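(* Let $H$ be a Hilbert space of functions on a set $\Omega$ with nonsingular reproducing kernel $k$, and let $D_\phi\subset\Omega$ be a set of uniqueness for $H$ and for $HH+HH=\{f_1f_2+f_3f_4: f_1,f_2,f_3,f_4\in H\}$. Let $m\ge 0$ be an integer. The following are equivalent for a function $\phi:D_\phi\to\mathbb{C}$: (1) $\phi$ is an $m$-pseudomultiplier of $H|D_\phi$ (regarded as a Hilbert space of functions on the set $D_\phi$); (2) there exists $t\ge 0$ such that the kernel $$(\lambda,\mu)\mapsto\bigl(t^2-\phi(\lambda)\overline{\phi(\mu)}\bigr)k(\lambda,\mu)$$ has at most $m$ negative squares on $D_\phi$; (3) there is an $m$-pseudomultiplier $\psi$ of $H$ (regarded as a Hilbert space of functions on $\Omega$) which extends $\phi$. Moreover, when these conditions hold, $\psi$ in (3) can be taken so that $$s_m(\phi)=s_m(\psi)=\inf t,$$ where the infimum is over all $t\ge 0$ for which the kernel in (2) has at most $m$ negative squares on $D_\phi$; here $s_m(\phi)$ is computed in $H|D_\phi$ and $s_m(\psi)$ in $H$.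
   Context: A Hilbert space of functions on a set $\Omega$ is a complex Hilbert space $H$ whose elements are functions $\Omega\to\mathbb{C}$ (with pointwise operations) such that all point evaluations $h\mapsto h(\lambda)$, $\lambda\in\Omega$, are continuous. Its reproducing kernel is $k(\mu,\lambda)=k_\lambda(\mu)$, where $k_\lambda\in H$ satisfies $\langle f,k_\lambda\rangle=f(\lambda)$ for all $f\in H$. The kernel $k$ is nonsingular if for all $n$ and distinct $\lambda_1,\dots,\lambda_n\in\Omega$ the matrix $[k(\lambda_i,\lambda_j)]_{i,j=1}^n$ is nonsingular. A subset $D\subset\Omega$ is a set of uniqueness for a class $\mathcal{C}$ of functions on $\Omega$ if $f,g\in\mathcal{C}$ and $f|D=g|D$ imply $f=g$. Write $H|D=\{h|D:h\in H\}$; if $D$ is a set of uniqueness for $H$, $H|D$ is a Hilbert space of functions on $D$ with the norm making $h\mapsto h|D$ a Hilbert space isomorphism $H\to H|D$; its kernel is the restriction of $k$ to $D\times D$. A kernel on a set $D$ is a function $\kappa:D\times D\to\mathbb{C}$ with $\kappa(\lambda,\mu)=\overline{\kappa(\mu,\lambda)}$. It has at most $m$ negative squares on $D$ if for all $n$ and all $\lambda_1,\dots,\lambda_n\in D$ the Hermitian matrix $[\kappa(\lambda_i,\lambda_j)]_{i,j=1}^n$ has at most $m$ negative eigenvalues, counted with multiplicity. For $\psi:D_\psi\subset\Omega\to\mathbb{C}$ and $h\in H$, $\psi h$ denotes the function on $D_\psi$ given by the pointwise product of $\psi$ and $h|D_\psi$; for $E\subset H$, $\psi E=\{\psi h:h\in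 E\}$. Suppose $D_\psi$ is a set of uniqueness for $H$. If $E$ is a closed subspace of $H$ with $\psi E\subset H|D_\psi$, then $M_{\psi,E}:E\to H$ is the (automatically bounded) linear operator sending $h$ to the unique element of $H$ extending $\psi h$. A point $\alpha\in\Omega$ is a singularity of $\psi$ (relative to $H$) if there exists $h\in H$ with $h(\alpha)=0$ such that $\psi h$ has an extension $g\in H$ with $g(\alpha)\neq 0$ (necessarily $\alpha\notin D_\psi$). For an integer $m\ge 0$, $\psi:D_\psi\subset\Omega\to\mathbb{C}$ is an $m$-pseudomultiplier of $H$ (a Hilbert space of functions on $\Omega$) if: (i) $D_\psi$ is a set of uniqueness for $H$; (ii) $\Omega\setminus D_\psi$ consists of singularities of $\psi$ and contains at most $m$ points; (iii) there is a closed subspace $E$ of codimension $m$ in $H$ such that $\psi E\subset H|D_\psi$. Then $s_m(\psi)$ is the infimum of $\|M_{\psi,E}\|$ over all closed subspaces $E$ of codimension $m$ in $H$ with $\psi E\subset H|D_\psi$. In the degenerate case $\dim H<m$ (so $\Omega$ is finite with fewer than $m$ points), by convention every function $\psi:\Omega\to\mathbb{C}$ is an $m$-pseudomultiplier and $s_m(\psi)=0$. The same definitions are applied with $(\Omega,H)$ replaced by $(D_\phi,H|D_\phi)$ in (1). *)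

theory Defs
  imports
    "HOL-Analysis.Abstract_Metric_Spaces"
    "HOL-Library.Function_Algebras"
    "Jordan_Normal_Form.Char_Poly"
begin

text \<open>
  A function on a set \<open>X\<close> is represented by a total function that vanishes outside \<open>X\<close>.
  With this convention the pointwise operations of \<open>Function_Algebras\<close> on the type
  \<open>'a \<Rightarrow> complex\<close> are those of functions on \<open>X\<close>.
\<close>

definition cscale :: "complex \<Rightarrow> ('a \<Rightarrow> complex) \<Rightarrow> 'a \<Rightarrow> complex" where
  "cscale c f = (\<lambda>x. c * f x)"

global_interpretation cfun: vector_space "cscale :: complex \<Rightarrow> ('a \<Rightarrow> complex) \<Rightarrow> 'a \<Rightarrow> complex"
  by unfold_locales (auto simp: cscale_def fun_eq_iff algebra_simps)

definition restr :: "'a set \<Rightarrow> ('a \<Rightarrow> complex) \<Rightarrow> 'a \<Rightarrow> complex" where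
  "restr D f = (\<lambda>x. if x \<in> D then f x else 0)"

text \<open>The dimension is \<open>n\<close>; in particular it is finite (unlike for the total function \<open>dim\<close>,
  which is \<open>0\<close> on infinite-dimensional spaces).\<close>

definition has_fin_dim :: "('a \<Rightarrow> complex) set \<Rightarrow> nat \<Rightarrow> bool" where
  "has_fin_dim V n \<longleftrightarrow> (\<exists>B. finite B \<and> card B = n \<and> cfun.independent B \<and> cfun.span B = V)"


section \<open>Hilbert spaces of functions\<close>

record 'a function_space =
  points :: "'a set"
  elements :: "('a \<Rightarrow> complex) set"
  inner_prod :: "('a \<Rightarrow> complex) \<Rightarrow> ('a \<Rightarrow> complex) \<Rightarrow> complex"

definition hnorm :: "'a function_space \<Rightarrow> ('a \<Rightarrow> complex) \<Rightarrow> real" where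
  "hnorm H f = sqrt (Re (inner_prod H f f))"

text \<open>The value \<open>0\<close> off the carrier is needed because the locale \<open>Metric_space\<close>
  demands nonnegativity and symmetry of the distance on the whole type.\<close>

definition hdist :: "'a function_space \<Rightarrow> ('a \<Rightarrow> complex) \<Rightarrow> ('a \<Rightarrow> complex) \<Rightarrow> real" where
  "hdist H f g = (if f \<in> elements H \<and> g \<in> elements H then hnorm H (f - g) else 0)"

abbreviation htopology :: "'a function_space \<Rightarrow> ('a \<Rightarrow> complex) topology" where
  "htopology H \<equiv> Metric_space.mtopology (elements H) (hdist H)"

locale hilbert_function_space =
  fixes H :: "'a function_space"
  assumes vanishes_outside: "\<And>f x. f \<in> elements H \<Longrightarrow> x \<notin> points H \<Longrightarrow> f x = 0"
    and subspace_elements: "cfun.subspace (elements H)"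
    and inner_add: "\<And>f g h. f \<in> elements H \<Longrightarrow> g \<in> elements H \<Longrightarrow> h \<in> elements H \<Longrightarrow>
          inner_prod H (f + g) h = inner_prod H f h + inner_prod H g h"
    and inner_scale: "\<And>c f g. f \<in> elements H \<Longrightarrow> g \<in> elements H \<Longrightarrow>
          inner_prod H (cscale c f) g = c * inner_prod H f g"
    and inner_commute: "\<And>f g. f \<in> elements H \<Longrightarrow> g \<in> elements H \<Longrightarrow>
          inner_prod H g f = cnj (inner_prod H f g)"
    and inner_nonneg: "\<And>f. f \<in> elements H \<Longrightarrow> 0 \<le> Re (inner_prod H f f)"
    and inner_definite: "\<And>f. f \<in> elements H \<Longrightarrow> inner_prod H f f = 0 \<Longrightarrow> f = 0"
    and complete: "Metric_space.mcomplete (elements H) (hdist H)"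
    and continuous_eval: "\<And>x. x \<in> points H \<Longrightarrow> continuous_map (htopology H) euclidean (\<lambda>h. h x)"

definition reproducing_kernel :: "'a function_space \<Rightarrow> ('a \<Rightarrow> 'a \<Rightarrow> complex) \<Rightarrow> bool" where
  "reproducing_kernel H k \<longleftrightarrow>
     (\<forall>l\<in>points H. (\<lambda>x. k x l) \<in> elements H \<and>
        (\<forall>f\<in>elements H. inner_prod H f (\<lambda>x. k x l) = f l))"

definition gram :: "('a \<Rightarrow> 'a \<Rightarrow> complex) \<Rightarrow> nat \<Rightarrow> (nat \<Rightarrow> 'a) \<Rightarrow> complex mat" where
  "gram k n l = Matrix.mat n n (\<lambda>(i, j). k (l i) (l j))"

definition nonsingular_kernel :: "'a set \<Rightarrow> ('a \<Rightarrow> 'a \<Rightarrow> complex) \<Rightarrow> bool" where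
  "nonsingular_kernel X k \<longleftrightarrow>
     (\<forall>n l. l ` {..<n} \<subseteq> X \<and> inj_on l {..<n} \<longrightarrow> invertible_mat (gram k n l))"

text \<open>The members of \<open>\<C>\<close> are meant to be functions on one set containing \<open>D\<close>,
  vanishing outside it.\<close>

definition set_of_uniqueness :: "'a set \<Rightarrow> ('a \<Rightarrow> complex) set \<Rightarrow> bool" where
  "set_of_uniqueness D \<C> \<longleftrightarrow> (\<forall>f\<in>\<C>. \<forall>g\<in>\<C>. (\<forall>x\<in>D. f x = g x) \<longrightarrow> f = g)"

text \<open>The space \<open>H|D\<close>, meaningful when \<open>D\<close> is a set of uniqueness for \<open>H\<close>: the inner
  product is transported along the bijection \<open>h \<mapsto> h|D\<close>.\<close>

definition restrict_space :: "'a function_space \<Rightarrow> 'a set \<Rightarrow> 'a function_space" where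
  "restrict_space H D =
     \<lparr>points = D,
      elements = restr D ` elements H,
      inner_prod = (\<lambda>f g. inner_prod H (the_inv_into (elements H) (restr D) f)
                                       (the_inv_into (elements H) (restr D) g))\<rparr>"


section \<open>Negative squares\<close>

definition num_neg_eigenvalues :: "complex mat \<Rightarrow> nat" where
  "num_neg_eigenvalues A =
     (\<Sum>x \<in> {x. eigenvalue A x \<and> x \<in> \<real> \<and> Re x < 0}. Polynomial.order x (char_poly A))"

definition at_most_neg_squares :: "'a set \<Rightarrow> ('a \<Rightarrow> 'a \<Rightarrow> complex) \<Rightarrow> nat \<Rightarrow> bool" where
  "at_most_neg_squares D \<kappa> m \<longleftrightarrow>
     (\<forall>x\<in>D. \<forall>y\<in>D. \<kappa> x y = cnj (\<kappa> y x)) \<and>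
     (\<forall>n l. l ` {..<n} \<subseteq> D \<longrightarrow> num_neg_eigenvalues (gram \<kappa> n l) \<le> m)"


section \<open>Pseudomultipliers\<close>

definition closed_subspace :: "'a function_space \<Rightarrow> ('a \<Rightarrow> complex) set \<Rightarrow> bool" where
  "closed_subspace H E \<longleftrightarrow> cfun.subspace E \<and> closedin (htopology H) E"

definition has_codim :: "'a function_space \<Rightarrow> ('a \<Rightarrow> complex) set \<Rightarrow> nat \<Rightarrow> bool" where
  "has_codim H E m \<longleftrightarrow>
     (\<exists>F. has_fin_dim F m \<and> F \<subseteq> elements H \<and> E \<inter> F = {0} \<and>
          elements H = {e + f | e f. e \<in> E \<and> f \<in> F})"

text \<open>A function \<open>\<psi> : D\<^sub>\<psi> \<rightarrow> \<complex>\<close> is given by its domain \<open>D\<close> and a total function \<open>\<psi>\<close> whose values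
  outside \<open>D\<close> are never used.\<close>

definition mult_fun :: "'a set \<Rightarrow> ('a \<Rightarrow> complex) \<Rightarrow> ('a \<Rightarrow> complex) \<Rightarrow> 'a \<Rightarrow> complex" where
  "mult_fun D \<psi> h = restr D (\<psi> * h)"

text \<open>\<open>\<psi> E \<subseteq> H|D\<close> for a closed subspace \<open>E\<close> of codimension \<open>m\<close>\<close>

definition admissible :: "'a function_space \<Rightarrow> nat \<Rightarrow> 'a set \<Rightarrow> ('a \<Rightarrow> complex) \<Rightarrow> ('a \<Rightarrow> complex) set \<Rightarrow> bool"
  where "admissible H m D \<psi> E \<longleftrightarrow>
     closed_subspace H E \<and> has_codim H E m \<and> mult_fun D \<psi> ` E \<subseteq> restr D ` elements H"

text \<open>The operator \<open>M\<^bsub>\<psi>,E\<^esub>\<close>; it depends on \<open>E\<close> only through its domain.\<close>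

definition mult_op :: "'a function_space \<Rightarrow> 'a set \<Rightarrow> ('a \<Rightarrow> complex) \<Rightarrow> ('a \<Rightarrow> complex) \<Rightarrow> 'a \<Rightarrow> complex"
  where "mult_op H D \<psi> h = (THE g. g \<in> elements H \<and> restr D g = mult_fun D \<psi> h)"

definition op_norm ::
  "'a function_space \<Rightarrow> ('a \<Rightarrow> complex) set \<Rightarrow> (('a \<Rightarrow> complex) \<Rightarrow> 'a \<Rightarrow> complex) \<Rightarrow> real" where
  "op_norm H E T = (SUP h\<in>{h\<in>E. hnorm H h \<le> 1}. hnorm H (T h))"

definition singularity :: "'a function_space \<Rightarrow> 'a set \<Rightarrow> ('a \<Rightarrow> complex) \<Rightarrow> 'a \<Rightarrow> bool" where
  "singularity H D \<psi> \<alpha> \<longleftrightarrow> \<alpha> \<in> points H \<and>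
     (\<exists>h\<in>elements H. h \<alpha> = 0 \<and> (\<exists>g\<in>elements H. restr D g = mult_fun D \<psi> h \<and> g \<alpha> \<noteq> 0))"

definition dim_less :: "'a function_space \<Rightarrow> nat \<Rightarrow> bool" where
  "dim_less H m \<longleftrightarrow> (\<exists>n<m. has_fin_dim (elements H) n)"

text \<open>When the dimension is less than \<open>m\<close> there are no subspaces of codimension \<open>m\<close>; by convention
  every function defined on all of \<open>points H\<close> is then an \<open>m\<close>-pseudomultiplier.\<close>

definition pseudomultiplier :: "'a function_space \<Rightarrow> nat \<Rightarrow> 'a set \<Rightarrow> ('a \<Rightarrow> complex) \<Rightarrow> bool" where
  "pseudomultiplier H m D \<psi> \<longleftrightarrow>
     (if dim_less H m then D = points H
      else D \<subseteq> points H \<and>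
        set_of_uniqueness D (elements H) \<and>
        (\<forall>\<alpha>\<in>points H - D. singularity H D \<psi> \<alpha>) \<and>
        finite (points H - D) \<and> card (points H - D) \<le> m \<and>
        (\<exists>E. admissible H m D \<psi> E))"

definition s_num :: "'a function_space \<Rightarrow> nat \<Rightarrow> 'a set \<Rightarrow> ('a \<Rightarrow> complex) \<Rightarrow> real" where
  "s_num H m D \<psi> =
     (if dim_less H m then 0
      else (INF E\<in>{E. admissible H m D \<psi> E}. op_norm H E (mult_op H D \<psi>)))"

end

theory Submission
  imports Defs
begin

text \<open>
  Let \<open>V\<close> be the space of finite combinations of the kernel functions \<open>k\<^sub>x\<close> with \<open>x\<close> in \<open>D\<close>, and let \<open>T\<close> be
  the operator \<open>k\<^sub>x \<mapsto> cnj (\<phi> x) k\<^sub>x\<close> on \<open>V\<close>. It is the formal adjoint of multiplication by \<open>\<phi>\<close>, and the kernel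
  \<open>(t\<^sup>2 - \<phi> x cnj (\<phi> y)) k x y\<close> is the matrix of the form \<open>Q f = t\<^sup>2 \<parallel>f\<parallel>\<^sup>2 - \<parallel>T f\<parallel>\<^sup>2\<close>. Hence the kernel
  has at most \<open>m\<close> negative squares iff \<open>Q\<close> is not negative definite on any space of dimension
  \<open>m + 1\<close> (\<open>at_most_neg_squares_iff\<close>, which rests on an orthonormal eigenbasis of a Hermitian matrix).

  If \<open>\<phi> E\<close> is contained in \<open>H|D\<close> for a closed subspace \<open>E\<close> of codimension \<open>m\<close>, multiplication by \<open>\<phi>\<close> on
  \<open>E\<close> is bounded by some \<open>t\<close> (\<open>multiplication_bounded\<close>), and duality gives \<open>\<parallel>T f\<parallel> \<le> t \<parallel>f\<parallel>\<close> whenever \<open>T f\<close>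
  lies in \<open>E\<close>. That is \<open>m\<close> linear conditions on \<open>f\<close>, so \<open>Q\<close> has at most \<open>m\<close> negative squares
  (\<open>codim_imp_neg_squares\<close>). Conversely, if \<open>Q\<close> has at most \<open>m\<close> negative squares, then
  \<open>\<parallel>T f\<parallel> \<le> t \<parallel>f\<parallel>\<close> on the \<open>Q\<close>-orthogonal complement of a maximal negative definite subspace. The adjoint
  \<open>S\<close> of this restricted operator has norm at most \<open>t\<close>, and \<open>S y\<close> is an extension of \<open>\<phi> y\<close> as soon as \<open>y\<close>
  satisfies one linear condition for each of the at most \<open>m\<close> omitted dimensions
  (\<open>neg_squares_imp_codim\<close>). So the bounds \<open>t\<close> with at most \<open>m\<close> negative squares are exactly the bounds
  for \<open>M\<^bsub>\<phi>,E\<^esub>\<close> over all \<open>E\<close>. They form a closed set (\<open>at_most_neg_squares_limit\<close>), so the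
  infimum \<open>s\<close> is attained by some \<open>E\<close>.

  For this \<open>E\<close>, extend \<open>\<phi>\<close> by \<open>\<psi> x = M h x / h x\<close> for any \<open>h\<close> in \<open>E\<close> with \<open>h x \<noteq> 0\<close>. The choice of \<open>h\<close> does
  not matter because \<open>M h\<^sub>1 * h\<^sub>2 - M h\<^sub>2 * h\<^sub>1\<close> vanishes on \<open>D\<close>, a set of uniqueness for \<open>HH + HH\<close>. At
  most \<open>m\<close> points are common zeros of \<open>E\<close>, as evaluations at distinct points are independent for a
  nonsingular kernel (\<open>common_zeros_card\<close>); at each of them outside \<open>D\<close>, \<open>\<psi>\<close> is singular or may be
  given any value (\<open>extend_multiplier\<close>). The same \<open>E\<close> is admissible for
  \<open>\<psi>\<close> with the same bound, and no subspace admissible for an extension of \<open>\<phi>\<close> has norm below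
  \<open>s\<close>, so \<open>s\<close> is the singular number of \<open>\<psi>\<close> and of \<open>\<phi>\<close> (\<open>s_num_eq_Inf\<close>). Statements about \<open>H|D\<close>
  are instances of those about \<open>H\<close>, since \<open>H|D\<close> is itself a Hilbert space of functions with the
  restricted kernel (\<open>kernel_space_restrict\<close>).
\<close>

section \<open>Inner product spaces of functions\<close>

lemma sum_fun_apply: "(\<Sum>i\<in>A. f i) x = (\<Sum>i\<in>A. f i x)"
  by (induction A rule: infinite_finite_induct) auto

lemma cscale_apply [simp]: "cscale c f x = c * f x"
  by (simp add: cscale_def)

abbreviation lincomb :: "nat \<Rightarrow> (nat \<Rightarrow> complex) \<Rightarrow> (nat \<Rightarrow> 'a \<Rightarrow> complex) \<Rightarrow> 'a \<Rightarrow> complex" where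
  "lincomb n a f \<equiv> (\<Sum>i<n. cscale (a i) (f i))"

text \<open>The vectors of \<open>\<complex>\<^sup>n\<close>, the elements of \<open>H\<close> and certain spaces of coefficient functions all
  carry inner products that are used below; this locale is their common part.\<close>

locale inner_product_functions =
  fixes V :: "('a \<Rightarrow> complex) set"
    and ip :: "('a \<Rightarrow> complex) \<Rightarrow> ('a \<Rightarrow> complex) \<Rightarrow> complex"
  assumes subspace: "cfun.subspace V"
    and ip_add_left: "\<And>f g h. f \<in> V \<Longrightarrow> g \<in> V \<Longrightarrow> h \<in> V \<Longrightarrow> ip (f + g) h = ip f h + ip g h"
    and ip_scale_left: "\<And>c f g. f \<in> V \<Longrightarrow> g \<in> V \<Longrightarrow> ip (cscale c f) g = c * ip f g"
    and ip_commute: "\<And>f g. f \<in> V \<Longrightarrow> g \<in> V \<Longrightarrow> ip g f = cnj (ip f g)"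
    and ip_nonneg: "\<And>f. f \<in> V \<Longrightarrow> 0 \<le> Re (ip f f)"
    and ip_definite: "\<And>f. f \<in> V \<Longrightarrow> ip f f = 0 \<Longrightarrow> f = 0"
begin

definition nrm :: "('a \<Rightarrow> complex) \<Rightarrow> real" where
  "nrm f = sqrt (Re (ip f f))"

lemma V_zero [simp, intro]: "0 \<in> V"
  using subspace by (rule cfun.subspace_0)
lemma V_add [simp, intro]: "f \<in> V \<Longrightarrow> g \<in> V \<Longrightarrow> f + g \<in> V"
  using subspace by (rule cfun.subspace_add)
lemma V_diff [simp, intro]: "f \<in> V \<Longrightarrow> g \<in> V \<Longrightarrow> f - g \<in> V"
  using subspace by (rule cfun.subspace_diff)
lemma V_uminus [simp, intro]: "f \<in> V \<Longrightarrow> - f \<in> V"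
  using subspace by (rule cfun.subspace_neg)
lemma V_scale [simp, intro]: "f \<in> V \<Longrightarrow> cscale c f \<in> V"
  using subspace by (rule cfun.subspace_scale)
lemma V_sum [simp, intro]: "(\<And>i. i \<in> A \<Longrightarrow> f i \<in> V) \<Longrightarrow> (\<Sum>i\<in>A. f i) \<in> V"
  using subspace by (rule cfun.subspace_sum)

lemma ip_add_right: "f \<in> V \<Longrightarrow> g \<in> V \<Longrightarrow> h \<in> V \<Longrightarrow> ip h (f + g) = ip h f + ip h g"
  by (subst (1 2 3) ip_commute) (auto simp: ip_add_left)
lemma ip_scale_right: "f \<in> V \<Longrightarrow> g \<in> V \<Longrightarrow> ip g (cscale c f) = cnj c * ip g f"
  by (subst (1 2) ip_commute) (auto simp: ip_scale_left)
lemma ip_zero_left [simp]: "f \<in> V \<Longrightarrow> ip 0 f = 0"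
  using ip_add_left[of 0 0 f] by simp
lemma ip_zero_right [simp]: "f \<in> V \<Longrightarrow> ip f 0 = 0"
  using ip_add_right[of 0 0 f] by simp
lemma ip_uminus_left: "f \<in> V \<Longrightarrow> g \<in> V \<Longrightarrow> ip (- f) g = - ip f g"
  using ip_add_left[of f "- f" g] by (simp add: eq_neg_iff_add_eq_0 add.commute)
lemma ip_uminus_right: "f \<in> V \<Longrightarrow> g \<in> V \<Longrightarrow> ip g (- f) = - ip g f"
  using ip_add_right[of f "- f" g] by (simp add: eq_neg_iff_add_eq_0 add.commute)
lemma ip_diff_left: "f \<in> V \<Longrightarrow> g \<in> V \<Longrightarrow> h \<in> V \<Longrightarrow> ip (f - g) h = ip f h - ip g h"
  using ip_add_left[of f "- g" h] by (simp add: ip_uminus_left)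
lemma ip_diff_right: "f \<in> V \<Longrightarrow> g \<in> V \<Longrightarrow> h \<in> V \<Longrightarrow> ip h (f - g) = ip h f - ip h g"
  using ip_add_right[of f "- g" h] by (simp add: ip_uminus_right)

lemma ip_sum_left:
  "(\<And>i. i \<in> A \<Longrightarrow> f i \<in> V) \<Longrightarrow> h \<in> V \<Longrightarrow> ip (\<Sum>i\<in>A. f i) h = (\<Sum>i\<in>A. ip (f i) h)"
  by (induction A rule: infinite_finite_induct) (auto simp: ip_add_left)
lemma ip_sum_right:
  "(\<And>i. i \<in> A \<Longrightarrow> f i \<in> V) \<Longrightarrow> h \<in> V \<Longrightarrow> ip h (\<Sum>i\<in>A. f i) = (\<Sum>i\<in>A. ip h (f i))"
  by (induction A rule: infinite_finite_induct) (auto simp: ip_add_right)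

lemmas ip_simps = ip_add_left ip_add_right ip_scale_left ip_scale_right ip_diff_left
  ip_diff_right ip_uminus_left ip_uminus_right

lemma nrm_nonneg [simp]: "f \<in> V \<Longrightarrow> 0 \<le> nrm f"
  by (simp add: nrm_def ip_nonneg)
lemma nrm_sq: "f \<in> V \<Longrightarrow> (nrm f)\<^sup>2 = Re (ip f f)"
  by (simp add: nrm_def ip_nonneg)
lemma ip_self: "f \<in> V \<Longrightarrow> ip f f = complex_of_real ((nrm f)\<^sup>2)"
  using ip_commute[of f f] by (simp add: nrm_sq complex_eq_iff)
lemma nrm_eq_0: "f \<in> V \<Longrightarrow> nrm f = 0 \<longleftrightarrow> f = 0"
  using ip_self[of f] ip_definite[of f] by (auto simp: nrm_def)
lemma nrm_zero [simp]: "nrm 0 = 0"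
  by (simp add: nrm_eq_0)
lemma nrm_scale: "f \<in> V \<Longrightarrow> nrm (cscale c f) = cmod c * nrm f"
proof -
  assume f: "f \<in> V"
  have "complex_of_real ((nrm (cscale c f))\<^sup>2) = c * cnj c * ip f f"
    using f by (simp add: ip_self[symmetric] ip_simps del: of_real_power)
  also have "\<dots> = complex_of_real ((cmod c * nrm f)\<^sup>2)"
    using f complex_norm_square[of c] by (simp add: ip_self power_mult_distrib)
  finally have "(nrm (cscale c f))\<^sup>2 = (cmod c * nrm f)\<^sup>2"
    using of_real_eq_iff by blast
  then show ?thesis
    using f by (simp add: power2_eq_iff_nonneg)
qed
lemma nrm_uminus: "f \<in> V \<Longrightarrow> nrm (- f) = nrm f"
  by (simp add: nrm_def ip_simps)
lemma nrm_minus_commute: "f \<in> V \<Longrightarrow> g \<in> V \<Longrightarrow> nrm (f - g) = nrm (g - f)"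
  using nrm_uminus[of "f - g"] by simp

lemma nrm_add_sq:
  "f \<in> V \<Longrightarrow> g \<in> V \<Longrightarrow> (nrm (f + g))\<^sup>2 = (nrm f)\<^sup>2 + (nrm g)\<^sup>2 + 2 * Re (ip f g)"
  using ip_commute[of f g] by (simp add: nrm_sq ip_simps)

lemma cauchy_schwarz:
  assumes "f \<in> V" "g \<in> V" shows "cmod (ip f g) \<le> nrm f * nrm g"
proof (cases "g = 0")
  case False
  then have g: "(nrm g)\<^sup>2 > 0" using assms by (simp add: nrm_eq_0)
  \<comment> \<open>the remainder of the projection of \<open>f\<close> to the line of \<open>g\<close> has nonnegative square\<close>
  define c where "c = - ip f g / complex_of_real ((nrm g)\<^sup>2)"
  have "0 \<le> (nrm (f + cscale c g))\<^sup>2" by simp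
  also have "\<dots> = (nrm f)\<^sup>2 + (cmod c)\<^sup>2 * (nrm g)\<^sup>2 + 2 * Re (cnj c * ip f g)"
    using assms by (simp add: nrm_add_sq nrm_scale ip_simps power_mult_distrib)
  also have "cnj c * ip f g = complex_of_real (- (cmod (ip f g))\<^sup>2 / (nrm g)\<^sup>2)"
    by (simp add: c_def mult.commute complex_norm_square[symmetric] del: of_real_power)
  also have "(cmod c)\<^sup>2 * (nrm g)\<^sup>2 = (cmod (ip f g))\<^sup>2 / (nrm g)\<^sup>2"
    using g by (simp add: c_def norm_divide norm_mult divide_simps power2_eq_square)
  finally have "(cmod (ip f g))\<^sup>2 / (nrm g)\<^sup>2 \<le> (nrm f)\<^sup>2" by simp
  then have "(cmod (ip f g))\<^sup>2 \<le> (nrm f * nrm g)\<^sup>2"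
    using g pos_divide_le_eq[OF g] by (simp add: power_mult_distrib)
  then show ?thesis by (rule power2_le_imp_le) (use assms in simp)
qed (use assms in simp)

lemma nrm_triangle: assumes "f \<in> V" "g \<in> V" shows "nrm (f + g) \<le> nrm f + nrm g"
proof -
  have "(nrm (f + g))\<^sup>2 \<le> (nrm f + nrm g)\<^sup>2"
    using assms cauchy_schwarz[of f g] complex_Re_le_cmod[of "ip f g"]
    by (simp add: nrm_add_sq power2_sum)
  then show ?thesis by (rule power2_le_imp_le) (use assms in simp)
qed
lemma nrm_triangle3:
  "f \<in> V \<Longrightarrow> g \<in> V \<Longrightarrow> h \<in> V \<Longrightarrow> nrm (f - h) \<le> nrm (f - g) + nrm (g - h)"
  using nrm_triangle[of "f - g" "g - h"] by simp
lemma nrm_sum: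
  "(\<And>i. i \<in> A \<Longrightarrow> f i \<in> V) \<Longrightarrow> nrm (\<Sum>i\<in>A. f i) \<le> (\<Sum>i\<in>A. nrm (f i))"
proof (induction A rule: infinite_finite_induct)
  case (insert x A)
  have "nrm (sum f (insert x A)) = nrm (f x + sum f A)" using insert by simp
  also have "\<dots> \<le> nrm (f x) + nrm (sum f A)"
    using insert.prems by (intro nrm_triangle) auto
  also have "\<dots> \<le> nrm (f x) + (\<Sum>i\<in>A. nrm (f i))" using insert by simp
  also have "\<dots> = (\<Sum>i\<in>insert x A. nrm (f i))" using insert(1,2) by simp
  finally show ?case .
qed auto

lemma parallelogram:
  "f \<in> V \<Longrightarrow> g \<in> V \<Longrightarrow> (nrm (f - g))\<^sup>2 = 2 * (nrm f)\<^sup>2 + 2 * (nrm g)\<^sup>2 - (nrm (f + g))\<^sup>2"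
  using nrm_add_sq[of f "- g"] nrm_add_sq[of f g] by (simp add: ip_simps nrm_uminus)

definition orthonormal :: "(nat \<Rightarrow> 'a \<Rightarrow> complex) \<Rightarrow> nat \<Rightarrow> bool" where
  "orthonormal b r \<longleftrightarrow>
     (\<forall>i<r. b i \<in> V) \<and> (\<forall>i<r. \<forall>j<r. ip (b i) (b j) = (if i = j then 1 else 0))"

lemma ip_orthonormal_sum:
  assumes "orthonormal b r" "j < r"
  shows "ip (lincomb r a b) (b j) = a j"
proof -
  have "ip (lincomb r a b) (b j) = (\<Sum>i<r. ip (cscale (a i) (b i)) (b j))"
    using assms by (intro ip_sum_left) (auto simp: orthonormal_def)
  also have "\<dots> = (\<Sum>i<r. if i = j then a i else 0)"
    using assms by (intro sum.cong) (auto simp: orthonormal_def ip_simps)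
  finally have "ip (lincomb r a b) (b j) = (\<Sum>i<r. if i = j then a i else 0)" .
  then show ?thesis using assms by (simp add: sum.delta)
qed

definition proj :: "(nat \<Rightarrow> 'a \<Rightarrow> complex) \<Rightarrow> nat \<Rightarrow> ('a \<Rightarrow> complex) \<Rightarrow> 'a \<Rightarrow> complex" where
  "proj b r f = (\<Sum>i<r. cscale (ip f (b i)) (b i))"

lemma proj_in [simp]: "orthonormal b r \<Longrightarrow> proj b r f \<in> V"
  by (auto simp: proj_def orthonormal_def)

lemma ip_minus_proj:
  assumes "orthonormal b r" "f \<in> V" "j < r" shows "ip (f - proj b r f) (b j) = 0"
proof -
  have "b j \<in> V" using assms by (auto simp: orthonormal_def)
  then show ?thesis
    using assms ip_orthonormal_sum[OF assms(1,3)] proj_in[OF assms(1)]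
    by (simp add: ip_diff_left) (simp add: proj_def)
qed

lemma proj_in_span: "proj b r f \<in> cfun.span (b ` {..<r})"
  unfolding proj_def
  by (intro cfun.span_sum cfun.span_scale cfun.span_base) auto

text \<open>One step of the Gram--Schmidt process.\<close>

lemma orthonormal_extend:
  assumes b: "orthonormal b r" and f: "f \<in> V" "f \<notin> cfun.span (b ` {..<r})"
  obtains b' where "orthonormal b' (Suc r)" "\<And>i. i < r \<Longrightarrow> b' i = b i"
    "f \<in> cfun.span (b' ` {..<Suc r})"
proof -
  define g where "g = f - proj b r f"
  have gV: "g \<in> V" using b f by (simp add: g_def)
  have "g \<noteq> 0" using f proj_in_span[of b r f] by (auto simp: g_def)
  then have ng: "nrm g > 0" using gV nrm_nonneg[OF gV] nrm_eq_0[OF gV] by linarith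
  define u where "u = cscale (complex_of_real (1 / nrm g)) g"
  define b' where "b' = b(r := u)"
  have uV: "u \<in> V" using gV by (simp add: u_def)
  have u1: "ip u u = 1"
    using ng gV by (simp add: ip_self nrm_scale u_def norm_divide)
  have ub: "ip u (b i) = 0" if "i < r" for i
    using that b ip_minus_proj[OF b f(1) that] gV
    by (simp add: u_def orthonormal_def ip_scale_left flip: g_def)
  have bu: "ip (b i) u = 0" if "i < r" for i
    using ub[OF that] ip_commute[of u "b i"] uV b that by (auto simp: orthonormal_def)
  have "orthonormal b' (Suc r)"
    using b uV u1 ub bu by (auto simp: orthonormal_def b'_def less_Suc_eq)
  moreover have "f \<in> cfun.span (b' ` {..<Suc r})"
  proof -
    have img: "b' ` {..<Suc r} = insert u (b ` {..<r})"
      by (auto simp: b'_def lessThan_Suc)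
    have "g = cscale (complex_of_real (nrm g)) u"
      using ng by (simp add: u_def)
    then have "g \<in> cfun.span (b' ` {..<Suc r})"
      unfolding img by (metis cfun.span_base cfun.span_scale insertI1)
    moreover have "proj b r f \<in> cfun.span (b' ` {..<Suc r})"
      unfolding img using proj_in_span cfun.span_mono by blast
    ultimately have "g + proj b r f \<in> cfun.span (b' ` {..<Suc r})" by (rule cfun.span_add)
    then show ?thesis by (simp add: g_def)
  qed
  ultimately show thesis using that[of b'] by (simp add: b'_def)
qed

lemma orthonormal_inj: "orthonormal b r \<Longrightarrow> inj_on b {..<r}"
  unfolding orthonormal_def inj_on_def by (metis lessThan_iff zero_neq_one)

lemma orthonormal_independent: assumes b: "orthonormal b r" shows "cfun.independent (b ` {..<r})"
proof (subst cfun.independent_explicit_finite_subsets, intro allI impI ballI)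
  fix S u v assume S: "S \<subseteq> b ` {..<r}" "finite S" "(\<Sum>v\<in>S. cscale (u v) v) = 0" "v \<in> S"
  then obtain j where j: "j < r" "v = b j" by auto
  have "0 = ip (\<Sum>w\<in>S. cscale (u w) w) (b j)"
    using S b j by (simp add: orthonormal_def)
  also have "\<dots> = (\<Sum>w\<in>S. u w * ip w (b j))"
    using S b j by (subst ip_sum_left) (auto simp: orthonormal_def ip_scale_left subset_eq intro!: sum.cong)
  also have "\<dots> = (\<Sum>w\<in>S. if w = v then u w else 0)"
    using S(1) b j
  proof (intro sum.cong refl)
    fix w assume "w \<in> S"
    then obtain i where "i < r" "w = b i" using S(1) by auto
    then show "u w * ip w (b j) = (if w = v then u w else 0)"
      using b j orthonormal_inj[OF b] by (auto simp: orthonormal_def inj_on_def)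
  qed
  also have "\<dots> = u v" using S by (simp add: sum.delta)
  finally show "u v = 0" by simp
qed

lemma orthonormal_span_subset: "orthonormal b r \<Longrightarrow> cfun.span (b ` {..<r}) \<subseteq> V"
  by (intro cfun.span_minimal subspace) (auto simp: orthonormal_def)

lemma orthonormal_has_fin_dim: "orthonormal b r \<Longrightarrow> has_fin_dim (cfun.span (b ` {..<r})) r"
  unfolding has_fin_dim_def
  by (intro exI[of _ "b ` {..<r}"])
    (auto simp: orthonormal_independent orthonormal_inj card_image)

text \<open>Together, the next two lemmas turn at most \<open>m\<close> linear conditions, each an orthogonality to some
  vector, into orthogonality to exactly \<open>m\<close> orthonormal vectors. This is where spaces of dimension
  less than \<open>m\<close> have to be excluded.\<close>

lemma orthonormal_cover:
  fixes e :: "nat \<Rightarrow> 'a \<Rightarrow> complex"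
  assumes "\<And>i. i < n \<Longrightarrow> e i \<in> V"
  shows "\<exists>b r. orthonormal b r \<and> r \<le> n \<and> e ` {..<n} \<subseteq> cfun.span (b ` {..<r})"
  using assms
proof (induction n)
  case 0
  have "orthonormal (\<lambda>_. 0) 0" by (simp add: orthonormal_def)
  then show ?case by fastforce
next
  case (Suc n)
  then obtain b r where b: "orthonormal b r" "r \<le> n"
    "e ` {..<n} \<subseteq> cfun.span (b ` {..<r})" by (meson less_SucI)
  show ?case
  proof (cases "e n \<in> cfun.span (b ` {..<r})")
    case True
    then have "e ` {..<Suc n} \<subseteq> cfun.span (b ` {..<r})" using b(3) by (auto simp: lessThan_Suc)
    then show ?thesis using b(1,2) le_SucI by blast
  next
    case False
    obtain b' where b': "orthonormal b' (Suc r)" "\<And>i. i < r \<Longrightarrow> b' i = b i"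
      "e n \<in> cfun.span (b' ` {..<Suc r})"
      using orthonormal_extend[OF b(1) Suc.prems[OF lessI] False] by metis
    have "b ` {..<r} = b' ` {..<r}" using b'(2) by (intro image_cong) auto
    then have "b ` {..<r} \<subseteq> b' ` {..<Suc r}" by (auto simp: lessThan_Suc)
    then have "cfun.span (b ` {..<r}) \<subseteq> cfun.span (b' ` {..<Suc r})" by (rule cfun.span_mono)
    then have "e ` {..<Suc n} \<subseteq> cfun.span (b' ` {..<Suc r})"
      using b(3) b'(3) by (auto simp: lessThan_Suc)
    then show ?thesis using b'(1) b(2) Suc_le_mono by blast
  qed
qed

lemma orthonormal_lengthen:
  assumes b: "orthonormal b r" and "r \<le> m" and large: "\<And>n. n < m \<Longrightarrow> \<not> has_fin_dim V n"
  obtains b' where "orthonormal b' m" "\<And>i. i < r \<Longrightarrow> b' i = b i"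
proof -
  have "\<exists>b'. orthonormal b' (r + d) \<and> (\<forall>i<r. b' i = b i)" if "r + d \<le> m" for d
    using that
  proof (induction d)
    case 0 then show ?case using b by auto
  next
    case (Suc d)
    then obtain c where c: "orthonormal c (r + d)" "\<forall>i<r. c i = b i" by auto
    have "cfun.span (c ` {..<r + d}) \<noteq> V"
      using orthonormal_has_fin_dim[OF c(1)] large[of "r + d"] Suc.prems by auto
    then obtain f where f: "f \<in> V" "f \<notin> cfun.span (c ` {..<r + d})"
      using orthonormal_span_subset[OF c(1)] by blast
    obtain c' where "orthonormal c' (Suc (r + d))" "\<And>i. i < r + d \<Longrightarrow> c' i = c i"
      using orthonormal_extend[OF c(1) f] by metis
    then show ?case using c(2) by (intro exI[of _ c']) auto
  qed
  from this[of "m - r"] show thesis using assms(2) that by auto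
qed

end

section \<open>Hermitian matrices\<close>

lemma underdetermined_system_on:
  fixes A :: "nat \<Rightarrow> 'b \<Rightarrow> complex"
  assumes "finite J" "m < card J"
  shows "\<exists>c. (\<exists>j\<in>J. c j \<noteq> 0) \<and> (\<forall>i<m. (\<Sum>j\<in>J. A i j * c j) = 0)"
  using assms
proof (induction m arbitrary: J A)
  case 0
  then have "J \<noteq> {}" by auto
  then show ?case by (intro exI[of _ "\<lambda>_. 1"]) auto
next
  case (Suc m)
  show ?case
  proof (cases "\<exists>p\<in>J. A m p \<noteq> 0")
    case False
    obtain c where "\<exists>j\<in>J. c j \<noteq> 0" "\<forall>i<m. (\<Sum>j\<in>J. A i j * c j) = 0"
      using Suc.IH[of J A] Suc.prems by auto
    then show ?thesis using False by (intro exI[of _ c]) (auto simp: less_Suc_eq)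
  next
    case True
    \<comment> \<open>eliminate the unknown \<open>p\<close> by means of the last equation\<close>
    then obtain p where p: "p \<in> J" "A m p \<noteq> 0" by auto
    define B where "B i j = A i j - A i p * A m j / A m p" for i j
    have "m < card (J - {p})" using Suc.prems p by simp
    then obtain c where c: "\<exists>j\<in>J - {p}. c j \<noteq> 0" "\<forall>i<m. (\<Sum>j\<in>J - {p}. B i j * c j) = 0"
      using Suc.IH[of "J - {p}" B] Suc.prems by auto
    define s where "s = (\<Sum>j\<in>J - {p}. A m j * c j)"
    define c' where "c' = c(p := - s / A m p)"
    have split: "(\<Sum>j\<in>J. A i j * c' j) = A i p * (- s / A m p) + (\<Sum>j\<in>J - {p}. A i j * c j)" for i
    proof -
      have "(\<Sum>j\<in>J. A i j * c' j) = A i p * c' p + (\<Sum>j\<in>J - {p}. A i j * c' j)"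
        using Suc.prems p by (intro sum.remove) auto
      also have "(\<Sum>j\<in>J - {p}. A i j * c' j) = (\<Sum>j\<in>J - {p}. A i j * c j)"
        by (intro sum.cong) (auto simp: c'_def)
      finally show ?thesis by (simp add: c'_def)
    qed
    have "(\<Sum>j\<in>J. A i j * c' j) = 0" if "i < Suc m" for i
    proof (cases "i = m")
      case True
      then show ?thesis using split[of m] p by (simp add: s_def)
    next
      case False
      then have "(\<Sum>j\<in>J - {p}. B i j * c j) = 0" using c that by auto
      moreover have "(\<Sum>j\<in>J - {p}. B i j * c j) =
          (\<Sum>j\<in>J - {p}. A i j * c j) - A i p / A m p * s"
        by (simp add: B_def s_def algebra_simps sum_subtractf sum_distrib_left)
      ultimately show ?thesis using split[of i] by simp
    qed
    moreover have "\<exists>j\<in>J. c' j \<noteq> 0" using c by (auto simp: c'_def)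
    ultimately show ?thesis by blast
  qed
qed

lemma underdetermined_system:
  fixes A :: "nat \<Rightarrow> nat \<Rightarrow> complex"
  assumes "m < n"
  shows "\<exists>c. (\<exists>j<n. c j \<noteq> 0) \<and> (\<forall>i<m. (\<Sum>j<n. A i j * c j) = 0)"
  using underdetermined_system_on[of "{..<n}" m A] assms by auto

text \<open>A vector of \<open>\<complex>\<^sup>n\<close> is a function on \<open>\<nat>\<close> vanishing from \<open>n\<close> on, so that the dimension can vary in
  an induction and \<open>inner_product_functions\<close> applies.\<close>

definition cspace :: "nat \<Rightarrow> (nat \<Rightarrow> complex) set" where
  "cspace n = {f. \<forall>i\<ge>n. f i = 0}"

definition cinner :: "nat \<Rightarrow> (nat \<Rightarrow> complex) \<Rightarrow> (nat \<Rightarrow> complex) \<Rightarrow> complex" where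
  "cinner n f g = (\<Sum>i<n. f i * cnj (g i))"

lemma inner_product_cspace: "inner_product_functions (cspace n) (cinner n)"
proof
  show "cfun.subspace (cspace n)"
    by (auto simp: cfun.subspace_def cspace_def)
  fix f g h :: "nat \<Rightarrow> complex" and c
  show "cinner n (f + g) h = cinner n f h + cinner n g h"
    by (simp add: cinner_def sum.distrib distrib_right)
  show "cinner n (cscale c f) g = c * cinner n f g"
    by (simp add: cinner_def sum_distrib_left mult_ac)
  show "cinner n g f = cnj (cinner n f g)"
    by (simp add: cinner_def mult_ac)
  show "0 \<le> Re (cinner n f f)"
    by (simp add: cinner_def sum_nonneg)
  assume "f \<in> cspace n" "cinner n f f = 0"
  moreover have "cinner n f f = complex_of_real (\<Sum>i<n. (cmod (f i))\<^sup>2)"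
    by (simp add: cinner_def complex_norm_square del: of_real_power)
  ultimately have "(\<Sum>i<n. (cmod (f i))\<^sup>2) = 0"
    using of_real_eq_0_iff by metis
  then have "\<forall>i<n. f i = 0" by (subst (asm) sum_nonneg_eq_0_iff) auto
  then show "f = 0" using \<open>f \<in> cspace n\<close>
    by (auto simp: cspace_def fun_eq_iff) (meson not_less)
qed

interpretation cspace: inner_product_functions "cspace n" "cinner n" for n
  by (rule inner_product_cspace)

text \<open>The vector \<open>p(A) v\<close> for a polynomial \<open>p\<close> and a linear operator \<open>A\<close>.\<close>

definition poly_act ::
  "(('a \<Rightarrow> complex) \<Rightarrow> ('a \<Rightarrow> complex)) \<Rightarrow> ('a \<Rightarrow> complex) \<Rightarrow> complex poly \<Rightarrow> 'a \<Rightarrow> complex" where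
  "poly_act A v p = fold_coeffs (\<lambda>a w. cscale a v + A w) p 0"

context
  fixes A :: "('a \<Rightarrow> complex) \<Rightarrow> ('a \<Rightarrow> complex)"
  assumes A_add: "\<And>f g. A (f + g) = A f + A g"
    and A_scale: "\<And>c f. A (cscale c f) = cscale c (A f)"
begin

lemma A_zero: "A 0 = 0"
  using A_add[of 0 0] by simp

lemma poly_act_0 [simp]: "poly_act A v 0 = 0"
  by (simp add: poly_act_def)

lemma poly_act_pCons: "poly_act A v (pCons a p) = cscale a v + A (poly_act A v p)"
  by (cases "a = 0 \<and> p = 0") (auto simp: poly_act_def A_zero)

lemma poly_act_add: "poly_act A v (p + q) = poly_act A v p + poly_act A v q"
proof (induction p q rule: poly_induct2)
  case (pCons a p b q)
  then show ?case
    by (simp add: poly_act_pCons A_add cfun.scale_left_distrib add_ac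
        del: plus_fun_apply cscale_apply)
qed simp

lemma poly_act_smult: "poly_act A v (Polynomial.smult c p) = cscale c (poly_act A v p)"
  by (induction p)
    (simp_all add: poly_act_pCons A_scale cfun.scale_right_distrib
      del: plus_fun_apply zero_fun_apply cscale_apply)

lemma poly_act_monom: "poly_act A v (Polynomial.monom c j) = cscale c ((A ^^ j) v)"
  by (induction j)
    (simp_all add: poly_act_pCons monom_0 monom_Suc A_scale A_zero del: plus_fun_apply cscale_apply)

lemma poly_act_linear_factor:
  "poly_act A v ([:- z, 1:] * q) = A (poly_act A v q) - cscale z (poly_act A v q)"
proof -
  have "[:- z, 1:] * q = Polynomial.smult (- z) q + pCons 0 q" by simp
  then show ?thesis
    by (simp only: poly_act_add poly_act_smult poly_act_pCons) (simp add: fun_eq_iff)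
qed

lemma poly_act_sum: "poly_act A v (\<Sum>i\<in>I. p i) = (\<Sum>i\<in>I. poly_act A v (p i))"
  by (induction I rule: infinite_finite_induct) (auto simp: poly_act_add)

lemma poly_act_in:
  assumes "cfun.subspace W" "\<And>f. f \<in> W \<Longrightarrow> A f \<in> W" "v \<in> W"
  shows "poly_act A v p \<in> W"
  using assms
  by (induction p) (auto simp: poly_act_pCons cfun.subspace_0 cfun.subspace_add cfun.subspace_scale)

text \<open>A polynomial \<open>q\<close> of minimal degree with \<open>q(A) v = 0\<close> has a root \<open>z\<close>, and \<open>(q/(x - z))(A) v\<close> is an
  eigenvector for \<open>z\<close>.\<close>

lemma invariant_subspace_eigenvector:
  assumes W: "cfun.subspace W" "\<And>f. f \<in> W \<Longrightarrow> A f \<in> W" and v: "v \<in> W" "v \<noteq> 0"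
    and p: "p \<noteq> 0" "poly_act A v p = 0"
  shows "\<exists>z. \<exists>w\<in>W. w \<noteq> 0 \<and> A w = cscale z w"
proof -
  define P where "P p \<longleftrightarrow> p \<noteq> 0 \<and> poly_act A v p = 0" for p
  have "\<exists>q. P q \<and> (\<forall>r. P r \<longrightarrow> degree q \<le> degree r)"
    using ex_has_least_nat[of P p degree] p by (auto simp: P_def)
  then obtain q where q: "P q" and min: "\<And>r. P r \<Longrightarrow> degree q \<le> degree r" by auto
  have "degree q \<noteq> 0"
  proof
    assume "degree q = 0"
    then obtain a where "q = [:a:]" by (rule degree_eq_zeroE)
    then have "a \<noteq> 0" "cscale a v = 0" using q by (auto simp: P_def poly_act_pCons A_zero)
    then show False using v by (auto simp: fun_eq_iff)
  qed
  then have "\<not> constant (poly q)" by (simp add: constant_degree)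
  then obtain z where "poly q z = 0" using fundamental_theorem_of_algebra by blast
  then obtain r where r: "q = [:- z, 1:] * r" using poly_eq_0_iff_dvd by (metis dvdE)
  have r0: "r \<noteq> 0" using r q by (auto simp: P_def)
  then have "degree q = Suc (degree r)" unfolding r by (subst degree_mult_eq) auto
  then have "\<not> P r" using min[of r] by auto
  then have "poly_act A v r \<noteq> 0" using r0 by (simp add: P_def)
  moreover have "A (poly_act A v r) = cscale z (poly_act A v r)"
    using q poly_act_linear_factor[of v z r] unfolding r P_def by (metis eq_iff_diff_eq_0)
  moreover have "poly_act A v r \<in> W" using W v(1) by (rule poly_act_in)
  ultimately show ?thesis by blast
qed

end

definition mat_act :: "nat \<Rightarrow> (nat \<Rightarrow> nat \<Rightarrow> complex) \<Rightarrow> (nat \<Rightarrow> complex) \<Rightarrow> nat \<Rightarrow> complex" where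
  "mat_act n G f = (\<lambda>i. if i < n then (\<Sum>j<n. G i j * f j) else 0)"

lemma mat_act_add: "mat_act n G (f + g) = mat_act n G f + mat_act n G g"
  by (auto simp: mat_act_def fun_eq_iff distrib_left sum.distrib)

lemma mat_act_scale: "mat_act n G (cscale c f) = cscale c (mat_act n G f)"
  by (auto simp: mat_act_def fun_eq_iff sum_distrib_left mult_ac)

lemma mat_act_in [simp]: "mat_act n G f \<in> cspace n"
  by (simp add: mat_act_def cspace_def)

lemma mat_act_symmetric:
  assumes "\<And>i j. i < n \<Longrightarrow> j < n \<Longrightarrow> G i j = cnj (G j i)"
  shows "cinner n (mat_act n G f) g = cinner n f (mat_act n G g)"
proof -
  have "cinner n (mat_act n G f) g = (\<Sum>i<n. \<Sum>j<n. G i j * f j * cnj (g i))"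
    by (simp add: cinner_def mat_act_def sum_distrib_right)
  also have "\<dots> = (\<Sum>j<n. \<Sum>i<n. G i j * f j * cnj (g i))" by (rule sum.swap)
  also have "\<dots> = (\<Sum>j<n. \<Sum>i<n. f j * (cnj (G j i) * cnj (g i)))"
    by (intro sum.cong refl, subst assms) (simp_all add: mult_ac)
  also have "\<dots> = cinner n f (mat_act n G g)"
    by (simp add: cinner_def mat_act_def sum_distrib_left)
  finally show ?thesis .
qed

text \<open>The orthogonal complement of a set of eigenvectors is invariant under a Hermitian matrix, and it
  is nonzero if the number of eigenvectors is less than the dimension.\<close>

lemma hermitian_eigenvector_complement:
  assumes G: "\<And>i j. i < n \<Longrightarrow> j < n \<Longrightarrow> G i j = cnj (G j i)"
    and b: "\<And>i. i < r \<Longrightarrow> b i \<in> cspace n" "\<And>i. i < r \<Longrightarrow> mat_act n G (b i) = cscale (d i) (b i)"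
    and "r < n"
  shows "\<exists>z. \<exists>w\<in>cspace n. w \<noteq> 0 \<and> mat_act n G w = cscale z w \<and> (\<forall>i<r. cinner n w (b i) = 0)"
proof -
  define W where "W = {f \<in> cspace n. \<forall>i<r. cinner n f (b i) = 0}"
  have W: "cfun.subspace W"
  proof (rule cfun.subspaceI)
    show "0 \<in> W" using b by (simp add: W_def cspace.ip_zero_left cspace.V_zero)
    fix x y c assume x: "x \<in> W"
    then show "cscale c x \<in> W" using b by (simp add: W_def cspace.ip_scale_left cspace.V_scale)
    assume "y \<in> W"
    then show "x + y \<in> W" using x b by (simp add: W_def cspace.ip_add_left cspace.V_add)
  qed
  have inv: "mat_act n G f \<in> W" if "f \<in> W" for f
    using that b mat_act_symmetric[of n G, OF G] by (simp add: W_def cspace.ip_scale_right)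
  obtain c where c: "\<exists>j<n. c j \<noteq> 0" "\<forall>i<r. (\<Sum>j<n. cnj (b i j) * c j) = 0"
    using underdetermined_system[OF \<open>r < n\<close>, of "\<lambda>i j. cnj (b i j)"] by auto
  define v where "v j = (if j < n then c j else 0)" for j
  have v: "v \<in> W" "v \<noteq> 0"
    using c by (auto simp: v_def W_def cspace_def cinner_def mult.commute fun_eq_iff)
  \<comment> \<open>\<open>v, A v, \<dots>, A\<^sup>n v\<close> are \<open>n + 1\<close> vectors in an \<open>n\<close>-dimensional space\<close>
  obtain a where a: "\<exists>j<Suc n. a j \<noteq> 0"
    "\<forall>i<n. (\<Sum>j<Suc n. ((mat_act n G ^^ j) v) i * a j) = 0"
    using underdetermined_system[of n "Suc n" "\<lambda>i j. ((mat_act n G ^^ j) v) i"] by auto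
  define p where "p = (\<Sum>j<Suc n. Polynomial.monom (a j) j)"
  have "coeff p j = a j" if "j < Suc n" for j
    using that by (simp add: p_def coeff_sum del: sum.lessThan_Suc)
  then have "p \<noteq> 0" using a(1) by (metis coeff_0)
  moreover have "poly_act (mat_act n G) v p = 0"
  proof
    fix i
    have *: "poly_act (mat_act n G) v p = (\<Sum>j<Suc n. cscale (a j) ((mat_act n G ^^ j) v))"
      unfolding p_def
      by (simp add: poly_act_sum poly_act_monom mat_act_add mat_act_scale del: sum.lessThan_Suc)
    have vn: "v \<in> cspace n" using v by (simp add: W_def)
    have pow: "(mat_act n G ^^ j) v \<in> cspace n" for j by (induction j) (auto simp: vn)
    show "poly_act (mat_act n G) v p i = 0 i"
    proof (cases "i < n")
      case True
      then show ?thesis using a(2)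
        by (simp add: * sum_fun_apply mult.commute del: sum.lessThan_Suc)
    next
      case False
      then have "((mat_act n G ^^ j) v) i = 0" for j using pow[of j] by (simp add: cspace_def)
      then show ?thesis by (simp add: * sum_fun_apply del: sum.lessThan_Suc)
    qed
  qed
  ultimately obtain z w where "w \<in> W" "w \<noteq> 0" "mat_act n G w = cscale z w"
    using invariant_subspace_eigenvector[of "mat_act n G" W v p, OF mat_act_add mat_act_scale W inv v]
    by blast
  then show ?thesis by (auto simp: W_def)
qed

lemma hermitian_eigenbasis:
  assumes G: "\<And>i j. i < n \<Longrightarrow> j < n \<Longrightarrow> G i j = cnj (G j i)"
  obtains b :: "nat \<Rightarrow> nat \<Rightarrow> complex" and d :: "nat \<Rightarrow> real"
  where "cspace.orthonormal n b n"
    "\<And>i. i < n \<Longrightarrow> mat_act n G (b i) = cscale (complex_of_real (d i)) (b i)"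
proof -
  have "\<exists>b d. cspace.orthonormal n b r \<and>
      (\<forall>i<r. mat_act n G (b i) = cscale (complex_of_real (d i)) (b i))" if "r \<le> n" for r
    using that
  proof (induction r)
    case 0
    then show ?case by (auto simp: cspace.orthonormal_def)
  next
    case (Suc r)
    then obtain b and d :: "nat \<Rightarrow> real" where b: "cspace.orthonormal n b r"
      "\<forall>i<r. mat_act n G (b i) = cscale (complex_of_real (d i)) (b i)" by (meson Suc_leD)
    obtain z w where w: "w \<in> cspace n" "w \<noteq> 0" "mat_act n G w = cscale z w"
      "\<forall>i<r. cinner n w (b i) = 0"
    proof -
      have "r < n" using Suc.prems by simp
      moreover have "b i \<in> cspace n" if "i < r" for i
        using b that by (simp add: cspace.orthonormal_def)
      ultimately show thesis
        using hermitian_eigenvector_complement[of n G r b "\<lambda>i. complex_of_real (d i)", OF G] b that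
        by blast
    qed
    have "z * cinner n w w = cnj z * cinner n w w"
      using mat_act_symmetric[of n G w w, OF G] w
      by (simp add: cspace.ip_scale_left cspace.ip_scale_right)
    then have "z = cnj z" using w cspace.ip_definite by auto
    then have z: "z = complex_of_real (Re z)" by (simp add: complex_eq_iff)
    define c where "c = complex_of_real (1 / cspace.nrm n w)"
    define u where "u = cscale c w"
    have nw: "cspace.nrm n w > 0"
      using w cspace.nrm_eq_0[OF w(1)] cspace.nrm_nonneg[OF w(1)] by linarith
    have u: "u \<in> cspace n" "mat_act n G u = cscale (complex_of_real (Re z)) u"
      using w z by (auto simp: u_def mat_act_scale fun_eq_iff)
    have uu: "cinner n u u = 1"
      using nw w by (simp add: u_def c_def cspace.ip_self cspace.nrm_scale norm_divide)
    have ub: "cinner n u (b i) = 0" "cinner n (b i) u = 0" if "i < r" for i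
    proof -
      show 1: "cinner n u (b i) = 0"
        using that w b by (simp add: u_def cspace.ip_scale_left cspace.orthonormal_def)
      show "cinner n (b i) u = 0"
        using 1 cspace.ip_commute[of u n "b i"] u b that by (simp add: cspace.orthonormal_def)
    qed
    have "cspace.orthonormal n (b(r := u)) (Suc r)"
      using b u uu ub by (auto simp: cspace.orthonormal_def less_Suc_eq)
    moreover have "\<forall>i<Suc r. mat_act n G ((b(r := u)) i) =
        cscale (complex_of_real ((d(r := Re z)) i)) ((b(r := u)) i)"
      using b u by (auto simp: less_Suc_eq)
    ultimately show ?case by blast
  qed
  from this[of n] show thesis using that by blast
qed

text \<open>The rows of a matrix with orthonormal columns are orthonormal too, since a left inverse of a
  square matrix is a right inverse.\<close>

lemma orthonormal_basis_expansion:
  assumes b: "cspace.orthonormal n b n" and "i < n" "k < n"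
  shows "(\<Sum>j<n. b j i * cnj (b j k)) = (if i = k then 1 else 0)"
proof -
  define U where "U = Matrix.mat n n (\<lambda>(i, j). b j i)"
  define U' where "U' = Matrix.mat n n (\<lambda>(i, j). cnj (b i j))"
  have C: "U \<in> carrier_mat n n" "U' \<in> carrier_mat n n" by (auto simp: U_def U'_def)
  have "U' * U = 1\<^sub>m n"
  proof (rule eq_matI)
    fix i j assume "i < dim_row (1\<^sub>m n :: complex mat)" "j < dim_col (1\<^sub>m n :: complex mat)"
    then have ij: "i < n" "j < n" by auto
    then have "(U' * U) $$ (i, j) = cinner n (b j) (b i)"
      by (simp add: U_def U'_def scalar_prod_def cinner_def atLeast0LessThan mult.commute)
    then show "(U' * U) $$ (i, j) = 1\<^sub>m n $$ (i, j)"
      using b ij by (auto simp: cspace.orthonormal_def)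
  qed (auto simp: U_def U'_def)
  then have "U * U' = 1\<^sub>m n" by (rule mat_mult_left_right_inverse[OF C(2,1)])
  then have "(U * U') $$ (i, k) = (if i = k then 1 else 0)" using assms by simp
  then show ?thesis using assms
    by (simp add: U_def U'_def scalar_prod_def atLeast0LessThan)
qed

lemma char_poly_eigenbasis:
  assumes b: "cspace.orthonormal n b n"
    and d: "\<And>i. i < n \<Longrightarrow> mat_act n G (b i) = cscale (d i) (b i)"
  shows "char_poly (Matrix.mat n n (\<lambda>(i, j). G i j)) = (\<Prod>i<n. [:- d i, 1:])"
proof -
  define A where "A = Matrix.mat n n (\<lambda>(i, j). G i j)"
  define U where "U = Matrix.mat n n (\<lambda>(i, j). b j i)"
  define U' where "U' = Matrix.mat n n (\<lambda>(i, j). cnj (b i j))"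
  define B where "B = Matrix.mat n n (\<lambda>(i, j). if i = j then d i else 0)"
  have C: "A \<in> carrier_mat n n" "U \<in> carrier_mat n n" "U' \<in> carrier_mat n n" "B \<in> carrier_mat n n"
    by (auto simp: U_def U'_def A_def B_def)
  have UU': "U * U' = 1\<^sub>m n"
    using orthonormal_basis_expansion[OF b]
    by (intro eq_matI) (auto simp: U_def U'_def scalar_prod_def atLeast0LessThan)
  then have U'U: "U' * U = 1\<^sub>m n" by (rule mat_mult_left_right_inverse[OF C(2,3)])
  have "A * U = U * B"
  proof (rule eq_matI)
    fix i j assume "i < dim_row (U * B)" "j < dim_col (U * B)"
    then have ij: "i < n" "j < n" using C by auto
    have "(A * U) $$ (i, j) = mat_act n G (b j) i"
      using ij by (simp add: A_def U_def scalar_prod_def atLeast0LessThan mat_act_def)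
    also have "\<dots> = d j * b j i" using d ij by simp
    also have "\<dots> = (\<Sum>k<n. if k = j then b k i * d k else 0)" using ij by (simp add: sum.delta)
    also have "\<dots> = (\<Sum>k<n. b k i * (if k = j then d k else 0))"
      by (intro sum.cong) auto
    also have "\<dots> = (U * B) $$ (i, j)"
      using ij by (simp add: B_def U_def scalar_prod_def atLeast0LessThan)
    finally show "(A * U) $$ (i, j) = (U * B) $$ (i, j)" .
  qed (use C in auto)
  then have "A = U * B * U'"
    using C UU' by (metis assoc_mult_mat right_mult_one_mat)
  then have "similar_mat_wit A B U U'"
    using C UU' U'U by (simp add: similar_mat_wit_def Let_def)
  then have "similar_mat A B" unfolding similar_mat_def by blast
  then have "char_poly A = char_poly B" by (rule char_poly_similar)
  also have "\<dots> = (\<Prod>a\<leftarrow>diag_mat B. [:- a, 1:])"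
    by (rule char_poly_upper_triangular[OF C(4)]) (auto simp: B_def)
  also have "diag_mat B = map d [0..<n]"
    by (auto simp: diag_mat_def B_def)
  also have "(\<Prod>a\<leftarrow>map d [0..<n]. [:- a, 1:]) = (\<Prod>i<n. [:- d i, 1:])"
    by (simp add: prod.list_conv_set_nth atLeast0LessThan)
  finally show ?thesis by (simp add: A_def)
qed

lemma order_prod_linear:
  fixes d :: "nat \<Rightarrow> complex"
  shows "Polynomial.order x (\<Prod>i<n. [:- d i, 1:]) = card {i. i < n \<and> d i = x}"
proof (induction n)
  case (Suc n)
  have "Polynomial.order x [:- d n, 1:] = (if d n = x then 1 else 0)"
    using order_power_n_n[of x 1] by (auto intro: order_0I)
  moreover have "Polynomial.order x (\<Prod>i<Suc n. [:- d i, 1:]) =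
      Polynomial.order x (\<Prod>i<n. [:- d i, 1:]) + Polynomial.order x [:- d n, 1:]"
    unfolding prod.lessThan_Suc by (intro order_mult no_zero_divisors) (simp_all del: mult_pCons_right)
  moreover have "{i. i < Suc n \<and> d i = x} =
      (if d n = x then insert n {i. i < n \<and> d i = x} else {i. i < n \<and> d i = x})"
    by (auto simp: less_Suc_eq)
  ultimately show ?case using Suc by simp
qed simp

text \<open>The matrix is similar to the diagonal matrix of the \<open>d i\<close>, so the order of a root of the
  characteristic polynomial is the number of its occurrences among the \<open>d i\<close>.\<close>

lemma num_neg_eigenvalues_eigenbasis:
  fixes d :: "nat \<Rightarrow> real"
  assumes b: "cspace.orthonormal n b n"
    and d: "\<And>i. i < n \<Longrightarrow> mat_act n G (b i) = cscale (complex_of_real (d i)) (b i)"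
  shows "num_neg_eigenvalues (Matrix.mat n n (\<lambda>(i, j). G i j)) = card {i. i < n \<and> d i < 0}"
proof -
  define A where "A = Matrix.mat n n (\<lambda>(i, j). G i j)"
  have A: "A \<in> carrier_mat n n" by (simp add: A_def)
  have cp: "char_poly A = (\<Prod>i<n. [:- complex_of_real (d i), 1:])"
    unfolding A_def using d by (rule char_poly_eigenbasis[OF b, of G "\<lambda>i. complex_of_real (d i)"])
  have ev: "eigenvalue A x \<longleftrightarrow> (\<exists>i<n. x = complex_of_real (d i))" for x
    by (auto simp: eigenvalue_root_char_poly[OF A] cp poly_prod)
  let ?I = "{i. i < n \<and> d i < 0}"
  have S: "{x. eigenvalue A x \<and> x \<in> \<real> \<and> Re x < 0} = (\<lambda>i. complex_of_real (d i)) ` ?I"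
    by (auto simp: ev)
  have "num_neg_eigenvalues A =
      (\<Sum>x\<in>(\<lambda>i. complex_of_real (d i)) ` ?I. card {i. i < n \<and> complex_of_real (d i) = x})"
    unfolding num_neg_eigenvalues_def S cp order_prod_linear ..
  also have "\<dots> = (\<Sum>x\<in>(\<lambda>i. complex_of_real (d i)) ` ?I. card {i \<in> ?I. complex_of_real (d i) = x})"
    by (intro sum.cong arg_cong[of _ _ card]) auto
  also have "\<dots> = card ?I"
    using sum.image_gen[of ?I "\<lambda>_. 1::nat" "\<lambda>i. complex_of_real (d i)"] by simp
  finally show ?thesis by (simp add: A_def)
qed

lemma hermitian_form_eigenbasis:
  fixes d :: "nat \<Rightarrow> real"
  assumes b: "cspace.orthonormal n b n"
    and d: "\<And>i. i < n \<Longrightarrow> mat_act n G (b i) = cscale (complex_of_real (d i)) (b i)"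
  shows "(\<Sum>i<n. \<Sum>j<n. cnj (c i) * c j * G i j) =
    complex_of_real (\<Sum>l<n. d l * (cmod (\<Sum>i<n. c i * cnj (b l i)))\<^sup>2)"
proof -
  define a where "a l = (\<Sum>i<n. c i * cnj (b l i))" for l
  have exp: "c i = (\<Sum>l<n. a l * b l i)" if "i < n" for i
  proof -
    have "(\<Sum>l<n. a l * b l i) = (\<Sum>l<n. \<Sum>k<n. c k * (b l i * cnj (b l k)))"
      by (simp add: a_def sum_distrib_left mult_ac)
    also have "\<dots> = (\<Sum>k<n. c k * (\<Sum>l<n. b l i * cnj (b l k)))"
      by (subst sum.swap) (simp add: sum_distrib_left)
    also have "\<dots> = (\<Sum>k<n. if k = i then c k else 0)"
      using orthonormal_basis_expansion[OF b that] by (intro sum.cong) auto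
    finally show ?thesis using that by (simp add: sum.delta)
  qed
  have Gc: "(\<Sum>j<n. c j * G i j) = (\<Sum>l<n. a l * complex_of_real (d l) * b l i)" if "i < n" for i
  proof -
    have "(\<Sum>j<n. c j * G i j) = (\<Sum>j<n. \<Sum>l<n. a l * (G i j * b l j))"
      by (intro sum.cong refl) (simp add: exp sum_distrib_left mult_ac)
    also have "\<dots> = (\<Sum>l<n. a l * mat_act n G (b l) i)"
      using that by (subst sum.swap) (simp add: mat_act_def sum_distrib_left)
    also have "\<dots> = (\<Sum>l<n. a l * complex_of_real (d l) * b l i)"
      using d by (intro sum.cong) auto
    finally show ?thesis .
  qed
  have cnj_a: "(\<Sum>i<n. b l i * cnj (c i)) = cnj (a l)" for l
    by (simp add: a_def mult_ac)
  have "(\<Sum>i<n. \<Sum>j<n. cnj (c i) * c j * G i j) = (\<Sum>i<n. cnj (c i) * (\<Sum>j<n. c j * G i j))"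
    by (simp add: sum_distrib_left mult_ac)
  also have "\<dots> = (\<Sum>i<n. \<Sum>l<n. a l * complex_of_real (d l) * (b l i * cnj (c i)))"
    by (intro sum.cong refl) (simp add: Gc sum_distrib_left mult_ac)
  also have "\<dots> = (\<Sum>l<n. a l * complex_of_real (d l) * cnj (a l))"
    by (subst sum.swap) (simp add: sum_distrib_left[symmetric] cnj_a)
  also have "\<dots> = (\<Sum>l<n. complex_of_real (d l * (cmod (a l))\<^sup>2))"
    by (intro sum.cong) (auto simp: complex_norm_square mult_ac simp del: of_real_power)
  finally show ?thesis by (simp add: a_def)
qed

section \<open>Negative squares through finitely supported functions\<close>

definition finsupp :: "'a set \<Rightarrow> ('a \<Rightarrow> complex) set" where
  "finsupp D = {c. finite {x. c x \<noteq> 0} \<and> {x. c x \<noteq> 0} \<subseteq> D}"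

definition qform :: "('a \<Rightarrow> 'a \<Rightarrow> complex) \<Rightarrow> ('a \<Rightarrow> complex) \<Rightarrow> real" where
  "qform \<kappa> c = Re (\<Sum>x | c x \<noteq> 0. \<Sum>y | c y \<noteq> 0. cnj (c x) * c y * \<kappa> x y)"

definition neg_definite_family ::
  "('a \<Rightarrow> 'a \<Rightarrow> complex) \<Rightarrow> 'a set \<Rightarrow> nat \<Rightarrow> (nat \<Rightarrow> 'a \<Rightarrow> complex) \<Rightarrow> bool" where
  "neg_definite_family \<kappa> D n f \<longleftrightarrow> (\<forall>i<n. f i \<in> finsupp D) \<and>
     (\<forall>a. (\<exists>i<n. a i \<noteq> 0) \<longrightarrow> qform \<kappa> (lincomb n a f) < 0)"

lemma subspace_finsupp: "cfun.subspace (finsupp D)"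
proof (rule cfun.subspaceI)
  fix c f g assume f: "f \<in> finsupp D"
  have "{x. cscale c f x \<noteq> 0} \<subseteq> {x. f x \<noteq> 0}" by auto
  then show "cscale c f \<in> finsupp D"
    using f unfolding finsupp_def by (blast intro: finite_subset)
  assume g: "g \<in> finsupp D"
  have "{x. (f + g) x \<noteq> 0} \<subseteq> {x. f x \<noteq> 0} \<union> {x. g x \<noteq> 0}" by auto
  then show "f + g \<in> finsupp D"
    using f g unfolding finsupp_def by (blast intro: finite_subset)
qed (simp add: finsupp_def)

lemma qform_superset:
  assumes "finite S" "{x. c x \<noteq> 0} \<subseteq> S"
  shows "qform \<kappa> c = Re (\<Sum>x\<in>S. \<Sum>y\<in>S. cnj (c x) * c y * \<kappa> x y)"
proof -
  have "(\<Sum>x | c x \<noteq> 0. \<Sum>y | c y \<noteq> 0. cnj (c x) * c y * \<kappa> x y) =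
      (\<Sum>x | c x \<noteq> 0. \<Sum>y\<in>S. cnj (c x) * c y * \<kappa> x y)"
    using assms by (intro sum.cong sum.mono_neutral_left) auto
  also have "\<dots> = (\<Sum>x\<in>S. \<Sum>y\<in>S. cnj (c x) * c y * \<kappa> x y)"
    using assms by (intro sum.mono_neutral_left) auto
  finally show ?thesis by (simp only: qform_def)
qed

text \<open>A coefficient vector for a sample \<open>l\<close> of points, possibly with repetitions, becomes a
  function on the points by adding up the coefficients of equal points.\<close>

definition push :: "nat \<Rightarrow> (nat \<Rightarrow> 'a) \<Rightarrow> (nat \<Rightarrow> complex) \<Rightarrow> 'a \<Rightarrow> complex" where
  "push n l c x = (\<Sum>p | p < n \<and> l p = x. c p)"

lemma push_support: "{x. push n l c x \<noteq> 0} \<subseteq> l ` {..<n}"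
  unfolding push_def by (force intro: sum.neutral)

lemma push_finsupp: assumes "l ` {..<n} \<subseteq> D" shows "push n l c \<in> finsupp D"
proof -
  have "finite {x. push n l c x \<noteq> 0}" by (rule finite_subset[OF push_support]) simp
  then show ?thesis using push_support[of n l c] assms unfolding finsupp_def by blast
qed

lemma sum_push: "(\<Sum>x\<in>l ` {..<n}. push n l c x * h x) = (\<Sum>p<n. c p * h (l p))"
proof -
  have "(\<Sum>p<n. c p * h (l p)) = (\<Sum>x\<in>l ` {..<n}. \<Sum>p\<in>{p. p \<in> {..<n} \<and> l p = x}. c p * h (l p))"
    by (rule sum.image_gen) simp
  also have "\<dots> = (\<Sum>x\<in>l ` {..<n}. push n l c x * h x)"
    by (intro sum.cong refl) (simp add: push_def sum_distrib_right)
  finally show ?thesis ..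
qed

lemma push_sum: "push n l (\<Sum>i\<in>I. cscale (a i) (c i)) = (\<Sum>i\<in>I. cscale (a i) (push n l (c i)))"
  by (rule ext)
    (simp add: push_def sum_fun_apply sum_distrib_left sum.swap[of _ I])

lemma qform_push:
  "qform \<kappa> (push n l c) = Re (\<Sum>p<n. \<Sum>q<n. cnj (c p) * c q * \<kappa> (l p) (l q))"
proof -
  let ?S = "l ` {..<n}"
  have cnj_push: "cnj (push n l c x) = push n l (\<lambda>p. cnj (c p)) x" for x
    by (simp add: push_def)
  have "(\<Sum>x\<in>?S. \<Sum>y\<in>?S. cnj (push n l c x) * push n l c y * \<kappa> x y) =
      (\<Sum>x\<in>?S. push n l (\<lambda>p. cnj (c p)) x * (\<Sum>y\<in>?S. push n l c y * \<kappa> x y))"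
    by (simp add: cnj_push sum_distrib_left mult_ac)
  also have "\<dots> = (\<Sum>p<n. \<Sum>q<n. cnj (c p) * c q * \<kappa> (l p) (l q))"
    by (simp only: sum_push) (simp add: sum_distrib_left mult_ac)
  finally show ?thesis
    by (subst qform_superset[OF _ push_support]) auto
qed

text \<open>This is the inertia theorem: a Hermitian matrix has more than \<open>m\<close> negative eigenvalues iff
  its form is negative definite on some \<open>(m + 1)\<close>-dimensional space. The eigenvectors for negative
  eigenvalues span such a space; conversely a space of dimension \<open>m + 1\<close> contains a nonzero vector
  orthogonal to at most \<open>m\<close> given ones.\<close>

lemma neg_definite_family_imp_eigenvalues:
  assumes herm: "\<And>x y. x \<in> D \<Longrightarrow> y \<in> D \<Longrightarrow> \<kappa> x y = cnj (\<kappa> y x)"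
    and f: "neg_definite_family \<kappa> D (Suc m) f"
  shows "\<exists>n l. l ` {..<n} \<subseteq> D \<and> m < num_neg_eigenvalues (gram \<kappa> n l)"
proof -
  define S where "S = (\<Union>i<Suc m. {x. f i x \<noteq> 0})"
  have fi: "finite {x. f i x \<noteq> 0}" "{x. f i x \<noteq> 0} \<subseteq> D" if "i < Suc m" for i
    using f that by (auto simp: neg_definite_family_def finsupp_def)
  have S: "finite S" "S \<subseteq> D" using fi unfolding S_def by blast+
  define n where "n = card S"
  obtain l where l: "bij_betw l {..<n} S"
    using ex_bij_betw_nat_finite[OF S(1)] unfolding atLeast0LessThan n_def by blast
  then have lS: "l ` {..<n} = S" by (simp add: bij_betw_def)
  define G where "G i j = \<kappa> (l i) (l j)" for i j
  have G: "G i j = cnj (G j i)" if "i < n" "j < n" for i j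
    unfolding G_def using that lS S by (intro herm) auto
  obtain b and d :: "nat \<Rightarrow> real" where b: "cspace.orthonormal n b n"
    and d: "\<And>i. i < n \<Longrightarrow> mat_act n G (b i) = cscale (complex_of_real (d i)) (b i)"
    using hermitian_eigenbasis[of n G, OF G] by blast
  define J where "J = {i. i < n \<and> d i < 0}"
  have "finite J" by (simp add: J_def)
  have num: "num_neg_eigenvalues (gram \<kappa> n l) = card J"
    using num_neg_eigenvalues_eigenbasis[of n b G d, OF b d]
    by (simp add: gram_def G_def J_def)
  have "m < card J"
  proof (rule ccontr)
    assume "\<not> m < card J"
    then have "card J < Suc m" by simp
    obtain e where e: "bij_betw e {..<card J} J"
      using ex_bij_betw_nat_finite[OF \<open>finite J\<close>] by (auto simp: atLeast0LessThan)
    obtain a where a: "\<exists>i<Suc m. a i \<noteq> 0"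
      "\<forall>s<card J. (\<Sum>i<Suc m. (\<Sum>p<n. f i (l p) * cnj (b (e s) p)) * a i) = 0"
      using underdetermined_system[OF \<open>card J < Suc m\<close>,
          of "\<lambda>s i. \<Sum>p<n. f i (l p) * cnj (b (e s) p)"] by blast
    define F where "F = (lincomb (Suc m) a f)"
    have F: "F x = (\<Sum>i<Suc m. a i * f i x)" for x
      by (simp only: F_def sum_fun_apply cscale_apply)
    have suppF: "{x. F x \<noteq> 0} \<subseteq> S"
    proof
      fix x assume "x \<in> {x. F x \<noteq> 0}"
      then have "(\<Sum>i<Suc m. a i * f i x) \<noteq> 0" by (simp only: F mem_Collect_eq not_False_eq_True)
      then obtain i where "i \<in> {..<Suc m}" "a i * f i x \<noteq> 0" by (rule sum.not_neutral_contains_not_neutral)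
      then have "i < Suc m" "f i x \<noteq> 0" by simp_all
      then show "x \<in> S" unfolding S_def by blast
    qed
    have orth: "(\<Sum>p<n. F (l p) * cnj (b j p)) = 0" if j: "j \<in> J" for j
    proof -
      obtain s where s: "s < card J" "j = e s" using bij_betw_imp_surj_on[OF e] j by (metis imageE lessThan_iff)
      have "(\<Sum>p<n. F (l p) * cnj (b j p)) =
          (\<Sum>p<n. \<Sum>i<Suc m. f i (l p) * cnj (b j p) * a i)"
        unfolding F sum_distrib_right by (intro sum.cong refl) (simp only: mult_ac)
      also have "\<dots> = (\<Sum>i<Suc m. (\<Sum>p<n. f i (l p) * cnj (b j p)) * a i)"
        unfolding sum_distrib_right by (rule sum.swap)
      also have "\<dots> = 0" using a(2) s by simp
      finally show ?thesis .
    qed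
    have "qform \<kappa> F = Re (\<Sum>x\<in>S. \<Sum>y\<in>S. cnj (F x) * F y * \<kappa> x y)"
      by (rule qform_superset[OF S(1) suppF])
    also have "(\<Sum>x\<in>S. \<Sum>y\<in>S. cnj (F x) * F y * \<kappa> x y) =
        (\<Sum>p<n. \<Sum>q<n. cnj (F (l p)) * F (l q) * G p q)"
      unfolding G_def by (simp only: sum.reindex_bij_betw[OF l, symmetric])
    also have "\<dots> = complex_of_real (\<Sum>j<n. d j * (cmod (\<Sum>p<n. F (l p) * cnj (b j p)))\<^sup>2)"
      by (rule hermitian_form_eigenbasis[OF b d])
    finally have "qform \<kappa> F = (\<Sum>j<n. d j * (cmod (\<Sum>p<n. F (l p) * cnj (b j p)))\<^sup>2)"
      by simp
    also have "\<dots> \<ge> 0"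
    proof (rule sum_nonneg)
      fix j assume "j \<in> {..<n}"
      then show "0 \<le> d j * (cmod (\<Sum>p<n. F (l p) * cnj (b j p)))\<^sup>2"
        using orth[of j] by (cases "d j < 0") (auto simp: J_def)
    qed
    finally show False using f a(1) by (auto simp: neg_definite_family_def F_def)
  qed
  then show ?thesis using lS S num by metis
qed

lemma eigenvalues_imp_neg_definite_family:
  assumes herm: "\<And>x y. x \<in> D \<Longrightarrow> y \<in> D \<Longrightarrow> \<kappa> x y = cnj (\<kappa> y x)"
    and l: "l ` {..<n} \<subseteq> D" and num: "m < num_neg_eigenvalues (gram \<kappa> n l)"
  shows "\<exists>f. neg_definite_family \<kappa> D (Suc m) f"
proof -
  define G where "G i j = \<kappa> (l i) (l j)" for i j
  have G: "G i j = cnj (G j i)" if "i < n" "j < n" for i j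
    unfolding G_def using that l by (intro herm) auto
  obtain b and d :: "nat \<Rightarrow> real" where b: "cspace.orthonormal n b n"
    and d: "\<And>i. i < n \<Longrightarrow> mat_act n G (b i) = cscale (complex_of_real (d i)) (b i)"
    using hermitian_eigenbasis[of n G, OF G] by blast
  define J where "J = {i. i < n \<and> d i < 0}"
  have "Suc m \<le> card J"
    using num num_neg_eigenvalues_eigenbasis[of n b G d, OF b d]
    by (simp add: gram_def G_def J_def)
  then obtain J' where J': "J' \<subseteq> J" "card J' = Suc m" "finite J'"
    by (meson obtain_subset_with_card_n)
  obtain e where e: "bij_betw e {..<Suc m} J'"
    using ex_bij_betw_nat_finite[OF J'(3)] J'(2) by (auto simp: atLeast0LessThan)
  have eJ: "e s < n" "d (e s) < 0" if "s < Suc m" for s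
    using that e J' by (auto simp: bij_betw_def J_def)
  define f where "f s = push n l (b (e s))" for s
  have "qform \<kappa> (lincomb (Suc m) a f) < 0" if a: "\<exists>s<Suc m. a s \<noteq> 0" for a
  proof -
    define c where "c = (\<Sum>s<Suc m. cscale (a s) (b (e s)))"
    have be: "b (e s) \<in> cspace n" if "s < Suc m" for s
      using b eJ[OF that] by (simp add: cspace.orthonormal_def)
    have coord: "(\<Sum>p<n. c p * cnj (b j p)) = (\<Sum>s<Suc m. if e s = j then a s else 0)"
      if "j < n" for j
    proof -
      have bj: "b j \<in> cspace n" using b that by (simp add: cspace.orthonormal_def)
      have "(\<Sum>p<n. c p * cnj (b j p)) = cinner n c (b j)" by (simp add: cinner_def)
      also have "\<dots> = (\<Sum>s<Suc m. cinner n (cscale (a s) (b (e s))) (b j))"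
        unfolding c_def using be bj by (intro cspace.ip_sum_left) auto
      also have "\<dots> = (\<Sum>s<Suc m. if e s = j then a s else 0)"
      proof (rule sum.cong[OF refl])
        fix s assume "s \<in> {..<Suc m}"
        then show "cinner n (cscale (a s) (b (e s))) (b j) = (if e s = j then a s else 0)"
          using be[of s] bj b eJ[of s] that
          by (simp add: cspace.ip_scale_left cspace.orthonormal_def)
      qed
      finally show ?thesis .
    qed
    have coord_e: "(\<Sum>p<n. c p * cnj (b (e s) p)) = a s" if s: "s < Suc m" for s
    proof -
      have "(\<Sum>s'<Suc m. if e s' = e s then a s' else 0) = (\<Sum>s'<Suc m. if s' = s then a s' else 0)"
        using e s by (intro sum.cong) (auto simp: bij_betw_def inj_on_def)
      also have "\<dots> = a s" using s by (subst sum.delta) auto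
      finally show ?thesis using coord[of "e s"] eJ s by simp
    qed
    have coord_0: "(\<Sum>p<n. c p * cnj (b j p)) = 0" if "j < n" "j \<notin> J'" for j
      using coord[OF that(1)] that e by (force simp: bij_betw_def intro: sum.neutral)
    have "qform \<kappa> (lincomb (Suc m) a f) = qform \<kappa> (push n l c)"
      by (simp only: f_def c_def push_sum)
    also have "\<dots> = Re (\<Sum>p<n. \<Sum>q<n. cnj (c p) * c q * G p q)"
      by (simp only: qform_push G_def)
    also have "(\<Sum>p<n. \<Sum>q<n. cnj (c p) * c q * G p q) =
        complex_of_real (\<Sum>j<n. d j * (cmod (\<Sum>p<n. c p * cnj (b j p)))\<^sup>2)"
      by (rule hermitian_form_eigenbasis[OF b d])
    also have "Re \<dots> = (\<Sum>j<n. d j * (cmod (\<Sum>p<n. c p * cnj (b j p)))\<^sup>2)" by simp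
    also have "\<dots> = (\<Sum>j\<in>J'. d j * (cmod (\<Sum>p<n. c p * cnj (b j p)))\<^sup>2)"
      using J' coord_0 by (intro sum.mono_neutral_right) (auto simp: J_def)
    also have "\<dots> = (\<Sum>s<Suc m. d (e s) * (cmod (a s))\<^sup>2)"
      unfolding sum.reindex_bij_betw[OF e, symmetric]
      by (rule sum.cong[OF refl]) (simp only: lessThan_iff coord_e)
    also have "\<dots> < (\<Sum>s<Suc m. 0)"
    proof (rule sum_strict_mono_ex1)
      show "\<forall>s\<in>{..<Suc m}. d (e s) * (cmod (a s))\<^sup>2 \<le> 0"
        using eJ(2) by (meson lessThan_iff less_imp_le mult_nonpos_nonneg zero_le_power2)
      from a obtain s where s: "s < Suc m" "a s \<noteq> 0" by blast
      then have "d (e s) * (cmod (a s))\<^sup>2 < 0" using eJ(2)[OF s(1)] by (simp add: mult_neg_pos)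
      then show "\<exists>s\<in>{..<Suc m}. d (e s) * (cmod (a s))\<^sup>2 < 0" using s(1) by blast
    qed simp
    finally show ?thesis by (simp only: sum.neutral_const)
  qed
  then have "neg_definite_family \<kappa> D (Suc m) f"
    unfolding neg_definite_family_def using push_finsupp[OF l] by (metis f_def)
  then show ?thesis by blast
qed

lemma at_most_neg_squares_iff:
  "at_most_neg_squares D \<kappa> m \<longleftrightarrow> (\<forall>x\<in>D. \<forall>y\<in>D. \<kappa> x y = cnj (\<kappa> y x)) \<and>
     \<not> (\<exists>f. neg_definite_family \<kappa> D (Suc m) f)"
proof (cases "\<forall>x\<in>D. \<forall>y\<in>D. \<kappa> x y = cnj (\<kappa> y x)")
  case True
  have herm: "\<kappa> x y = cnj (\<kappa> y x)" if "x \<in> D" "y \<in> D" for x y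
    by (rule bspec[OF bspec[OF True that(1)] that(2)])
  have 1: "num_neg_eigenvalues (gram \<kappa> n l) \<le> m"
    if no: "\<not> (\<exists>f. neg_definite_family \<kappa> D (Suc m) f)" and l: "l ` {..<n} \<subseteq> D" for n l
  proof (rule ccontr)
    assume "\<not> num_neg_eigenvalues (gram \<kappa> n l) \<le> m"
    then have "m < num_neg_eigenvalues (gram \<kappa> n l)" by simp
    from eigenvalues_imp_neg_definite_family[of D \<kappa>, OF herm l this] no show False by (rule notE[rotated])
  qed
  have 2: False
    if "neg_definite_family \<kappa> D (Suc m) f"
      "\<forall>n l. l ` {..<n} \<subseteq> D \<longrightarrow> num_neg_eigenvalues (gram \<kappa> n l) \<le> m" for f
    using neg_definite_family_imp_eigenvalues[of D \<kappa> m f, OF herm that(1)] that(2)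
    by (meson leD)
  have "(\<forall>n l. l ` {..<n} \<subseteq> D \<longrightarrow> num_neg_eigenvalues (gram \<kappa> n l) \<le> m) \<longleftrightarrow>
      \<not> (\<exists>f. neg_definite_family \<kappa> D (Suc m) f)"
    using 1 2 by blast
  then show ?thesis
    by (simp only: at_most_neg_squares_def)
next
  case False
  then show ?thesis by (simp only: at_most_neg_squares_def simp_thms)
qed

section \<open>Riesz representation and uniform boundedness\<close>

lemma null_sequence_comparison:
  fixes f :: "nat \<Rightarrow> 'b::real_normed_vector"
  assumes "\<And>n. norm (f n) \<le> g n" "g \<longlonglongrightarrow> 0" shows "f \<longlonglongrightarrow> 0"
  using Lim_null_comparison[OF always_eventually assms(2)] assms(1) by blast

locale hilbert_functions = inner_product_functions +
  assumes cauchy_convergent: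
    "\<And>\<sigma>. (\<And>n. \<sigma> n \<in> V) \<Longrightarrow> (\<And>\<epsilon>. \<epsilon> > 0 \<Longrightarrow> \<exists>N. \<forall>n\<ge>N. \<forall>m\<ge>N. nrm (\<sigma> n - \<sigma> m) < \<epsilon>) \<Longrightarrow>
        \<exists>l\<in>V. (\<lambda>n. nrm (\<sigma> n - l)) \<longlonglongrightarrow> 0"
begin

lemma ip_right_tendsto:
  assumes "\<And>n. \<sigma> n \<in> V" "l \<in> V" "f \<in> V" "(\<lambda>n. nrm (\<sigma> n - l)) \<longlonglongrightarrow> 0"
  shows "(\<lambda>n. ip f (\<sigma> n)) \<longlonglongrightarrow> ip f l"
proof -
  have lim: "(\<lambda>n. nrm f * nrm (\<sigma> n - l)) \<longlonglongrightarrow> 0"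
    using assms(4) by (rule tendsto_mult_right_zero)
  have "norm (ip f (\<sigma> n) - ip f l) \<le> nrm f * nrm (\<sigma> n - l)" for n
    using cauchy_schwarz[of f "\<sigma> n - l"] assms by (simp add: ip_diff_right)
  then have "(\<lambda>n. ip f (\<sigma> n) - ip f l) \<longlonglongrightarrow> 0"
    using lim by (rule null_sequence_comparison)
  then show ?thesis by (rule Lim_null[THEN iffD2])
qed

lemma ip_left_tendsto:
  assumes "\<And>n. \<sigma> n \<in> V" "l \<in> V" "f \<in> V" "(\<lambda>n. nrm (\<sigma> n - l)) \<longlonglongrightarrow> 0"
  shows "(\<lambda>n. ip (\<sigma> n) f) \<longlonglongrightarrow> ip l f"
proof -
  have "(\<lambda>n. cnj (ip f (\<sigma> n))) \<longlonglongrightarrow> cnj (ip f l)"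
    using ip_right_tendsto[OF assms] by (rule tendsto_cnj)
  moreover have "cnj (ip f (\<sigma> n)) = ip (\<sigma> n) f" "cnj (ip f l) = ip l f" for n
    using assms by (auto simp flip: ip_commute)
  ultimately show ?thesis by simp
qed

lemma nrm_tendsto:
  assumes "\<And>n. \<sigma> n \<in> V" "l \<in> V" "(\<lambda>n. nrm (\<sigma> n - l)) \<longlonglongrightarrow> 0"
  shows "(\<lambda>n. nrm (\<sigma> n)) \<longlonglongrightarrow> nrm l"
proof -
  have "norm (nrm (\<sigma> n) - nrm l) \<le> nrm (\<sigma> n - l)" for n
    using nrm_triangle[of "\<sigma> n - l" l] nrm_triangle[of "l - \<sigma> n" "\<sigma> n"]
      nrm_minus_commute[of l "\<sigma> n"] assms by (simp add: abs_le_iff)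
  then have "(\<lambda>n. nrm (\<sigma> n) - nrm l) \<longlonglongrightarrow> 0"
    using assms(3) by (rule null_sequence_comparison)
  then show ?thesis by (rule Lim_null[THEN iffD2])
qed

definition lim_closure :: "('a \<Rightarrow> complex) set \<Rightarrow> ('a \<Rightarrow> complex) set" where
  "lim_closure S = {g \<in> V. \<exists>\<sigma>. (\<forall>n. \<sigma> n \<in> S) \<and> (\<lambda>n. nrm (\<sigma> n - g)) \<longlonglongrightarrow> 0}"

lemma lim_closure_in: "g \<in> lim_closure S \<Longrightarrow> g \<in> V"
  by (simp add: lim_closure_def)

lemma lim_closure_add:
  assumes S: "S \<subseteq> V" "cfun.subspace S" and "f \<in> lim_closure S" "g \<in> lim_closure S"
  shows "f + g \<in> lim_closure S"
proof -
  obtain \<sigma> \<tau> where st: "\<And>n. \<sigma> n \<in> S" "(\<lambda>n. nrm (\<sigma> n - f)) \<longlonglongrightarrow> 0"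
    "\<And>n. \<tau> n \<in> S" "(\<lambda>n. nrm (\<tau> n - g)) \<longlonglongrightarrow> 0" and fg: "f \<in> V" "g \<in> V"
    using assms(3,4) unfolding lim_closure_def by blast
  have V: "\<sigma> n \<in> V" "\<tau> n \<in> V" for n using S st by blast+
  have "(\<sigma> n + \<tau> n) - (f + g) = (\<sigma> n - f) + (\<tau> n - g)" for n by (rule add_diff_add)
  then have "norm (nrm ((\<sigma> n + \<tau> n) - (f + g))) \<le> nrm (\<sigma> n - f) + nrm (\<tau> n - g)" for n
    using nrm_triangle[of "\<sigma> n - f" "\<tau> n - g"] nrm_nonneg[of "(\<sigma> n - f) + (\<tau> n - g)"] V fg
    by (simp only: real_norm_def abs_of_nonneg V_add V_diff)
  moreover have "(\<lambda>n. nrm (\<sigma> n - f) + nrm (\<tau> n - g)) \<longlonglongrightarrow> 0"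
    using st(2,4) by (rule tendsto_add_zero)
  ultimately have "(\<lambda>n. nrm ((\<sigma> n + \<tau> n) - (f + g))) \<longlonglongrightarrow> 0"
    by (rule null_sequence_comparison)
  moreover have "\<sigma> n + \<tau> n \<in> S" for n using S(2) st by (simp add: cfun.subspace_add)
  ultimately show ?thesis using fg unfolding lim_closure_def
    by (intro CollectI conjI exI[of _ "\<lambda>n. \<sigma> n + \<tau> n"]) auto
qed

lemma lim_closure_scale:
  assumes S: "S \<subseteq> V" "cfun.subspace S" and "f \<in> lim_closure S"
  shows "cscale c f \<in> lim_closure S"
proof -
  obtain \<sigma> where st: "\<And>n. \<sigma> n \<in> S" "(\<lambda>n. nrm (\<sigma> n - f)) \<longlonglongrightarrow> 0" and f: "f \<in> V"
    using assms(3) unfolding lim_closure_def by blast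
  have V: "\<sigma> n \<in> V" for n using S st by blast
  have "nrm (cscale c (\<sigma> n) - cscale c f) = cmod c * nrm (\<sigma> n - f)" for n
    using V f by (simp add: nrm_scale flip: cfun.scale_right_diff_distrib)
  then have "(\<lambda>n. nrm (cscale c (\<sigma> n) - cscale c f)) \<longlonglongrightarrow> 0"
    using tendsto_mult_right_zero[OF st(2)] by simp
  moreover have "cscale c (\<sigma> n) \<in> S" for n using S(2) st by (simp add: cfun.subspace_scale)
  ultimately show ?thesis using f unfolding lim_closure_def
    by (intro CollectI conjI exI[of _ "\<lambda>n. cscale c (\<sigma> n)"]) auto
qed

lemma lim_closure_orthogonal:
  assumes "S \<subseteq> V" "g \<in> lim_closure S" "\<And>f. f \<in> S \<Longrightarrow> ip f g = 0"
  shows "g = 0"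
proof -
  obtain \<sigma> where st: "\<And>n. \<sigma> n \<in> S" "(\<lambda>n. nrm (\<sigma> n - g)) \<longlonglongrightarrow> 0" and g: "g \<in> V"
    using assms(2) unfolding lim_closure_def by blast
  have "(\<lambda>n. ip (\<sigma> n) g) \<longlonglongrightarrow> ip g g"
    using st(1) g assms(1) by (intro ip_left_tendsto[OF _ g g st(2)]) blast
  then have "(\<lambda>n. 0) \<longlonglongrightarrow> ip g g" using st(1) assms(3) by simp
  then have "ip g g = 0" using LIMSEQ_const_iff by metis
  then show ?thesis using g ip_definite by blast
qed

text \<open>Riesz representation in parametrised form: a functional \<open>L\<close> on a vector space \<open>W\<close> that is
  bounded by the seminorm \<open>nrm \<circ> K\<close> is an inner product with a vector of the closure of the range
  of \<open>K\<close>. The vector is the limit of the values of \<open>K\<close> along a minimising sequence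
  of \<open>w \<mapsto> (nrm (K w))\<^sup>2 - 2 * Re (L w)\<close>. That \<open>L\<close> factors through \<open>K\<close> is part of the conclusion.\<close>

lemma riesz:
  fixes K :: "('w \<Rightarrow> complex) \<Rightarrow> 'a \<Rightarrow> complex" and L :: "('w \<Rightarrow> complex) \<Rightarrow> complex"
  assumes W: "cfun.subspace W"
    and KV: "\<And>w. w \<in> W \<Longrightarrow> K w \<in> V"
    and K_add: "\<And>v w. v \<in> W \<Longrightarrow> w \<in> W \<Longrightarrow> K (v + w) = K v + K w"
    and K_scale: "\<And>c w. w \<in> W \<Longrightarrow> K (cscale c w) = cscale c (K w)"
    and L_add: "\<And>v w. v \<in> W \<Longrightarrow> w \<in> W \<Longrightarrow> L (v + w) = L v + L w"
    and L_scale: "\<And>c w. w \<in> W \<Longrightarrow> L (cscale c w) = c * L w"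
    and bound: "\<And>w. w \<in> W \<Longrightarrow> cmod (L w) \<le> C * nrm (K w)"
    and C: "0 \<le> C"
  shows "\<exists>g\<in>lim_closure (K ` W). (\<forall>w\<in>W. ip (K w) g = L w) \<and> nrm g \<le> C"
proof -
  define J where "J w = (nrm (K w))\<^sup>2 - 2 * Re (L w)" for w
  have J_bound: "- (C\<^sup>2) \<le> J w" if "w \<in> W" for w
  proof -
    have "Re (L w) \<le> C * nrm (K w)" using bound[OF that] complex_Re_le_cmod order_trans by blast
    moreover have "0 \<le> (nrm (K w) - C)\<^sup>2" by simp
    ultimately show ?thesis by (simp add: J_def power2_diff mult.commute)
  qed
  define I where "I = (INF w\<in>W. J w)"
  have W0: "0 \<in> W" using W by (rule cfun.subspace_0)
  have bdd: "bdd_below (J ` W)" using J_bound by (intro bdd_belowI[of _ "- (C\<^sup>2)"]) auto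
  have I: "I \<le> J w" if "w \<in> W" for w unfolding I_def using that bdd by (intro cINF_lower) auto
  have "\<exists>w\<in>W. J w < I + 1 / real (Suc n)" for n
  proof -
    have "(INF w\<in>W. J w) < I + 1 / real (Suc n)" by (simp add: I_def)
    then show ?thesis using W0 bdd by (subst (asm) cINF_less_iff) auto
  qed
  then obtain s where s: "\<And>n. s n \<in> W" "\<And>n. J (s n) < I + 1 / real (Suc n)" by metis
  have near: "(nrm (K (s n) - K (s m)))\<^sup>2 \<le> 2 / real (Suc n) + 2 / real (Suc m)" for n m
  proof -
    define w where "w = cscale (1/2) (s n + s m)"
    have sW: "s n + s m \<in> W" using W s by (simp add: cfun.subspace_add)
    then have wW: "w \<in> W" using W by (simp add: w_def cfun.subspace_scale)
    have "K (s n) + K (s m) = K (s n + s m)" using s K_add by simp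
    then have "(nrm (K (s n) + K (s m)))\<^sup>2 = 4 * (nrm (K w))\<^sup>2"
      using sW KV K_scale by (simp add: w_def nrm_scale power_mult_distrib power2_eq_square norm_divide)
    moreover have "L w = (L (s n) + L (s m)) / 2"
      using L_scale[OF sW] L_add[OF s(1) s(1)] by (simp add: w_def)
    then have "Re (L w) = Re ((L (s n) + L (s m)) / 2)" by (simp only:)
    then have "Re (L w) = (Re (L (s n)) + Re (L (s m))) / 2" by simp
    ultimately have "(nrm (K (s n) - K (s m)))\<^sup>2 = 2 * J (s n) + 2 * J (s m) - 4 * J w"
      using parallelogram[of "K (s n)" "K (s m)"] KV s by (simp add: J_def)
    then show ?thesis using s(2)[of n] s(2)[of m] I[OF wW] by simp
  qed
  have KsV: "K (s n) \<in> V" for n using KV s by blast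
  have "\<exists>g\<in>V. (\<lambda>n. nrm (K (s n) - g)) \<longlonglongrightarrow> 0"
  proof (rule cauchy_convergent)
    fix \<epsilon> :: real assume e: "\<epsilon> > 0"
    then obtain N where N: "4 / \<epsilon>\<^sup>2 < real N" using reals_Archimedean2 by blast
    have "nrm (K (s n) - K (s m)) < \<epsilon>" if "N \<le> n" "N \<le> m" for n m
    proof -
      have N0: "real N > 0" using order.strict_trans[OF divide_pos_pos[of 4 "\<epsilon>\<^sup>2"] N] e by simp
      have "2 / real (Suc n) < 2 / real N" "2 / real (Suc m) < 2 / real N"
        using that N0 by (intro divide_strict_left_mono; simp)+
      then have "(nrm (K (s n) - K (s m)))\<^sup>2 < 4 / real N" using near[of n m] by simp
      also have "\<dots> < \<epsilon>\<^sup>2" using N e N0 by (simp add: field_simps)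
      finally show ?thesis by (rule power_less_imp_less_base) (use e in simp)
    qed
    then show "\<exists>N. \<forall>n\<ge>N. \<forall>m\<ge>N. nrm (K (s n) - K (s m)) < \<epsilon>" by blast
  qed (rule KsV)
  then obtain g where g: "g \<in> V" "(\<lambda>n. nrm (K (s n) - g)) \<longlonglongrightarrow> 0" by blast
  have rep: "ip (K w) g = L w" if w: "w \<in> W" for w
  proof (rule ccontr)
    assume "ip (K w) g \<noteq> L w"
    define q where "q = ip (K w) g - L w"
    define \<delta> where "\<delta> = 1 / ((nrm (K w))\<^sup>2 + 1)"
    define z where "z = - complex_of_real \<delta> * cnj q"
    have \<delta>: "\<delta> > 0" by (simp add: \<delta>_def add_nonneg_pos)
    \<comment> \<open>moving the minimising sequence in the direction of \<open>w\<close> cannot decrease the infimum\<close>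
    have "- 1 / real (Suc n) \<le> (cmod z)\<^sup>2 * (nrm (K w))\<^sup>2 + 2 * Re (z * (ip (K w) (K (s n)) - L w))" for n
    proof -
      have zw: "cscale z w \<in> W" using W w by (simp add: cfun.subspace_scale)
      have "I \<le> J (cscale z w + s n)" using I W zw s by (simp add: cfun.subspace_add)
      also have "\<dots> = (nrm (cscale z (K w) + K (s n)))\<^sup>2 - 2 * Re (z * L w + L (s n))"
        by (simp only: J_def K_add[OF zw s(1)] L_add[OF zw s(1)] K_scale[OF w] L_scale[OF w])
      also have "(nrm (cscale z (K w) + K (s n)))\<^sup>2 =
          (cmod z)\<^sup>2 * (nrm (K w))\<^sup>2 + (nrm (K (s n)))\<^sup>2 + 2 * Re (z * ip (K w) (K (s n)))"
        using KV[OF w] KsV[of n]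
        by (simp only: nrm_add_sq V_scale nrm_scale ip_scale_left power_mult_distrib)
      also have "\<dots> - 2 * Re (z * L w + L (s n)) =
          J (s n) + ((cmod z)\<^sup>2 * (nrm (K w))\<^sup>2 + 2 * Re (z * (ip (K w) (K (s n)) - L w)))"
        by (simp add: J_def algebra_simps)
      finally show ?thesis using s(2)[of n] by simp
    qed
    moreover have "(\<lambda>n. (cmod z)\<^sup>2 * (nrm (K w))\<^sup>2 + 2 * Re (z * (ip (K w) (K (s n)) - L w)))
        \<longlonglongrightarrow> (cmod z)\<^sup>2 * (nrm (K w))\<^sup>2 + 2 * Re (z * q)"
      unfolding q_def using g KsV KV[OF w]
      by (intro tendsto_intros ip_right_tendsto) auto
    moreover have "(\<lambda>n. - 1 / real (Suc n)) \<longlonglongrightarrow> 0"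
      using tendsto_minus[OF LIMSEQ_inverse_real_of_nat] by (simp add: inverse_eq_divide)
    ultimately have "0 \<le> (cmod z)\<^sup>2 * (nrm (K w))\<^sup>2 + 2 * Re (z * q)"
      by (intro LIMSEQ_le[of "\<lambda>n. - 1 / real (Suc n)" 0]) auto
    moreover have "Re (z * q) = - \<delta> * (cmod q)\<^sup>2"
    proof -
      have "z * q = complex_of_real (- \<delta> * (cmod q)\<^sup>2)"
        by (simp add: z_def complex_norm_square mult_ac del: of_real_power)
      then show ?thesis by (simp only: Re_complex_of_real)
    qed
    moreover have "(cmod z)\<^sup>2 * (nrm (K w))\<^sup>2 \<le> \<delta> * (cmod q)\<^sup>2"
    proof -
      have "\<delta> * (nrm (K w))\<^sup>2 \<le> 1" by (simp add: \<delta>_def divide_le_eq_1 add_nonneg_pos)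
      then have "\<delta> * (cmod q)\<^sup>2 * (\<delta> * (nrm (K w))\<^sup>2) \<le> \<delta> * (cmod q)\<^sup>2 * 1"
        using \<delta> by (intro mult_left_mono) auto
      then show ?thesis using \<delta> by (simp add: z_def norm_mult power_mult_distrib power2_eq_square mult_ac)
    qed
    ultimately have "\<delta> * (cmod q)\<^sup>2 \<le> 0" by simp
    then show False using \<delta> \<open>ip (K w) g \<noteq> L w\<close> by (simp add: q_def mult_le_0_iff)
  qed
  have "nrm g \<le> C"
  proof (cases "nrm g = 0")
    case False
    have "(\<lambda>n. cmod (ip (K (s n)) g)) \<longlonglongrightarrow> cmod (ip g g)"
      by (intro tendsto_norm ip_left_tendsto g KsV)
    moreover have "(\<lambda>n. C * nrm (K (s n))) \<longlonglongrightarrow> C * nrm g"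
      by (intro tendsto_mult_left nrm_tendsto g KsV)
    moreover have "cmod (ip (K (s n)) g) \<le> C * nrm (K (s n))" for n
      using rep[OF s(1)] bound[OF s(1)] by simp
    ultimately have "cmod (ip g g) \<le> C * nrm g" by (intro LIMSEQ_le) auto
    then have "nrm g * nrm g \<le> C * nrm g"
      using g by (simp add: ip_self norm_power power2_eq_square norm_mult)
    then show ?thesis using False nrm_nonneg[OF g(1)] by simp
  qed (use C in simp)
  moreover have "g \<in> lim_closure (K ` W)"
    unfolding lim_closure_def using g s
    by (intro CollectI conjI exI[of _ "\<lambda>n. K (s n)"]) auto
  ultimately show ?thesis using rep by blast
qed

text \<open>Uniform boundedness, by a gliding hump. Moving by \<open>\<plusminus> 3\<^sup>-\<^sup>n\<close> in the direction of
  \<open>r\<^sub>n\<close>, where \<open>nrm r\<^sub>n > 4\<^sup>n\<close>, makes the inner product with \<open>r\<^sub>n\<close> at least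
  \<open>3\<^sup>-\<^sup>n * nrm r\<^sub>n\<close> for one of the two signs, and all later moves together destroy at most half of it.\<close>

lemma uniform_boundedness:
  assumes E: "E \<subseteq> V" "cfun.subspace E" and closed: "lim_closure E \<subseteq> E" and R: "R \<subseteq> E"
    and weak: "\<And>h. h \<in> E \<Longrightarrow> \<exists>C. \<forall>r\<in>R. cmod (ip h r) \<le> C"
  shows "\<exists>B. \<forall>r\<in>R. nrm r \<le> B"
proof (rule ccontr)
  assume "\<not> ?thesis"
  then have "\<exists>r\<in>R. 4 ^ n < nrm r" for n :: nat by (meson not_le)
  then obtain r where r: "\<And>n::nat. r n \<in> R" "\<And>n. 4 ^ n < nrm (r n)" by metis
  have rE: "r n \<in> E" and rV: "r n \<in> V" for n using r R E by blast+
  have pos: "nrm (r n) > 0" for n using r(2)[of n] zero_less_power[of "4::real" n] by linarith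
  define \<delta> :: "nat \<Rightarrow> real" where "\<delta> n = (1/3) ^ n" for n
  have \<delta>: "\<delta> n > 0" "\<delta> (Suc n) = \<delta> n / 3" for n by (auto simp: \<delta>_def)
  define u where "u n = cscale (complex_of_real (\<delta> n / nrm (r n))) (r n)" for n
  have uE: "u n \<in> E" for n using rE E by (simp add: u_def cfun.subspace_scale)
  then have uV: "u n \<in> V" for n using E by blast
  have nu: "nrm (u n) = \<delta> n" for n
    using rV pos[of n] \<delta>(1)[of n] by (simp add: u_def nrm_scale norm_divide abs_of_pos)
  have ur: "ip (u n) (r n) = complex_of_real (\<delta> n * nrm (r n))" for n
    using rV pos[of n] by (simp add: u_def ip_scale_left ip_self power2_eq_square)
  define step where "step n x =
      (if \<delta> n * nrm (r n) \<le> cmod (ip (x + u n) (r n)) then x + u n else x - u n)" for n x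
  define x where "x = rec_nat 0 step"
  have x_Suc: "x (Suc n) = step n (x n)" and x_0: "x 0 = 0" for n by (auto simp: x_def)
  have xE: "x n \<in> E" for n
  proof (induction n)
    case 0 then show ?case using E by (simp add: x_0 cfun.subspace_0 del: zero_fun_apply)
  next
    case (Suc n)
    then show ?case using E(2) uE
      by (auto simp: x_Suc step_def intro: cfun.subspace_add cfun.subspace_diff)
  qed
  then have xV: "x n \<in> V" for n using E by blast
  have big: "\<delta> n * nrm (r n) \<le> cmod (ip (x (Suc n)) (r n))" for n
  proof (cases "\<delta> n * nrm (r n) \<le> cmod (ip (x n + u n) (r n))")
    case False
    have "ip (x n + u n) (r n) - ip (x n - u n) (r n) = complex_of_real (2 * \<delta> n * nrm (r n))"
      using xV uV rV ur by (simp add: ip_add_left ip_diff_left)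
    then have "cmod (ip (x n + u n) (r n) - ip (x n - u n) (r n)) = 2 * \<delta> n * nrm (r n)"
      using \<delta>(1)[of n] pos[of n] by (simp only: norm_of_real) simp
    then have "2 * \<delta> n * nrm (r n) \<le> cmod (ip (x n + u n) (r n)) + cmod (ip (x n - u n) (r n))"
      using norm_triangle_ineq4 by metis
    then show ?thesis using False by (simp add: x_Suc step_def)
  qed (simp add: x_Suc step_def)
  have small_step: "nrm (x (Suc n) - x n) = \<delta> n" for n
    using nu[of n] nrm_uminus[OF uV, of n] xV uV by (auto simp: x_Suc step_def)
  have tail: "nrm (x (n + k) - x n) \<le> 3/2 * (\<delta> n - \<delta> (n + k))" for n k
  proof (induction k)
    case 0
    have "x (n + 0) - x n = 0" by (simp only: add_0_right diff_self)
    then show ?case by (simp only: nrm_zero) simp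
  next
    case (Suc k)
    have "nrm (x (n + Suc k) - x n) \<le> nrm (x (Suc (n + k)) - x (n + k)) + nrm (x (n + k) - x n)"
      using nrm_triangle3[OF xV xV xV] by simp
    also have "\<dots> \<le> \<delta> (n + k) + 3/2 * (\<delta> n - \<delta> (n + k))"
      using Suc.IH small_step[of "n + k"] by linarith
    also have "\<dots> = 3/2 * (\<delta> n - \<delta> (n + Suc k))"
      unfolding add_Suc_right \<delta>(2)[of "n + k"] by (simp add: field_simps)
    finally show ?case .
  qed
  have tail': "nrm (x m - x n) \<le> 3/2 * \<delta> n" if "n \<le> m" for n m
    using tail[of n "m - n"] that \<delta>(1)[of m] by simp
  have \<delta>0: "\<delta> \<longlonglongrightarrow> 0" unfolding \<delta>_def by (intro LIMSEQ_power_zero) auto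
  have "\<exists>l\<in>V. (\<lambda>n. nrm (x n - l)) \<longlonglongrightarrow> 0"
  proof (rule cauchy_convergent)
    fix \<epsilon> :: real assume "\<epsilon> > 0"
    then have "\<forall>\<^sub>F n in sequentially. \<delta> n < \<epsilon> / 3"
      using \<delta>0 by (intro order_tendstoD) auto
    then obtain N where N: "\<delta> N < \<epsilon> / 3" by (auto simp: eventually_sequentially)
    have "nrm (x n - x m) < \<epsilon>" if "N \<le> n" "N \<le> m" for n m
      using nrm_triangle3[OF xV xV xV, of n m N] tail'[OF that(1)] tail'[OF that(2)] N
        nrm_minus_commute[OF xV xV, of N m] by simp
    then show "\<exists>N. \<forall>n\<ge>N. \<forall>m\<ge>N. nrm (x n - x m) < \<epsilon>" by blast
  qed (rule xV)
  then obtain l where l: "l \<in> V" "(\<lambda>n. nrm (x n - l)) \<longlonglongrightarrow> 0" by blast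
  then have "l \<in> lim_closure E" unfolding lim_closure_def using xE by blast
  then have lE: "l \<in> E" using closed by blast
  have lim: "nrm (x n - l) \<le> 3/2 * \<delta> n" for n
  proof (rule LIMSEQ_le_const2)
    have "(\<lambda>m. nrm ((x m - x n) - (l - x n))) \<longlonglongrightarrow> 0" using l(2) by simp
    then have "(\<lambda>m. nrm (x m - x n)) \<longlonglongrightarrow> nrm (l - x n)"
      using xV l by (intro nrm_tendsto) auto
    then show "(\<lambda>m. nrm (x m - x n)) \<longlonglongrightarrow> nrm (x n - l)"
      using nrm_minus_commute[OF l(1) xV[of n]] by simp
    show "\<exists>N. \<forall>m\<ge>N. nrm (x m - x n) \<le> 3/2 * \<delta> n" using tail' by blast
  qed
  have lower: "(4/3) ^ n / 2 \<le> cmod (ip l (r n))" for n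
  proof -
    have "cmod (ip (x (Suc n) - l) (r n)) \<le> nrm (x (Suc n) - l) * nrm (r n)"
      by (rule cauchy_schwarz[OF V_diff[OF xV l(1)] rV])
    also have "\<dots> \<le> 3/2 * \<delta> (Suc n) * nrm (r n)"
      using lim[of "Suc n"] pos[of n] by (intro mult_right_mono) auto
    also have "\<dots> = \<delta> n * nrm (r n) / 2" by (simp add: \<delta>(2))
    finally have "cmod (ip (x (Suc n)) (r n)) - cmod (ip l (r n)) \<le> \<delta> n * nrm (r n) / 2"
      using norm_triangle_ineq2[of "ip (x (Suc n)) (r n)" "ip l (r n)"] xV l rV
      by (simp add: ip_diff_left)
    then have "\<delta> n * nrm (r n) / 2 \<le> cmod (ip l (r n))" using big[of n] by simp
    moreover have "(4/3) ^ n \<le> \<delta> n * nrm (r n)"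
      using r(2)[of n] by (simp add: \<delta>_def power_divide divide_right_mono)
    ultimately show ?thesis by linarith
  qed
  obtain C where C: "\<forall>r\<in>R. cmod (ip l r) \<le> C" using weak[OF lE] by blast
  obtain n where "2 * C < (4/3 :: real) ^ n" using real_arch_pow[of "4/3"] by auto
  moreover have "(4/3) ^ n / 2 \<le> C" using lower[of n] C r(1)[of n] by (meson order_trans)
  ultimately show False by simp
qed

end

section \<open>Forms with finitely many negative squares\<close>

text \<open>Modulo \<open>E\<close> the \<open>n\<close> vectors lie in a space of dimension less than \<open>n\<close>.\<close>

lemma combination_in_subspace:
  assumes E: "cfun.subspace E" and B: "finite B" "card B < n"
    and g: "\<And>i. i < n \<Longrightarrow> \<exists>e\<in>E. \<exists>f\<in>cfun.span B. g i = e + f"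
  shows "\<exists>a. (\<exists>i<n. a i \<noteq> 0) \<and> (lincomb n a g) \<in> E"
proof -
  have "\<exists>e u. e \<in> E \<and> g i = e + (\<Sum>v\<in>B. cscale (u v) v)" if i: "i < n" for i
  proof -
    obtain e f where "e \<in> E" "f \<in> cfun.span B" "g i = e + f" using g[OF i] by blast
    moreover from this obtain u where "f = (\<Sum>v\<in>B. cscale (u v) v)"
      unfolding cfun.span_finite[OF B(1)] by blast
    ultimately show ?thesis by blast
  qed
  then obtain e u where eu: "\<And>i. i < n \<Longrightarrow> e i \<in> E"
    "\<And>i. i < n \<Longrightarrow> g i = e i + (\<Sum>v\<in>B. cscale (u i v) v)" by metis
  obtain \<beta> where \<beta>: "bij_betw \<beta> {..<card B} B"
    using ex_bij_betw_nat_finite[OF B(1)] unfolding atLeast0LessThan by blast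
  obtain a where a: "\<exists>i<n. a i \<noteq> 0" "\<forall>s<card B. (\<Sum>i<n. u i (\<beta> s) * a i) = 0"
    using underdetermined_system[OF B(2), of "\<lambda>s i. u i (\<beta> s)"] by blast
  have zero: "(\<Sum>i<n. a i * u i v) = 0" if v: "v \<in> B" for v
  proof -
    obtain s where "s < card B" "v = \<beta> s"
      using bij_betw_imp_surj_on[OF \<beta>] v by (metis imageE lessThan_iff)
    then show ?thesis using a(2) by (simp add: mult.commute)
  qed
  have "(lincomb n a g) =
      (\<Sum>i<n. cscale (a i) (e i) + (\<Sum>v\<in>B. cscale (a i * u i v) v))"
    by (intro sum.cong refl)
      (simp only: lessThan_iff eu(2) cfun.scale_right_distrib cfun.scale_sum_right cfun.scale_scale)
  also have "\<dots> = (lincomb n a e) + (\<Sum>i<n. \<Sum>v\<in>B. cscale (a i * u i v) v)"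
    by (rule sum.distrib)
  also have "(\<Sum>i<n. \<Sum>v\<in>B. cscale (a i * u i v) v) = (\<Sum>v\<in>B. cscale (\<Sum>i<n. a i * u i v) v)"
    by (subst sum.swap) (simp only: cfun.scale_sum_left)
  also have "\<dots> = (\<Sum>v\<in>B. cscale 0 v)"
    by (intro sum.cong refl) (simp only: zero)
  also have "\<dots> = 0" by (simp only: cfun.scale_zero_left sum.neutral_const)
  finally have "(lincomb n a g) = (lincomb n a e)"
    by (simp only: add_0_right)
  moreover have "(lincomb n a e) \<in> E"
    using E eu(1) by (intro cfun.subspace_sum cfun.subspace_scale) auto
  ultimately show ?thesis using a(1) by auto
qed

locale hermitian_form =
  fixes W :: "('a \<Rightarrow> complex) set"
    and B :: "('a \<Rightarrow> complex) \<Rightarrow> ('a \<Rightarrow> complex) \<Rightarrow> complex"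
  assumes W: "cfun.subspace W"
    and B_add: "\<And>c d e. c \<in> W \<Longrightarrow> d \<in> W \<Longrightarrow> e \<in> W \<Longrightarrow> B (c + d) e = B c e + B d e"
    and B_scale: "\<And>a c d. c \<in> W \<Longrightarrow> d \<in> W \<Longrightarrow> B (cscale a c) d = a * B c d"
    and B_commute: "\<And>c d. c \<in> W \<Longrightarrow> d \<in> W \<Longrightarrow> B d c = cnj (B c d)"
begin

lemma B_sum:
  assumes "\<And>i. i \<in> I \<Longrightarrow> f i \<in> W" "d \<in> W"
  shows "B (\<Sum>i\<in>I. cscale (a i) (f i)) d = (\<Sum>i\<in>I. a i * B (f i) d)"
  using assms(1)
proof (induction I rule: infinite_finite_induct)
  case (insert x I)
  let ?s = "\<Sum>i\<in>I. cscale (a i) (f i)"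
  have fx: "f x \<in> W" and sW: "?s \<in> W"
    using insert W by (blast intro: cfun.subspace_sum cfun.subspace_scale)+
  have "B (\<Sum>i\<in>insert x I. cscale (a i) (f i)) d = B (cscale (a x) (f x) + ?s) d"
    by (subst sum.insert[OF insert(1,2)]) (rule refl)
  also have "\<dots> = a x * B (f x) d + B ?s d"
    using fx sW assms(2) cfun.subspace_scale[OF W fx] by (simp only: B_add B_scale)
  also have "B ?s d = (\<Sum>i\<in>I. a i * B (f i) d)" using insert by blast
  finally show ?case using insert(1,2) by simp
next
  case empty
  have "B (cscale 0 d) d = 0" using B_scale[OF assms(2,2)] by (simp only: mult_zero_left)
  then show ?case by (simp only: cfun.scale_zero_left sum.empty)
next
  case (infinite I)
  have "B (cscale 0 d) d = 0" using B_scale[OF assms(2,2)] by (simp only: mult_zero_left)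
  then show ?case using infinite(1) by (simp only: cfun.scale_zero_left sum.infinite simp_thms)
qed

definition neg_orthonormal :: "(nat \<Rightarrow> 'a \<Rightarrow> complex) \<Rightarrow> nat \<Rightarrow> bool" where
  "neg_orthonormal b r \<longleftrightarrow>
     (\<forall>i<r. b i \<in> W) \<and> (\<forall>i<r. \<forall>j<r. B (b i) (b j) = (if i = j then - 1 else 0))"

lemma B_neg_orthonormal_sum:
  assumes "neg_orthonormal b r" "j < r"
  shows "B (lincomb r a b) (b j) = - a j"
proof -
  have "B (lincomb r a b) (b j) = (\<Sum>i<r. a i * B (b i) (b j))"
    using assms by (intro B_sum) (auto simp: neg_orthonormal_def)
  also have "\<dots> = (\<Sum>i<r. if i = j then - a i else 0)"
    using assms by (intro sum.cong) (auto simp: neg_orthonormal_def)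
  finally show ?thesis using assms(2) by (simp add: sum.delta)
qed

lemma neg_orthonormal_form:
  assumes b: "neg_orthonormal b r"
  shows "Re (B (lincomb r a b) (lincomb r a b)) = - (\<Sum>i<r. (cmod (a i))\<^sup>2)"
proof -
  define f where "f = (lincomb r a b)"
  have bW: "b i \<in> W" if "i < r" for i using b that by (simp add: neg_orthonormal_def)
  have f: "f \<in> W" unfolding f_def using bW W by (intro cfun.subspace_sum cfun.subspace_scale) auto
  have "B f f = (\<Sum>i<r. a i * B (b i) f)"
    using f bW by (subst f_def, intro B_sum) auto
  also have "\<dots> = (\<Sum>i<r. - complex_of_real ((cmod (a i))\<^sup>2))"
  proof (rule sum.cong[OF refl])
    fix i assume "i \<in> {..<r}"
    then have i: "i < r" by simp
    have "B (b i) f = cnj (B f (b i))" using f bW[OF i] by (rule B_commute)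
    also have "B f (b i) = - a i" unfolding f_def by (rule B_neg_orthonormal_sum[OF b i])
    finally show "a i * B (b i) f = - complex_of_real ((cmod (a i))\<^sup>2)"
      by (simp add: complex_norm_square del: of_real_power)
  qed
  finally have "B f f = complex_of_real (- (\<Sum>i<r. (cmod (a i))\<^sup>2))"
    by (simp add: sum_negf)
  then show ?thesis by (simp only: f_def Re_complex_of_real)
qed

text \<open>The length of a neg-orthonormal family is bounded by \<open>m\<close>, so there is one of maximal length. On
  its orthogonal complement the form is nonnegative, since a negative vector there could be added to
  the family.\<close>

lemma maximal_neg_orthonormal:
  assumes no: "\<not> (\<exists>f. (\<forall>i<Suc m. f i \<in> W) \<and> (\<forall>a. (\<exists>i<Suc m. a i \<noteq> 0) \<longrightarrow>
      Re (B (lincomb (Suc m) a f) (lincomb (Suc m) a f)) < 0))"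
  shows "\<exists>b r. neg_orthonormal b r \<and> r \<le> m \<and>
    (\<forall>c\<in>W. (\<forall>i<r. B c (b i) = 0) \<longrightarrow> 0 \<le> Re (B c c))"
proof -
  define P where "P r \<longleftrightarrow> (\<exists>b. neg_orthonormal b r)" for r
  have bound: "r \<le> m" if Pr: "P r" for r
  proof (rule ccontr)
    assume r: "\<not> r \<le> m"
    obtain b where "neg_orthonormal b r" using Pr P_def by blast
    then have b: "neg_orthonormal b (Suc m)" using r by (auto simp: neg_orthonormal_def)
    have "Re (B (lincomb (Suc m) a b) (lincomb (Suc m) a b)) < 0"
      if a: "\<exists>i<Suc m. a i \<noteq> 0" for a
    proof -
      obtain i where i: "i < Suc m" "a i \<noteq> 0" using a by blast
      have "0 < (\<Sum>i<Suc m. (cmod (a i))\<^sup>2)"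
        using i by (intro sum_pos2[of _ i]) auto
      then show ?thesis unfolding neg_orthonormal_form[OF b] by linarith
    qed
    moreover have "\<forall>i<Suc m. b i \<in> W" using b by (simp add: neg_orthonormal_def)
    ultimately show False using no by blast
  qed
  have "P 0" by (simp add: P_def neg_orthonormal_def)
  then obtain r where r: "P r" and greatest: "\<And>s. P s \<Longrightarrow> s \<le> r"
    using ex_has_greatest_nat[of P 0 "\<lambda>x. x" "Suc m"] bound by (metis le_imp_less_Suc)
  obtain b where b: "neg_orthonormal b r" using r P_def by blast
  have "0 \<le> Re (B c c)" if c: "c \<in> W" and orth: "\<And>i. i < r \<Longrightarrow> B c (b i) = 0" for c
  proof (rule ccontr)
    assume "\<not> 0 \<le> Re (B c c)"
    then have neg: "Re (B c c) < 0" by simp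
    \<comment> \<open>normalise \<open>c\<close> to the value \<open>- 1\<close> of the form\<close>
    define s where "s = 1 / sqrt (- Re (B c c))"
    define u where "u = cscale (complex_of_real s) c"
    have u: "u \<in> W" using c W by (simp add: u_def cfun.subspace_scale)
    have Bcc: "B c c = complex_of_real (Re (B c c))"
      using B_commute[OF c c] by (simp add: complex_eq_iff)
    have "B u u = complex_of_real s * cnj (complex_of_real s * cnj (B c c))"
      using B_scale[OF c u] B_commute[OF u c] B_commute[OF c c] B_scale[OF c c]
      unfolding u_def by simp
    also have "\<dots> = complex_of_real (s\<^sup>2 * Re (B c c))"
      by (subst Bcc) (simp add: power2_eq_square)
    also have "s\<^sup>2 * Re (B c c) = - 1"
      using neg by (simp add: s_def power_divide)
    finally have uu: "B u u = - 1" by simp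
    have ub: "B u (b i) = 0" "B (b i) u = 0" if i: "i < r" for i
    proof -
      have bi: "b i \<in> W" using b i by (simp add: neg_orthonormal_def)
      show "B u (b i) = 0" using B_scale[OF c bi] orth[OF i] by (simp add: u_def)
      then show "B (b i) u = 0" using B_commute[OF u bi] by simp
    qed
    have "neg_orthonormal (b(r := u)) (Suc r)"
      using b u uu ub by (auto simp: neg_orthonormal_def less_Suc_eq)
    then have "P (Suc r)" unfolding P_def by blast
    then show False using greatest by fastforce
  qed
  then show ?thesis using b bound[OF r] by blast
qed

end

section \<open>The metric of a Hilbert space of functions\<close>

context
  fixes H :: "'a function_space"
  assumes ip: "inner_product_functions (elements H) (inner_prod H)"
begin

interpretation ip: inner_product_functions "elements H" "inner_prod H"
  by (rule ip)

lemma nrm_eq_hnorm': "inner_product_functions.nrm (inner_prod H) f = hnorm H f"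
  by (simp add: ip.nrm_def hnorm_def)

lemma Metric_space_hdist: "Metric_space (elements H) (hdist H)"
proof
  show "0 \<le> hdist H x y" for x y
    by (auto simp: hdist_def simp flip: nrm_eq_hnorm')
  show "hdist H x y = hdist H y x" for x y
    using ip.nrm_minus_commute[of x y] by (auto simp: hdist_def simp flip: nrm_eq_hnorm')
  show "hdist H x y = 0 \<longleftrightarrow> x = y" if "x \<in> elements H" "y \<in> elements H" for x y
    using that ip.nrm_eq_0[of "x - y"] by (simp add: hdist_def flip: nrm_eq_hnorm')
  show "hdist H x z \<le> hdist H x y + hdist H y z"
    if "x \<in> elements H" "y \<in> elements H" "z \<in> elements H" for x y z
    using that ip.nrm_triangle3[of x y z] by (simp add: hdist_def flip: nrm_eq_hnorm')
qed

interpretation M: Metric_space "elements H" "hdist H"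
  by (rule Metric_space_hdist)

lemma limitin_hdist_iff:
  assumes "\<And>n. \<sigma> n \<in> elements H" "l \<in> elements H"
  shows "limitin M.mtopology \<sigma> l sequentially \<longleftrightarrow> (\<lambda>n. hnorm H (\<sigma> n - l)) \<longlonglongrightarrow> 0"
  unfolding M.limit_metric_sequentially LIMSEQ_iff
  using assms ip.nrm_nonneg by (simp add: hdist_def flip: nrm_eq_hnorm')

lemma mcomplete_hdist_iff:
  "M.mcomplete \<longleftrightarrow> (\<forall>\<sigma>. (\<forall>n. \<sigma> n \<in> elements H) \<longrightarrow>
      (\<forall>\<epsilon>>0. \<exists>N. \<forall>n\<ge>N. \<forall>m\<ge>N. hnorm H (\<sigma> n - \<sigma> m) < \<epsilon>) \<longrightarrow>
      (\<exists>l\<in>elements H. (\<lambda>n. hnorm H (\<sigma> n - l)) \<longlonglongrightarrow> 0))"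
proof -
  have cauchy: "M.MCauchy \<sigma> \<longleftrightarrow> (\<forall>n. \<sigma> n \<in> elements H) \<and>
      (\<forall>\<epsilon>>0. \<exists>N. \<forall>n\<ge>N. \<forall>m\<ge>N. hnorm H (\<sigma> n - \<sigma> m) < \<epsilon>)" for \<sigma>
  proof (cases "\<forall>n. \<sigma> n \<in> elements H")
    case True
    then have "hdist H (\<sigma> n) (\<sigma> m) = hnorm H (\<sigma> n - \<sigma> m)" for n m by (simp add: hdist_def)
    then show ?thesis using True unfolding M.MCauchy_def by auto
  next
    case False
    then show ?thesis unfolding M.MCauchy_def by blast
  qed
  have lim: "(\<exists>l. limitin M.mtopology \<sigma> l sequentially) \<longleftrightarrow>
      (\<exists>l\<in>elements H. (\<lambda>n. hnorm H (\<sigma> n - l)) \<longlonglongrightarrow> 0)" if "\<forall>n. \<sigma> n \<in> elements H" for \<sigma>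
  proof
    assume "\<exists>l. limitin M.mtopology \<sigma> l sequentially"
    then obtain l where l: "limitin M.mtopology \<sigma> l sequentially" by blast
    then have "l \<in> elements H" by (simp add: M.limit_metric_sequentially)
    then show "\<exists>l\<in>elements H. (\<lambda>n. hnorm H (\<sigma> n - l)) \<longlonglongrightarrow> 0"
      using l limitin_hdist_iff[of \<sigma> l] that by blast
  next
    assume "\<exists>l\<in>elements H. (\<lambda>n. hnorm H (\<sigma> n - l)) \<longlonglongrightarrow> 0"
    then show "\<exists>l. limitin M.mtopology \<sigma> l sequentially"
      using limitin_hdist_iff[of \<sigma>] that by blast
  qed
  show ?thesis unfolding M.mcomplete_def cauchy using lim by auto
qed

lemma continuous_map_evaluation:
  assumes bound: "\<And>f. f \<in> elements H \<Longrightarrow> cmod (f x) \<le> C * hnorm H f"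
  shows "continuous_map M.mtopology euclidean (\<lambda>h. h x)"
proof -
  have "openin M.mtopology {h \<in> elements H. h x \<in> U}" if U: "open U" for U
    unfolding M.openin_mtopology
  proof (intro conjI allI impI)
    fix h assume h: "h \<in> {h \<in> elements H. h x \<in> U}"
    then obtain e where e: "e > 0" "ball (h x) e \<subseteq> U" using U openE by blast
    define r where "r = e / (\<bar>C\<bar> + 1)"
    have r: "r > 0" using e by (simp add: r_def add_nonneg_pos)
    have "g \<in> {h \<in> elements H. h x \<in> U}" if "g \<in> M.mball h r" for g
    proof -
      have g: "g \<in> elements H" "hnorm H (h - g) < r" using that h by (auto simp: hdist_def)
      have "h - g \<in> elements H" using g h by simp
      then have "cmod (h x - g x) \<le> C * hnorm H (h - g)" using bound[of "h - g"] by simp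
      also have "\<dots> \<le> \<bar>C\<bar> * hnorm H (h - g)"
        using ip.nrm_nonneg[OF \<open>h - g \<in> elements H\<close>] by (intro mult_right_mono) (auto simp: nrm_eq_hnorm')
      also have "\<dots> \<le> \<bar>C\<bar> * r" using g(2) by (intro mult_left_mono) auto
      also have "\<dots> < (\<bar>C\<bar> + 1) * r" using r by (simp add: algebra_simps)
      also have "\<dots> = e" by (simp add: r_def)
      finally have "g x \<in> ball (h x) e" by (simp add: dist_norm)
      then show ?thesis using e g by blast
    qed
    then show "\<exists>r>0. M.mball h r \<subseteq> {h \<in> elements H. h x \<in> U}" using r by blast
  qed auto
  then show ?thesis by (simp add: continuous_map_def)
qed

end

context hilbert_function_space
begin

sublocale inner_product_functions "elements H" "inner_prod H"
  using subspace_elements inner_add inner_scale inner_commute inner_nonneg inner_definite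
  by unfold_locales

lemma nrm_eq_hnorm: "nrm f = hnorm H f"
  by (rule nrm_eq_hnorm') unfold_locales

interpretation M: Metric_space "elements H" "hdist H"
  by (rule Metric_space_hdist) unfold_locales

lemma limitin_iff:
  assumes "\<And>n. \<sigma> n \<in> elements H" "l \<in> elements H"
  shows "limitin M.mtopology \<sigma> l sequentially \<longleftrightarrow> (\<lambda>n. nrm (\<sigma> n - l)) \<longlonglongrightarrow> 0"
  unfolding nrm_eq_hnorm using inner_product_functions_axioms assms by (rule limitin_hdist_iff)

sublocale hilbert_functions "elements H" "inner_prod H"
proof
  fix \<sigma> :: "nat \<Rightarrow> 'a \<Rightarrow> complex"
  assume \<sigma>: "\<And>n. \<sigma> n \<in> elements H"
    and cauchy: "\<And>\<epsilon>. \<epsilon> > 0 \<Longrightarrow> \<exists>N. \<forall>n\<ge>N. \<forall>m\<ge>N. nrm (\<sigma> n - \<sigma> m) < \<epsilon>"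
  show "\<exists>l\<in>elements H. (\<lambda>n. nrm (\<sigma> n - l)) \<longlonglongrightarrow> 0"
    using complete \<sigma> cauchy
    unfolding mcomplete_hdist_iff[OF inner_product_functions_axioms] nrm_eq_hnorm by blast
qed

lemma closed_subspace_iff:
  "closed_subspace H E \<longleftrightarrow> cfun.subspace E \<and> E \<subseteq> elements H \<and> lim_closure E \<subseteq> E"
proof -
  have "(\<forall>\<sigma> l. range \<sigma> \<subseteq> E \<and> limitin M.mtopology \<sigma> l sequentially \<longrightarrow> l \<in> E) \<longleftrightarrow> lim_closure E \<subseteq> E"
    if E: "E \<subseteq> elements H"
  proof (intro iffI subsetI allI impI)
    fix l assume *: "\<forall>\<sigma> l. range \<sigma> \<subseteq> E \<and> limitin M.mtopology \<sigma> l sequentially \<longrightarrow> l \<in> E"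
      and "l \<in> lim_closure E"
    then obtain \<sigma> where "l \<in> elements H" "\<And>n. \<sigma> n \<in> E" "(\<lambda>n. nrm (\<sigma> n - l)) \<longlonglongrightarrow> 0"
      unfolding lim_closure_def by blast
    then have "limitin M.mtopology \<sigma> l sequentially" "range \<sigma> \<subseteq> E"
      using E limitin_iff[of \<sigma> l] by blast+
    then show "l \<in> E" using * by blast
  next
    fix \<sigma> l assume *: "lim_closure E \<subseteq> E" "range \<sigma> \<subseteq> E \<and> limitin M.mtopology \<sigma> l sequentially"
    then have l: "l \<in> elements H" by (simp add: M.limit_metric_sequentially)
    have "\<sigma> n \<in> E" for n using * by blast
    moreover from this have "(\<lambda>n. nrm (\<sigma> n - l)) \<longlonglongrightarrow> 0"
      using * E l limitin_iff[of \<sigma> l] by blast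
    ultimately have "l \<in> lim_closure E" using l unfolding lim_closure_def by blast
    then show "l \<in> E" using * by blast
  qed
  then show ?thesis
    unfolding closed_subspace_def M.metric_closedin_iff_sequentially_closed by blast
qed

text \<open>The span of \<open>b\<close> is the complementary subspace, by orthogonal projection.\<close>

lemma orthogonal_complement:
  assumes b: "orthonormal b m"
  defines "E \<equiv> {f \<in> elements H. \<forall>i<m. inner_prod H f (b i) = 0}"
  shows "closed_subspace H E" "has_codim H E m"
proof -
  have bH: "b i \<in> elements H" if "i < m" for i using b that by (simp add: orthonormal_def)
  have sub: "cfun.subspace E"
  proof (rule cfun.subspaceI)
    show "0 \<in> E" using bH by (simp add: E_def ip_zero_left V_zero del: zero_fun_apply)
    fix x y c assume x: "x \<in> E"
    then show "cscale c x \<in> E" using bH by (simp add: E_def ip_scale_left)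
    assume "y \<in> E"
    then show "x + y \<in> E" using x bH by (simp add: E_def ip_add_left)
  qed
  moreover have "lim_closure E \<subseteq> E"
  proof
    fix l assume "l \<in> lim_closure E"
    then obtain \<sigma> where l: "l \<in> elements H" "\<And>n. \<sigma> n \<in> E" "(\<lambda>n. nrm (\<sigma> n - l)) \<longlonglongrightarrow> 0"
      unfolding lim_closure_def by blast
    have "inner_prod H l (b i) = 0" if i: "i < m" for i
    proof -
      have "(\<lambda>n. inner_prod H (\<sigma> n) (b i)) \<longlonglongrightarrow> inner_prod H l (b i)"
        using l(2) by (intro ip_left_tendsto[OF _ l(1) bH[OF i] l(3)]) (simp add: E_def)
      moreover have "inner_prod H (\<sigma> n) (b i) = 0" for n using l(2)[of n] i by (simp add: E_def)
      ultimately show ?thesis by (simp add: LIMSEQ_const_iff)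
    qed
    then show "l \<in> E" using l(1) by (simp add: E_def)
  qed
  ultimately show "closed_subspace H E" by (auto simp: closed_subspace_iff E_def)
  define F where "F = cfun.span (b ` {..<m})"
  have FH: "F \<subseteq> elements H" unfolding F_def using b by (rule orthonormal_span_subset)
  have "E \<inter> F = {0}"
  proof (intro equalityI subsetI)
    fix f assume f: "f \<in> E \<inter> F"
    have "f \<in> cfun.span (b ` {..<m}) \<Longrightarrow> inner_prod H f f = 0"
    proof -
      have fH: "f \<in> elements H" using f by (simp add: E_def)
      have "F \<subseteq> {g \<in> elements H. inner_prod H f g = 0}"
        unfolding F_def
      proof (rule cfun.span_minimal)
        show "cfun.subspace {g \<in> elements H. inner_prod H f g = 0}"
        proof (rule cfun.subspaceI)
          show "0 \<in> {g \<in> elements H. inner_prod H f g = 0}"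
            using fH V_zero ip_zero_right by blast
        qed (use fH in \<open>simp_all add: ip_add_right ip_scale_right\<close>)
        show "b ` {..<m} \<subseteq> {g \<in> elements H. inner_prod H f g = 0}"
          using f bH by (auto simp: E_def)
      qed
      then show ?thesis using f by blast
    qed
    then have "f = 0" using f inner_definite[of f] by (auto simp: E_def F_def)
    then show "f \<in> {0}" by blast
  next
    fix f :: "'a \<Rightarrow> complex" assume "f \<in> {0}"
    then have "f = 0" by blast
    then show "f \<in> E \<inter> F" using cfun.subspace_0[OF sub] cfun.span_zero unfolding F_def by blast
  qed
  moreover have "elements H = {e + f | e f. e \<in> E \<and> f \<in> F}"
  proof (intro equalityI subsetI)
    fix h assume h: "h \<in> elements H"
    have "h - proj b m h \<in> E"
      using h b ip_minus_proj[OF b h] unfolding E_def by simp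
    moreover have "proj b m h \<in> F" unfolding F_def by (rule proj_in_span)
    moreover have "h = (h - proj b m h) + proj b m h" by (rule diff_add_cancel[symmetric])
    ultimately show "h \<in> {e + f | e f. e \<in> E \<and> f \<in> F}" by blast
  next
    fix h assume "h \<in> {e + f | e f. e \<in> E \<and> f \<in> F}"
    then obtain e f where "e \<in> elements H" "f \<in> elements H" "h = e + f" using FH by (auto simp: E_def)
    then show "h \<in> elements H" by (simp only: V_add)
  qed
  ultimately show "has_codim H E m"
    using orthonormal_has_fin_dim[OF b] FH unfolding has_codim_def F_def by blast
qed

end

section \<open>Multiplication and the kernel\<close>

abbreviation defect_kernel ::
  "('a \<Rightarrow> 'a \<Rightarrow> complex) \<Rightarrow> ('a \<Rightarrow> complex) \<Rightarrow> real \<Rightarrow> 'a \<Rightarrow> 'a \<Rightarrow> complex" where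
  "defect_kernel k w t \<equiv> \<lambda>x y. (complex_of_real (t\<^sup>2) - w x * cnj (w y)) * k x y"

locale kernel_space = hilbert_function_space H for H :: "'a function_space" +
  fixes k :: "'a \<Rightarrow> 'a \<Rightarrow> complex"
  assumes reproducing: "reproducing_kernel H k"
begin

lemma kernel_in: "x \<in> points H \<Longrightarrow> (\<lambda>y. k y x) \<in> elements H"
  using reproducing by (simp add: reproducing_kernel_def)

lemma kernel_eval: "x \<in> points H \<Longrightarrow> f \<in> elements H \<Longrightarrow> inner_prod H f (\<lambda>y. k y x) = f x"
  using reproducing by (simp add: reproducing_kernel_def)

lemma kernel_eval_left: "x \<in> points H \<Longrightarrow> f \<in> elements H \<Longrightarrow> inner_prod H (\<lambda>y. k y x) f = cnj (f x)"
  using inner_commute[of f "\<lambda>y. k y x"] by (simp add: kernel_in kernel_eval)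

lemma kernel_hermitian: "x \<in> points H \<Longrightarrow> y \<in> points H \<Longrightarrow> k x y = cnj (k y x)"
  using kernel_eval[of x "\<lambda>z. k z y"] kernel_eval_left[of y "\<lambda>z. k z x"] by (simp add: kernel_in)

text \<open>For \<open>w = 1\<close> this is the combination of kernel functions with coefficients \<open>c\<close>; in general
  it is the image of that combination under \<open>k\<^sub>x \<mapsto> cnj (w x) k\<^sub>x\<close>, the formal adjoint of
  multiplication by \<open>w\<close>. Taking \<open>c\<close> as the argument makes it well defined even if the \<open>k\<^sub>x\<close> are
  linearly dependent.\<close>

definition synth :: "('a \<Rightarrow> complex) \<Rightarrow> ('a \<Rightarrow> complex) \<Rightarrow> 'a \<Rightarrow> complex" where
  "synth w c = (\<Sum>x | c x \<noteq> 0. cscale (c x * cnj (w x)) (\<lambda>y. k y x))"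

context
  fixes D assumes D: "D \<subseteq> points H"
begin

lemma synth_in:
  assumes "c \<in> finsupp D" shows "synth w c \<in> elements H"
  unfolding synth_def using assms D kernel_in by (intro V_sum V_scale) (auto simp: finsupp_def)

lemma ip_synth:
  assumes c: "c \<in> finsupp D" and h: "h \<in> elements H"
  shows "inner_prod H h (synth w c) = (\<Sum>x | c x \<noteq> 0. cnj (c x) * w x * h x)"
proof -
  have supp: "x \<in> points H" if "c x \<noteq> 0" for x using c D that by (auto simp: finsupp_def)
  have "inner_prod H h (synth w c) =
      (\<Sum>x | c x \<noteq> 0. inner_prod H h (cscale (c x * cnj (w x)) (\<lambda>y. k y x)))"
    unfolding synth_def using supp kernel_in h by (intro ip_sum_right) auto
  also have "\<dots> = (\<Sum>x | c x \<noteq> 0. cnj (c x) * w x * h x)"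
    using supp kernel_in h kernel_eval by (intro sum.cong) (auto simp: ip_scale_right)
  finally show ?thesis .
qed

lemma synth_superset:
  assumes "finite S" "{x. c x \<noteq> 0} \<subseteq> S"
  shows "synth w c = (\<Sum>x\<in>S. cscale (c x * cnj (w x)) (\<lambda>y. k y x))"
  unfolding synth_def using assms
  by (intro sum.mono_neutral_left) (auto simp: fun_eq_iff)

lemma synth_add:
  assumes "c \<in> finsupp D" "d \<in> finsupp D"
  shows "synth w (c + d) = synth w c + synth w d"
proof -
  let ?S = "{x. c x \<noteq> 0} \<union> {x. d x \<noteq> 0}"
  have S: "finite ?S" "{x. (c + d) x \<noteq> 0} \<subseteq> ?S" "{x. c x \<noteq> 0} \<subseteq> ?S" "{x. d x \<noteq> 0} \<subseteq> ?S"
    using assms by (auto simp: finsupp_def)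
  show ?thesis
    unfolding synth_superset[OF S(1,2)] synth_superset[OF S(1,3)] synth_superset[OF S(1,4)]
      sum.distrib[symmetric]
    by (intro sum.cong refl) (simp add: fun_eq_iff algebra_simps)
qed

lemma synth_scale:
  assumes "c \<in> finsupp D" shows "synth w (cscale a c) = cscale a (synth w c)"
proof -
  have S: "finite {x. c x \<noteq> 0}" "{x. cscale a c x \<noteq> 0} \<subseteq> {x. c x \<noteq> 0}" "{x. c x \<noteq> 0} \<subseteq> {x. c x \<noteq> 0}"
    using assms by (auto simp: finsupp_def)
  show ?thesis
    unfolding synth_superset[OF S(1,2)] synth_superset[OF S(1,3)] cfun.scale_sum_right
    by (intro sum.cong refl) (simp add: fun_eq_iff algebra_simps)
qed

lemma synth_zero: "synth w 0 = 0"
  by (simp add: synth_def)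

lemma synth_sum:
  assumes "\<And>i. i \<in> I \<Longrightarrow> f i \<in> finsupp D"
  shows "synth w (\<Sum>i\<in>I. cscale (a i) (f i)) = (\<Sum>i\<in>I. cscale (a i) (synth w (f i)))"
  using assms
proof (induction I rule: infinite_finite_induct)
  case (insert x I)
  have *: "cscale (a x) (f x) \<in> finsupp D" "(\<Sum>i\<in>I. cscale (a i) (f i)) \<in> finsupp D"
    using insert by (blast intro: cfun.subspace_sum cfun.subspace_scale subspace_finsupp)+
  have "synth w (\<Sum>i\<in>insert x I. cscale (a i) (f i)) =
      synth w (cscale (a x) (f x) + (\<Sum>i\<in>I. cscale (a i) (f i)))"
    by (subst sum.insert[OF insert(1,2)]) (rule refl)
  also have "\<dots> = cscale (a x) (synth w (f x)) + (\<Sum>i\<in>I. cscale (a i) (synth w (f i)))"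
  proof -
    have "synth w (\<Sum>i\<in>I. cscale (a i) (f i)) = (\<Sum>i\<in>I. cscale (a i) (synth w (f i)))"
      using insert by blast
    moreover have "f x \<in> finsupp D" using insert by blast
    ultimately show ?thesis by (simp only: synth_add[OF *] synth_scale)
  qed
  also have "\<dots> = (\<Sum>i\<in>insert x I. cscale (a i) (synth w (f i)))"
    by (subst sum.insert[OF insert(1,2)]) (rule refl)
  finally show ?case .
next
  case empty
  show ?case by (simp only: sum.empty synth_zero)
next
  case (infinite I)
  then show ?case by (simp only: sum.infinite simp_thms synth_zero)
qed

definition point_mass :: "'a \<Rightarrow> 'a \<Rightarrow> complex" where
  "point_mass x = (\<lambda>y. if y = x then 1 else 0)"

lemma point_mass_in: "x \<in> D \<Longrightarrow> point_mass x \<in> finsupp D"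
  by (auto simp: point_mass_def finsupp_def)

lemma synth_point_mass: "synth w (point_mass x) = cscale (cnj (w x)) (\<lambda>y. k y x)"
proof -
  have "{y. point_mass x y \<noteq> 0} = {x}" by (auto simp: point_mass_def)
  then show ?thesis by (simp add: synth_def point_mass_def)
qed

text \<open>The relation \<open>f = w g\<close> on \<open>D\<close> is recovered from its dual form by testing on point masses.\<close>

lemma dual_relation_imp_mult:
  assumes "f \<in> elements H" "g \<in> elements H" "x \<in> D"
    and "\<And>c. c \<in> finsupp D \<Longrightarrow> inner_prod H (synth (\<lambda>_. 1) c) f = inner_prod H (synth w c) g"
  shows "f x = w x * g x"
proof -
  have x: "x \<in> points H" using assms(3) D by blast
  have "cnj (f x) = cnj (w x) * cnj (g x)"
    using assms(4)[OF point_mass_in[OF assms(3)]] x assms(1,2) kernel_in[OF x]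
    by (simp add: synth_point_mass ip_scale_left kernel_eval_left)
  then show ?thesis by (metis complex_cnj_cancel_iff complex_cnj_mult)
qed

text \<open>The matrix of this form in the kernel functions is \<open>defect_kernel k w t\<close>. It measures by how much
  \<open>synth w\<close> fails to be dominated by \<open>t\<close> times \<open>synth 1\<close>.\<close>

definition defect :: "('a \<Rightarrow> complex) \<Rightarrow> real \<Rightarrow> ('a \<Rightarrow> complex) \<Rightarrow> ('a \<Rightarrow> complex) \<Rightarrow> complex" where
  "defect w t c d = complex_of_real (t\<^sup>2) * inner_prod H (synth (\<lambda>_. 1) c) (synth (\<lambda>_. 1) d)
     - inner_prod H (synth w c) (synth w d)"

lemma hermitian_form_defect: "hermitian_form (finsupp D) (defect w t)"
proof
  fix c d e a assume cde: "c \<in> finsupp D" "d \<in> finsupp D"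
  show "defect w t (cscale a c) d = a * defect w t c d"
    using cde by (simp add: defect_def synth_scale synth_in ip_scale_left algebra_simps)
  show "defect w t d c = cnj (defect w t c d)"
    using cde inner_commute[OF synth_in synth_in, of c d] by (simp add: defect_def)
  assume "e \<in> finsupp D"
  then show "defect w t (c + d) e = defect w t c e + defect w t d e"
    using cde by (simp add: defect_def synth_add synth_in ip_add_left algebra_simps)
qed (rule subspace_finsupp)

lemma defect_self:
  assumes "c \<in> finsupp D"
  shows "Re (defect w t c c) = t\<^sup>2 * (nrm (synth (\<lambda>_. 1) c))\<^sup>2 - (nrm (synth w c))\<^sup>2"
  using assms by (simp add: defect_def ip_self synth_in)

lemma qform_defect:
  assumes c: "c \<in> finsupp D"
  shows "qform (defect_kernel k w t) c = Re (defect w t c c)"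
proof -
  let ?S = "{x. c x \<noteq> 0}"
  have synth_app: "synth v c x = (\<Sum>y\<in>?S. c y * cnj (v y) * k x y)" for v x
    by (simp add: synth_def sum_fun_apply)
  have form: "inner_prod H (synth v c) (synth v c) =
      (\<Sum>x\<in>?S. \<Sum>y\<in>?S. cnj (c x) * c y * (v x * cnj (v y) * k x y))" for v
    unfolding ip_synth[OF c synth_in[OF c]]
    by (simp add: synth_app sum_distrib_left mult_ac)
  have "defect w t c c =
      (\<Sum>x\<in>?S. \<Sum>y\<in>?S. cnj (c x) * c y * ((complex_of_real (t\<^sup>2) - w x * cnj (w y)) * k x y))"
    unfolding defect_def form
    by (simp add: sum_distrib_left sum_subtractf[symmetric] algebra_simps)
  then show ?thesis by (simp only: qform_def)
qed

lemma defect_family: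
  "neg_definite_family (defect_kernel k w t) D n f \<longleftrightarrow>
    (\<forall>i<n. f i \<in> finsupp D) \<and> (\<forall>a. (\<exists>i<n. a i \<noteq> 0) \<longrightarrow>
      Re (defect w t (lincomb n a f) (lincomb n a f)) < 0)"
proof -
  have "(lincomb n a f) \<in> finsupp D" if "\<forall>i<n. f i \<in> finsupp D" for a
    using that by (intro cfun.subspace_sum cfun.subspace_scale subspace_finsupp) auto
  then show ?thesis unfolding neg_definite_family_def using qform_defect by auto
qed

lemma at_most_neg_squares_defect:
  "at_most_neg_squares D (defect_kernel k w t) m \<longleftrightarrow>
    \<not> (\<exists>f. (\<forall>i<Suc m. f i \<in> finsupp D) \<and> (\<forall>a. (\<exists>i<Suc m. a i \<noteq> 0) \<longrightarrow>
      Re (defect w t (lincomb (Suc m) a f) (lincomb (Suc m) a f)) < 0))"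
proof -
  have "(complex_of_real (t\<^sup>2) - w x * cnj (w y)) * k x y =
      cnj ((complex_of_real (t\<^sup>2) - w y * cnj (w x)) * k y x)" if "x \<in> D" "y \<in> D" for x y
  proof -
    have "k x y = cnj (k y x)" using that D by (intro kernel_hermitian) auto
    then show ?thesis by (simp add: mult.commute)
  qed
  then show ?thesis unfolding at_most_neg_squares_iff defect_family by blast
qed

text \<open>If \<open>w\<close> multiplies a subspace \<open>E\<close> of codimension \<open>n\<close> into \<open>H\<close> with norm at most \<open>t\<close>, a kernel
  combination \<open>c\<close> whose image \<open>g = synth w c\<close> lies in \<open>E\<close> has nonnegative defect:
  \<open>\<parallel>g\<parallel>\<^sup>2 = \<langle>w g, synth 1 c\<rangle> \<le> t \<parallel>g\<parallel> \<parallel>synth 1 c\<parallel>\<close>. Among \<open>n + 1\<close> coefficient functions some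
  nontrivial combination \<open>c\<close> is of this kind, so the form is not negative definite on them.\<close>

lemma codim_imp_neg_squares:
  assumes E: "cfun.subspace E" and codim: "has_codim H E n" and EH: "E \<subseteq> elements H" and t: "0 \<le> t"
    and mult: "\<And>h. h \<in> E \<Longrightarrow> \<exists>g\<in>elements H. nrm g \<le> t * nrm h \<and> (\<forall>x\<in>D. g x = w x * h x)"
  shows "at_most_neg_squares D (defect_kernel k w t) n"
  unfolding at_most_neg_squares_defect
proof
  assume "\<exists>f. (\<forall>i<Suc n. f i \<in> finsupp D) \<and> (\<forall>a. (\<exists>i<Suc n. a i \<noteq> 0) \<longrightarrow>
      Re (defect w t (lincomb (Suc n) a f) (lincomb (Suc n) a f)) < 0)"
  then obtain f where f: "\<And>i. i < Suc n \<Longrightarrow> f i \<in> finsupp D"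
    and neg: "\<And>a. \<exists>i<Suc n. a i \<noteq> 0 \<Longrightarrow>
      Re (defect w t (lincomb (Suc n) a f) (lincomb (Suc n) a f)) < 0" by blast
  obtain B where B: "finite B" "card B = n" and H_eq: "elements H = {e + f | e f. e \<in> E \<and> f \<in> cfun.span B}"
    using codim unfolding has_codim_def has_fin_dim_def by blast
  have "\<exists>e\<in>E. \<exists>v\<in>cfun.span B. synth w (f i) = e + v" if "i < Suc n" for i
  proof -
    have "synth w (f i) \<in> {e + f | e f. e \<in> E \<and> f \<in> cfun.span B}"
      using synth_in[OF f[OF that]] H_eq by blast
    then show ?thesis by blast
  qed
  then obtain a where a: "\<exists>i<Suc n. a i \<noteq> 0" "(\<Sum>i<Suc n. cscale (a i) (synth w (f i))) \<in> E"
    using combination_in_subspace[OF E B(1), of "Suc n" "\<lambda>i. synth w (f i)"] B(2) lessI by metis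
  define c where "c = (lincomb (Suc n) a f)"
  have c: "c \<in> finsupp D"
    unfolding c_def using f by (intro cfun.subspace_sum cfun.subspace_scale subspace_finsupp) auto
  define g where "g = synth w c"
  have "g = (\<Sum>i<Suc n. cscale (a i) (synth w (f i)))"
    unfolding g_def c_def using f by (intro synth_sum) auto
  then have gE: "g \<in> E" using a(2) by (simp only:)
  then have gH: "g \<in> elements H" using EH by blast
  obtain g' where g': "g' \<in> elements H" "nrm g' \<le> t * nrm g" "\<forall>x\<in>D. g' x = w x * g x"
    using mult[OF gE] by blast
  have "inner_prod H g g = (\<Sum>x | c x \<noteq> 0. cnj (c x) * w x * g x)"
    using ip_synth[OF c gH, of w] by (simp only: g_def)
  also have "\<dots> = (\<Sum>x | c x \<noteq> 0. cnj (c x) * 1 * g' x)"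
    using c g'(3) by (intro sum.cong) (auto simp: finsupp_def)
  also have "\<dots> = inner_prod H g' (synth (\<lambda>_. 1) c)"
    using ip_synth[OF c g'(1), of "\<lambda>_. 1"] by simp
  finally have "cmod (inner_prod H g g) \<le> nrm g' * nrm (synth (\<lambda>_. 1) c)"
    using cauchy_schwarz[OF g'(1) synth_in[OF c]] by simp
  also have "\<dots> \<le> t * nrm g * nrm (synth (\<lambda>_. 1) c)"
    using g'(2) synth_in[OF c] by (intro mult_right_mono) auto
  finally have "nrm g * nrm g \<le> nrm g * (t * nrm (synth (\<lambda>_. 1) c))"
    using gH by (simp add: ip_self norm_power power2_eq_square norm_mult mult_ac)
  then have "nrm g \<le> t * nrm (synth (\<lambda>_. 1) c)"
    using nrm_nonneg[OF gH] t synth_in[OF c, of "\<lambda>_. 1"]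
    by (cases "nrm g = 0") (auto simp: mult_le_cancel_left)
  then have "(nrm g)\<^sup>2 \<le> t\<^sup>2 * (nrm (synth (\<lambda>_. 1) c))\<^sup>2"
    using gH by (metis nrm_nonneg power_mono power_mult_distrib)
  then have "0 \<le> Re (defect w t c c)" by (simp add: defect_self[OF c] g_def)
  then show False using neg[OF a(1)] unfolding c_def by (rule leD[THEN notE])
qed

text \<open>Conversely, let the defect form have at most \<open>m\<close> negative squares, and let \<open>b\<close> be a maximal
  neg-orthonormal family. On its orthogonal complement \<open>V1\<close> one has
  \<open>\<parallel>synth w c\<parallel> \<le> t \<parallel>synth 1 c\<parallel>\<close>, so every \<open>y\<close> has a vector \<open>S y\<close> with
  \<open>\<langle>synth 1 c, S y\<rangle> = \<langle>synth w c, y\<rangle>\<close> for \<open>c \<in> V1\<close> and \<open>\<parallel>S y\<parallel> \<le> t \<parallel>y\<parallel>\<close>, and \<open>S\<close> is linear. The same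
  equation for the members of \<open>b\<close> is at most \<open>m\<close> linear conditions on \<open>y\<close>; where they hold,
  \<open>S y = w y\<close> on \<open>D\<close>.\<close>

lemma neg_squares_imp_codim:
  assumes t: "0 \<le> t"
    and neg: "at_most_neg_squares D (defect_kernel k w t) m"
    and large: "\<And>n. n < m \<Longrightarrow> \<not> has_fin_dim (elements H) n"
  obtains E where "closed_subspace H E" "has_codim H E m"
    "\<And>h. h \<in> E \<Longrightarrow> \<exists>g\<in>elements H. nrm g \<le> t * nrm h \<and> (\<forall>x\<in>D. g x = w x * h x)"
proof -
  interpret F: hermitian_form "finsupp D" "defect w t" by (rule hermitian_form_defect)
  let ?K = "synth (\<lambda>_. 1)" and ?T = "synth w"
  obtain b r where b: "F.neg_orthonormal b r" "r \<le> m"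
    and nonneg: "\<forall>c\<in>finsupp D. (\<forall>i<r. defect w t c (b i) = 0) \<longrightarrow> 0 \<le> Re (defect w t c c)"
    using F.maximal_neg_orthonormal[OF neg[unfolded at_most_neg_squares_defect]] by blast
  have bD: "b i \<in> finsupp D" if "i < r" for i using b(1) that by (simp add: F.neg_orthonormal_def)
  define V1 where "V1 = {c \<in> finsupp D. \<forall>i<r. defect w t c (b i) = 0}"
  have V1: "cfun.subspace V1"
  proof (rule cfun.subspaceI)
    have z: "0 \<in> finsupp D" using subspace_finsupp by (rule cfun.subspace_0)
    have "defect w t (cscale 0 0) (b i) = 0" if "i < r" for i
      using F.B_scale[OF z bD[OF that], of 0] by (simp only: mult_zero_left)
    then show "0 \<in> V1" using z by (simp only: V1_def mem_Collect_eq cfun.scale_zero_left) blast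
    fix c d a assume c: "c \<in> V1"
    then show "cscale a c \<in> V1"
      using bD subspace_finsupp[of D] by (auto simp: V1_def F.B_scale cfun.subspace_scale)
    assume "d \<in> V1"
    then show "c + d \<in> V1"
      using c bD subspace_finsupp[of D] by (auto simp: V1_def F.B_add cfun.subspace_add)
  qed
  have V1D: "c \<in> finsupp D" if "c \<in> V1" for c using that by (simp add: V1_def)
  have contr: "nrm (?T c) \<le> t * nrm (?K c)" if "c \<in> V1" for c
  proof (rule power2_le_imp_le)
    have "0 \<le> Re (defect w t c c)" using that nonneg by (simp add: V1_def)
    then show "(nrm (?T c))\<^sup>2 \<le> (t * nrm (?K c))\<^sup>2"
      using V1D[OF that] by (simp add: defect_self power_mult_distrib)
    show "0 \<le> t * nrm (?K c)" using t synth_in[OF V1D[OF that]] by simp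
  qed
  \<comment> \<open>requiring \<open>g\<close> to lie in the closure of the range makes it unique, and hence linear in \<open>y\<close>\<close>
  define P where "P y g \<longleftrightarrow> g \<in> lim_closure (?K ` V1) \<and>
      (\<forall>c\<in>V1. inner_prod H (?K c) g = inner_prod H (?T c) y)" for y g
  have KV1: "?K ` V1 \<subseteq> elements H" using V1D synth_in by blast
  have KV1_sub: "cfun.subspace (?K ` V1)"
  proof (rule cfun.subspaceI)
    have "?K 0 \<in> ?K ` V1" using cfun.subspace_0[OF V1] by (rule imageI)
    then show "0 \<in> ?K ` V1" by (simp only: synth_zero)
    fix f g a assume "f \<in> ?K ` V1"
    then obtain c where c: "c \<in> V1" "f = ?K c" by blast
    have "?K (cscale a c) \<in> ?K ` V1" using cfun.subspace_scale[OF V1 c(1)] by (rule imageI)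
    then show "cscale a f \<in> ?K ` V1" using synth_scale[OF V1D[OF c(1)]] c(2) by (simp only:)
    assume "g \<in> ?K ` V1"
    then obtain d where d: "d \<in> V1" "g = ?K d" by blast
    have "?K (c + d) \<in> ?K ` V1" using cfun.subspace_add[OF V1 c(1) d(1)] by (rule imageI)
    then show "f + g \<in> ?K ` V1" using synth_add[OF V1D[OF c(1)] V1D[OF d(1)]] c(2) d(2) by (simp only:)
  qed
  have PH: "g \<in> elements H" if "P y g" for y g using that lim_closure_in by (auto simp: P_def)
  have P_add: "P (y + z) (g + h)" if "P y g" "P z h" "y \<in> elements H" "z \<in> elements H" for y z g h
    using that lim_closure_add[OF KV1 KV1_sub, of g h] PH[OF that(1)] PH[OF that(2)] V1D synth_in
    by (auto simp: P_def ip_add_right)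
  have P_scale: "P (cscale a y) (cscale a g)" if "P y g" "y \<in> elements H" for y g a
    using that lim_closure_scale[OF KV1 KV1_sub, of g a] PH[OF that(1)] V1D synth_in
    by (auto simp: P_def ip_scale_right)
  have P_unique: "g = g'" if "P y g" "P y g'" "y \<in> elements H" for y g g'
  proof -
    have "P (y + cscale (- 1) y) (g + cscale (- 1) g')"
      using that by (intro P_add P_scale) auto
    moreover have "y + cscale (- 1) y = 0" "g + cscale (- 1) g' = g - g'" by (auto simp: fun_eq_iff)
    ultimately have "P 0 (g - g')" by (simp only:)
    then have "g - g' = 0"
      using V1D synth_in by (intro lim_closure_orthogonal[OF KV1]) (auto simp: P_def simp del: zero_fun_apply)
    then show ?thesis by (simp only: right_minus_eq)
  qed
  have "\<exists>g. P y g \<and> nrm g \<le> t * nrm y" if y: "y \<in> elements H" for y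
  proof -
    have "\<exists>g\<in>lim_closure (?K ` V1). (\<forall>c\<in>V1. inner_prod H (?K c) g = inner_prod H (?T c) y) \<and> nrm g \<le> t * nrm y"
    proof (rule riesz[OF V1])
      fix c assume c: "c \<in> V1"
      have "cmod (inner_prod H (?T c) y) \<le> nrm (?T c) * nrm y"
        using synth_in[OF V1D[OF c]] y by (rule cauchy_schwarz)
      also have "\<dots> \<le> t * nrm (?K c) * nrm y" using contr[OF c] y by (intro mult_right_mono) auto
      finally show "cmod (inner_prod H (?T c) y) \<le> t * nrm y * nrm (?K c)" by (simp add: mult_ac)
    qed (use V1D y t in \<open>simp_all add: synth_in synth_add synth_scale ip_add_left ip_scale_left\<close>)
    then show ?thesis by (auto simp: P_def)
  qed
  then obtain S where S: "\<And>y. y \<in> elements H \<Longrightarrow> P y (S y)" "\<And>y. y \<in> elements H \<Longrightarrow> nrm (S y) \<le> t * nrm y"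
    by metis
  have SH: "S y \<in> elements H" if "y \<in> elements H" for y using S(1)[OF that] by (rule PH)
  have S_add: "S (y + z) = S y + S z" if "y \<in> elements H" "z \<in> elements H" for y z
    using P_unique[OF S(1) P_add[OF S(1) S(1)]] that by blast
  have S_scale: "S (cscale a y) = cscale a (S y)" if "y \<in> elements H" for a y
    using P_unique[OF S(1) P_scale[OF S(1)]] that by blast
  \<comment> \<open>\<open>l i y = 0\<close> is the condition that the relation between \<open>S y\<close> and \<open>y\<close> also holds for \<open>b i\<close>\<close>
  define l where "l i y = inner_prod H y (?T (b i)) - inner_prod H (S y) (?K (b i))" for i y
  have "\<exists>e\<in>elements H. \<forall>y\<in>elements H. inner_prod H y e = l i y" if i: "i < r" for i
  proof -
    have bi: "?T (b i) \<in> elements H" "?K (b i) \<in> elements H" using bD[OF i] synth_in by blast+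
    have "\<exists>e\<in>lim_closure ((\<lambda>y. y) ` elements H). (\<forall>y\<in>elements H. inner_prod H y e = l i y) \<and>
        nrm e \<le> nrm (?T (b i)) + t * nrm (?K (b i))"
    proof (rule riesz[OF subspace_elements])
      fix y assume y: "y \<in> elements H"
      have "cmod (l i y) \<le> cmod (inner_prod H y (?T (b i))) + cmod (inner_prod H (S y) (?K (b i)))"
        unfolding l_def by (rule norm_triangle_ineq4)
      also have "\<dots> \<le> nrm y * nrm (?T (b i)) + nrm (S y) * nrm (?K (b i))"
        using y SH bi by (intro add_mono cauchy_schwarz) auto
      also have "nrm (S y) * nrm (?K (b i)) \<le> t * nrm y * nrm (?K (b i))"
        using S(2)[OF y] bi by (intro mult_right_mono) auto
      finally show "cmod (l i y) \<le> (nrm (?T (b i)) + t * nrm (?K (b i))) * nrm y"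
        by (simp add: algebra_simps)
    qed (use bi SH t in \<open>simp_all add: l_def S_add S_scale ip_add_left ip_scale_left algebra_simps\<close>)
    then show ?thesis using lim_closure_in by blast
  qed
  then obtain e where e: "\<And>i. i < r \<Longrightarrow> e i \<in> elements H"
    "\<And>i y. i < r \<Longrightarrow> y \<in> elements H \<Longrightarrow> inner_prod H y (e i) = l i y" by metis
  obtain u s where u: "orthonormal u s" "s \<le> r" "e ` {..<r} \<subseteq> cfun.span (u ` {..<s})"
    using orthonormal_cover[of r e] e(1) by blast
  obtain v where v: "orthonormal v m" "\<And>i. i < s \<Longrightarrow> v i = u i"
    using orthonormal_lengthen[OF u(1) _ large] u(2) b(2) by (metis order_trans)
  define E where "E = {f \<in> elements H. \<forall>i<m. inner_prod H f (v i) = 0}"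
  have "\<exists>g\<in>elements H. nrm g \<le> t * nrm y \<and> (\<forall>x\<in>D. g x = w x * y x)" if yE: "y \<in> E" for y
  proof -
    have y: "y \<in> elements H" using yE by (simp add: E_def)
    have l0: "l i y = 0" if i: "i < r" for i
    proof -
      have "cfun.span (u ` {..<s}) \<subseteq> {f \<in> elements H. inner_prod H y f = 0}"
      proof (rule cfun.span_minimal)
        show "u ` {..<s} \<subseteq> {f \<in> elements H. inner_prod H y f = 0}"
        proof
          fix f assume "f \<in> u ` {..<s}"
          then obtain j where "j < s" "f = v j" using v(2) by auto
          then show "f \<in> {f \<in> elements H. inner_prod H y f = 0}"
            using yE v(1) u(2) b(2) by (auto simp: E_def orthonormal_def)
        qed
        show "cfun.subspace {f \<in> elements H. inner_prod H y f = 0}"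
        proof (rule cfun.subspaceI)
          show "0 \<in> {f \<in> elements H. inner_prod H y f = 0}" using y V_zero ip_zero_right by blast
        qed (use y in \<open>simp_all add: ip_add_right ip_scale_right\<close>)
      qed
      then have "inner_prod H y (e i) = 0" using u(3) i by blast
      then show ?thesis using e(2)[OF i y] by simp
    qed
    have "inner_prod H (?K c) (S y) = inner_prod H (?T c) y" if c: "c \<in> finsupp D" for c
    proof -
      \<comment> \<open>\<open>- d\<close> is the component of \<open>c\<close> in the span of \<open>b\<close>: signs are reversed by negative definiteness\<close>
      define d where "d = (\<Sum>i<r. cscale (defect w t c (b i)) (b i))"
      have d: "d \<in> finsupp D" unfolding d_def
        using bD by (intro cfun.subspace_sum cfun.subspace_scale subspace_finsupp) auto
      have "c + d \<in> V1"
      proof -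
        have "defect w t (c + d) (b i) = 0" if "i < r" for i
          using F.B_add[OF c d bD[OF that]] F.B_neg_orthonormal_sum[OF b(1) that] by (simp add: d_def)
        then show ?thesis using cfun.subspace_add[OF subspace_finsupp c d] by (simp add: V1_def)
      qed
      then have 1: "inner_prod H (?K (c + d)) (S y) = inner_prod H (?T (c + d)) y"
        using S(1)[OF y] by (simp add: P_def)
      have bi: "inner_prod H (?K (b i)) (S y) = inner_prod H (?T (b i)) y" if i: "i < r" for i
        using l0[OF i] inner_commute[OF SH[OF y] synth_in[OF bD[OF i]]]
          inner_commute[OF y synth_in[OF bD[OF i]]] by (simp add: l_def)
      have sumip: "inner_prod H (synth w' d) f =
          (\<Sum>i<r. defect w t c (b i) * inner_prod H (synth w' (b i)) f)" if f: "f \<in> elements H" for w' f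
      proof -
        have "inner_prod H (synth w' d) f =
            inner_prod H (\<Sum>i<r. cscale (defect w t c (b i)) (synth w' (b i))) f"
          unfolding d_def using bD by (subst synth_sum) auto
        also have "\<dots> = (\<Sum>i<r. inner_prod H (cscale (defect w t c (b i)) (synth w' (b i))) f)"
          using bD synth_in f by (intro ip_sum_left) auto
        also have "\<dots> = (\<Sum>i<r. defect w t c (b i) * inner_prod H (synth w' (b i)) f)"
          using bD synth_in f by (intro sum.cong) (auto simp: ip_scale_left)
        finally show ?thesis .
      qed
      have "inner_prod H (?K d) (S y) = inner_prod H (?T d) y"
        unfolding sumip[OF SH[OF y]] sumip[OF y] using bi by (intro sum.cong) auto
      then show ?thesis
        using 1 synth_add[OF c d] synth_in[OF c] synth_in[OF d] y SH[OF y] by (simp add: ip_add_left)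
    qed
    then have "\<forall>x\<in>D. S y x = w x * y x" using dual_relation_imp_mult[OF SH[OF y] y] by blast
    then show ?thesis using S(2)[OF y] SH[OF y] by blast
  qed
  then show thesis using that orthogonal_complement[OF v(1)] unfolding E_def by blast
qed

text \<open>Automatic boundedness by uniform boundedness: for \<open>\<parallel>synth 1 c\<parallel> \<le> 1\<close> the functionals
  \<open>h \<mapsto> \<langle>M h, synth 1 c\<rangle>\<close> are pointwise bounded, and each is represented by a vector of \<open>E\<close>, because it
  involves only finitely many point evaluations of \<open>h\<close>. They determine the norm of \<open>M h\<close> since the
  kernel functions of a set of uniqueness span a dense subspace.\<close>

lemma multiplication_bounded:
  assumes E: "closed_subspace H E"
    and uniq: "set_of_uniqueness D (elements H)"
    and mult: "\<And>h. h \<in> E \<Longrightarrow> M h \<in> elements H \<and> (\<forall>x\<in>D. M h x = w x * h x)"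
  shows "\<exists>C. \<forall>h\<in>E. nrm (M h) \<le> C * nrm h"
proof -
  let ?K = "synth (\<lambda>_. 1)" and ?T = "synth w"
  have E': "cfun.subspace E" "E \<subseteq> elements H" "lim_closure E \<subseteq> E"
    using E by (auto simp: closed_subspace_iff)
  have ip_M: "inner_prod H h (?T c) = inner_prod H (M h) (?K c)" if "h \<in> E" "c \<in> finsupp D" for h c
  proof -
    have "inner_prod H h (?T c) = (\<Sum>x | c x \<noteq> 0. cnj (c x) * w x * h x)"
      using that E' by (intro ip_synth) auto
    also have "\<dots> = (\<Sum>x | c x \<noteq> 0. cnj (c x) * 1 * M h x)"
      using mult[OF that(1)] that(2) by (intro sum.cong) (auto simp: finsupp_def)
    also have "\<dots> = inner_prod H (M h) (?K c)"
      using mult[OF that(1)] that(2) by (intro ip_synth[symmetric]) auto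
    finally show ?thesis .
  qed
  define R where "R = {r \<in> E. \<exists>c\<in>finsupp D. nrm (?K c) \<le> 1 \<and>
      (\<forall>h\<in>E. inner_prod H h r = inner_prod H h (?T c))}"
  have "\<exists>C. \<forall>r\<in>R. cmod (inner_prod H h r) \<le> C" if h: "h \<in> E" for h
  proof (intro exI ballI)
    fix r assume "r \<in> R"
    then obtain c where c: "c \<in> finsupp D" "nrm (?K c) \<le> 1" "inner_prod H h r = inner_prod H h (?T c)"
      using h by (auto simp: R_def)
    have "cmod (inner_prod H h r) \<le> nrm (M h) * nrm (?K c)"
      using c(3) ip_M[OF h c(1)] cauchy_schwarz[of "M h" "?K c"] mult[OF h] synth_in[OF c(1)] by simp
    also have "\<dots> \<le> nrm (M h) * 1" using c(2) mult[OF h] by (intro mult_left_mono) auto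
    finally show "cmod (inner_prod H h r) \<le> nrm (M h)" by simp
  qed
  then obtain B where B: "\<And>r. r \<in> R \<Longrightarrow> nrm r \<le> B"
    using uniform_boundedness[OF E'(2,1,3), of R] unfolding R_def by blast
  define C where "C = max B 0"
  have unit: "cmod (inner_prod H (?K c) (M h)) \<le> C * nrm h"
    if h: "h \<in> E" and c: "c \<in> finsupp D" "nrm (?K c) \<le> 1" for h c
  proof -
    have "\<exists>r\<in>lim_closure ((\<lambda>h. h) ` E). (\<forall>h\<in>E. inner_prod H h r = inner_prod H h (?T c)) \<and> nrm r \<le> nrm (?T c)"
    proof (rule riesz[OF E'(1)])
      show "cmod (inner_prod H g (?T c)) \<le> nrm (?T c) * nrm g" if "g \<in> E" for g
        using cauchy_schwarz[of g "?T c"] that E'(2) synth_in[OF c(1)] by (auto simp: mult.commute)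
      show "inner_prod H (f + g) (?T c) = inner_prod H f (?T c) + inner_prod H g (?T c)"
        if "f \<in> E" "g \<in> E" for f g using that E'(2) synth_in[OF c(1)] by (intro ip_add_left) auto
      show "inner_prod H (cscale a g) (?T c) = a * inner_prod H g (?T c)"
        if "g \<in> E" for a g using that E'(2) synth_in[OF c(1)] by (intro ip_scale_left) auto
    qed (use E'(2) synth_in[OF c(1)] in auto)
    then obtain r where r: "r \<in> E" "\<forall>h\<in>E. inner_prod H h r = inner_prod H h (?T c)"
      using E'(3) by auto
    then have "r \<in> R" using c by (auto simp: R_def)
    have hH: "h \<in> elements H" "r \<in> elements H" using h r(1) E'(2) by auto
    have "cmod (inner_prod H (?K c) (M h)) = cmod (inner_prod H (M h) (?K c))"
      using inner_commute[of "M h" "?K c"] mult[OF h] synth_in[OF c(1)] by simp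
    also have "\<dots> = cmod (inner_prod H h r)" using r(2) h ip_M[OF h c(1)] by simp
    also have "\<dots> \<le> nrm h * nrm r" using hH by (rule cauchy_schwarz)
    also have "\<dots> \<le> nrm h * C"
      using B[OF \<open>r \<in> R\<close>] hH by (intro mult_left_mono) (auto simp: C_def)
    finally show ?thesis by (simp add: mult.commute)
  qed
  have "nrm (M h) \<le> C * nrm h" if h: "h \<in> E" for h
  proof -
    have Mh: "M h \<in> elements H" using mult[OF h] by blast
    have hH: "h \<in> elements H" using h E'(2) by blast
    have "\<exists>g\<in>lim_closure (?K ` finsupp D).
        (\<forall>c\<in>finsupp D. inner_prod H (?K c) g = inner_prod H (?K c) (M h)) \<and> nrm g \<le> C * nrm h"
    proof (rule riesz[OF subspace_finsupp])
      fix c assume c: "c \<in> finsupp D"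
      have Kc: "?K c \<in> elements H" using c by (rule synth_in)
      show "cmod (inner_prod H (?K c) (M h)) \<le> C * nrm h * nrm (?K c)"
      proof (cases "nrm (?K c) = 0")
        case True
        then show ?thesis using cauchy_schwarz[OF Kc Mh] by simp
      next
        case False
        then have pos: "nrm (?K c) > 0" using nrm_nonneg[OF Kc] by linarith
        define a where "a = complex_of_real (1 / nrm (?K c))"
        have Ka: "?K (cscale a c) = cscale a (?K c)" using c by (rule synth_scale)
        have "cmod (inner_prod H (?K (cscale a c)) (M h)) \<le> C * nrm h"
        proof (rule unit[OF h])
          show "cscale a c \<in> finsupp D" using subspace_finsupp c by (rule cfun.subspace_scale)
          show "nrm (?K (cscale a c)) \<le> 1"
            unfolding Ka using Kc pos by (simp add: nrm_scale a_def norm_divide)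
        qed
        then have "cmod (inner_prod H (?K c) (M h)) / nrm (?K c) \<le> C * nrm h"
          unfolding Ka using Kc Mh pos by (simp add: ip_scale_left a_def norm_mult norm_divide)
        then show ?thesis using pos by (simp add: pos_divide_le_eq)
      qed
    qed (use Mh hH in \<open>simp_all add: synth_in synth_add synth_scale ip_add_left ip_scale_left C_def\<close>)
    then obtain g where g: "g \<in> elements H" "nrm g \<le> C * nrm h"
      "\<And>c. c \<in> finsupp D \<Longrightarrow> inner_prod H (?K c) g = inner_prod H (?K c) (M h)"
      using lim_closure_in by blast
    have "g x = 1 * M h x" if "x \<in> D" for x
      using dual_relation_imp_mult[OF g(1) Mh that, of "\<lambda>_. 1"] g(3) by blast
    then have "g = M h" using uniq g(1) Mh unfolding set_of_uniqueness_def by simp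
    then show ?thesis using g(2) by (simp only:)
  qed
  then show ?thesis by blast
qed

end

end

section \<open>The set of admissible bounds\<close>

context kernel_space
begin

text \<open>This makes the infimum of all bounds a bound. If the form at level \<open>s\<close> is negative definite on a space of
  dimension \<open>m + 1\<close>, an orthonormal basis of that space with respect to the negated form shows that it
  stays negative definite at all levels \<open>t\<close> with \<open>t\<^sup>2\<close> close to \<open>s\<^sup>2\<close>.\<close>

lemma at_most_neg_squares_limit:
  assumes D: "D \<subseteq> points H"
    and lim: "\<And>\<epsilon>. \<epsilon> > 0 \<Longrightarrow> \<exists>t. t\<^sup>2 < s\<^sup>2 + \<epsilon> \<and>
      at_most_neg_squares D (defect_kernel k w t) m"
  shows "at_most_neg_squares D (defect_kernel k w s) m"
  unfolding at_most_neg_squares_defect[OF D]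
proof
  interpret F: hermitian_form "finsupp D" "defect w s" by (rule hermitian_form_defect[OF D])
  let ?K = "synth (\<lambda>_. 1)"
  define n where "n = Suc m"
  \<comment> \<open>\<open>U\<close> below is the span of a family on which the form at level \<open>s\<close> is negative definite\<close>
  assume "\<exists>f. (\<forall>i<Suc m. f i \<in> finsupp D) \<and> (\<forall>a. (\<exists>i<Suc m. a i \<noteq> 0) \<longrightarrow>
      Re (defect w s (lincomb (Suc m) a f) (lincomb (Suc m) a f)) < 0)"
  then obtain f where f: "\<And>i. i < n \<Longrightarrow> f i \<in> finsupp D"
    and neg: "\<And>a. \<exists>i<n. a i \<noteq> 0 \<Longrightarrow>
      Re (defect w s (lincomb n a f) (lincomb n a f)) < 0"
    unfolding n_def by blast
  define comb where "comb a = (lincomb n a f)" for a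
  have comb_D: "comb a \<in> finsupp D" for a
    unfolding comb_def using f by (intro cfun.subspace_sum cfun.subspace_scale subspace_finsupp) auto
  have comb_neg: "comb a = 0 \<or> Re (defect w s (comb a) (comb a)) < 0" for a
  proof (cases "\<exists>i<n. a i \<noteq> 0")
    case True
    then show ?thesis using neg unfolding comb_def by blast
  next
    case False
    then have "comb a = (\<Sum>i<n. cscale 0 (f i))" unfolding comb_def by (intro sum.cong) auto
    then show ?thesis by (simp only: cfun.scale_zero_left sum.neutral_const) blast
  qed
  define U where "U = range comb"
  have U_D: "u \<in> finsupp D" if "u \<in> U" for u using that comb_D by (auto simp: U_def)
  have U_neg: "u = 0 \<or> Re (defect w s u u) < 0" if "u \<in> U" for u using that comb_neg by (auto simp: U_def)
  have U: "cfun.subspace U"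
  proof (rule cfun.subspaceI)
    have "comb (\<lambda>_. 0) = 0" unfolding comb_def by (simp only: cfun.scale_zero_left sum.neutral_const)
    then show "0 \<in> U" unfolding U_def by (metis rangeI)
    fix u v c assume "u \<in> U" "v \<in> U"
    then obtain a b where ab: "u = comb a" "v = comb b" by (auto simp: U_def)
    have "u + v = comb (\<lambda>i. a i + b i)"
      unfolding ab comb_def by (simp only: cfun.scale_left_distrib sum.distrib)
    then show "u + v \<in> U" by (simp only: U_def rangeI)
  next
    fix c u assume "u \<in> U"
    then obtain a where a: "u = comb a" by (auto simp: U_def)
    have "cscale c u = comb (\<lambda>i. c * a i)"
      unfolding a comb_def by (simp only: cfun.scale_sum_right cfun.scale_scale)
    then show "cscale c u \<in> U" by (simp only: U_def rangeI)
  qed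
  have defect_zero: "defect w s 0 v = 0" if "v \<in> finsupp D" for v
    using F.B_scale[OF that that, of 0] by (simp only: cfun.scale_zero_left mult_zero_left)
  interpret U: inner_product_functions U "\<lambda>c d. - defect w s c d"
  proof
    show "cfun.subspace U" by (rule U)
    fix u assume u: "u \<in> U"
    have "Re (defect w s u u) \<le> 0"
    proof (cases "u = 0")
      case True
      have "defect w s 0 u = 0" using U_D[OF u] by (rule defect_zero)
      then show ?thesis using True by (simp only: zero_complex.sel order_refl)
    next
      case False
      then show ?thesis using U_neg[OF u] by simp
    qed
    then show "0 \<le> Re (- defect w s u u)" by simp
    assume "- defect w s u u = 0"
    then have "\<not> Re (defect w s u u) < 0" by simp
    then show "u = 0" using U_neg[OF u] by blast
  next
    fix u v c assume uv: "u \<in> U" "v \<in> U"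
    show "- defect w s (cscale c u) v = c * - defect w s u v"
      using F.B_scale[OF U_D[OF uv(1)] U_D[OF uv(2)]] by simp
    show "- defect w s v u = cnj (- defect w s u v)"
      using F.B_commute[OF U_D[OF uv(1)] U_D[OF uv(2)]] by simp
    fix z assume "z \<in> U"
    then show "- defect w s (u + v) z = - defect w s u z + - defect w s v z"
      using F.B_add[OF U_D[OF uv(1)] U_D[OF uv(2)] U_D] by simp
  qed
  have "\<not> has_fin_dim U r" if r: "r < n" for r
  proof
    assume "has_fin_dim U r"
    then obtain B where B: "finite B" "card B = r" "cfun.span B = U" unfolding has_fin_dim_def by blast
    have "\<exists>e\<in>{0}. \<exists>v\<in>cfun.span B. f i = e + v" if i: "i < n" for i
    proof -
      have "comb (\<lambda>j. if j = i then 1 else 0) = (\<Sum>j<n. if j = i then f j else 0)"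
        unfolding comb_def by (intro sum.cong) (auto simp: fun_eq_iff)
      also have "\<dots> = f i" using i by (subst sum.delta) auto
      finally have "f i \<in> cfun.span B" unfolding B(3) U_def by (metis rangeI)
      then show ?thesis by (intro bexI[of _ 0] bexI[of _ "f i"]) simp_all
    qed
    then obtain a where "\<exists>i<n. a i \<noteq> 0" "(lincomb n a f) \<in> {0}"
      using combination_in_subspace[of "{0}" B n f] B(1,2) r cfun.subspace_single_0 by blast
    then have "Re (defect w s 0 0) < 0" using neg[of a] by (simp only: singleton_iff) 
    then show False using defect_zero[OF cfun.subspace_0[OF subspace_finsupp]] by (simp only: zero_complex.sel)
  qed
  then obtain b where b: "U.orthonormal b n"
    using U.orthonormal_lengthen[of "\<lambda>_. 0" 0 n] by (auto simp: U.orthonormal_def)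
  have bD: "b i \<in> finsupp D" if "i < n" for i using b that U_D by (simp add: U.orthonormal_def)
  have bneg: "F.neg_orthonormal b n"
    unfolding F.neg_orthonormal_def
  proof (intro conjI allI impI)
    fix i j assume ij: "i < n" "j < n"
    have "- defect w s (b i) (b j) = (if i = j then 1 else 0)"
      using b ij by (simp add: U.orthonormal_def)
    then show "defect w s (b i) (b j) = (if i = j then - 1 else 0)"
      by (metis add.inverse_inverse add.inverse_neutral)
  qed (rule bD)
  define \<kappa> where "\<kappa> = (\<Sum>i<n. (nrm (?K (b i)))\<^sup>2)"
  have \<kappa>: "\<kappa> \<ge> 0" unfolding \<kappa>_def by (intro sum_nonneg) auto
  obtain t where t: "t\<^sup>2 < s\<^sup>2 + 1 / (\<kappa> + 1)"
    and at_most: "at_most_neg_squares D (defect_kernel k w t) m"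
    using lim[of "1 / (\<kappa> + 1)"] \<kappa> by auto
  have "Re (defect w t (lincomb n a b) (lincomb n a b)) < 0"
    if a: "\<exists>i<n. a i \<noteq> 0" for a
  proof -
    define c where "c = (lincomb n a b)"
    define A where "A = (\<Sum>i<n. (cmod (a i))\<^sup>2)"
    have c: "c \<in> finsupp D"
      unfolding c_def using bD by (intro cfun.subspace_sum cfun.subspace_scale subspace_finsupp) auto
    obtain i where "i < n" "a i \<noteq> 0" using a by blast
    then have A: "A > 0" unfolding A_def by (intro sum_pos2[of _ i]) auto
    have "nrm (?K c) = nrm (\<Sum>i<n. cscale (a i) (?K (b i)))"
      unfolding c_def using bD by (subst synth_sum[OF D]) auto
    also have "\<dots> \<le> (\<Sum>i<n. nrm (cscale (a i) (?K (b i))))"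
      using bD synth_in[OF D] by (intro nrm_sum) auto
    also have "\<dots> = (\<Sum>i<n. cmod (a i) * nrm (?K (b i)))"
      using bD synth_in[OF D] by (intro sum.cong) (auto simp: nrm_scale)
    finally have "(nrm (?K c))\<^sup>2 \<le> (\<Sum>i<n. cmod (a i) * nrm (?K (b i)))\<^sup>2"
      using synth_in[OF D c] by (intro power_mono) auto
    also have "\<dots> \<le> A * \<kappa>" unfolding A_def \<kappa>_def by (rule Cauchy_Schwarz_ineq_sum)
    finally have Kc: "(nrm (?K c))\<^sup>2 \<le> A * \<kappa>" .
    have "(t\<^sup>2 - s\<^sup>2) * (nrm (?K c))\<^sup>2 \<le> 1 / (\<kappa> + 1) * (nrm (?K c))\<^sup>2"
      using t by (intro mult_right_mono) auto
    also have "\<dots> \<le> 1 / (\<kappa> + 1) * (A * \<kappa>)"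
      using Kc \<kappa> by (intro mult_left_mono) auto
    also have "\<dots> < A" using \<kappa> A by (simp add: divide_less_eq algebra_simps)
    finally have "(t\<^sup>2 - s\<^sup>2) * (nrm (?K c))\<^sup>2 < A" .
    moreover have "Re (defect w t c c) = Re (defect w s c c) + (t\<^sup>2 - s\<^sup>2) * (nrm (?K c))\<^sup>2"
      unfolding defect_self[OF D c] by (simp add: algebra_simps)
    moreover have "Re (defect w s c c) = - A"
      unfolding c_def A_def by (rule F.neg_orthonormal_form[OF bneg])
    ultimately show ?thesis unfolding c_def by linarith
  qed
  then show False using at_most bD unfolding at_most_neg_squares_defect[OF D] n_def by blast
qed

section \<open>Evaluations and codimension\<close>

text \<open>Testing a vanishing combination of evaluations on the kernel functions of the same points gives
  a vector in the kernel of their Gram matrix.\<close>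

lemma evaluations_independent:
  assumes ns: "nonsingular_kernel (points H) k"
    and A: "finite A" "A \<subseteq> points H"
    and zero: "\<And>h. h \<in> elements H \<Longrightarrow> (\<Sum>x\<in>A. c x * h x) = 0" and x: "x \<in> A"
  shows "c x = 0"
proof -
  define n where "n = card A"
  obtain l where l: "bij_betw l {..<n} A"
    using ex_bij_betw_nat_finite[OF A(1)] unfolding atLeast0LessThan n_def by blast
  then have lA: "l ` {..<n} = A" "inj_on l {..<n}" by (auto simp: bij_betw_def)
  define G where "G = gram k n l"
  have G: "G \<in> carrier_mat n n" by (simp add: G_def gram_def)
  have "invertible_mat G" using ns lA A(2) unfolding nonsingular_kernel_def G_def by blast
  then obtain B where B: "inverts_mat B G" "B \<in> carrier_mat n n"
  proof -
    obtain B where B: "inverts_mat G B" "inverts_mat B G"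
      using \<open>invertible_mat G\<close> unfolding invertible_mat_def by blast
    have "dim_col B = n" using B(1) G unfolding inverts_mat_def
      by (metis carrier_matD(1) index_mult_mat(3) index_one_mat(3))
    moreover have "dim_row B = n" using B(2) G unfolding inverts_mat_def
      by (metis carrier_matD(2) index_mult_mat(3) index_one_mat(3))
    ultimately show thesis using that[of B] B by blast
  qed
  define v where "v = vec n (\<lambda>j. cnj (c (l j)))"
  have "G *\<^sub>v v = 0\<^sub>v n"
  proof (rule eq_vecI)
    fix i assume "i < dim_vec (0\<^sub>v n :: complex vec)"
    then have i: "i < n" by simp
    then have li: "l i \<in> points H" using lA A(2) by blast
    have "(G *\<^sub>v v) $ i = (\<Sum>j<n. k (l i) (l j) * cnj (c (l j)))"
      using i by (simp add: G_def gram_def v_def scalar_prod_def atLeast0LessThan)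
    also have "\<dots> = (\<Sum>x\<in>A. k (l i) x * cnj (c x))"
      by (rule sum.reindex_bij_betw[OF l, of "\<lambda>x. k (l i) x * cnj (c x)"])
    also have "\<dots> = cnj (\<Sum>x\<in>A. c x * k x (l i))"
    proof -
      have "k (l i) x * cnj (c x) = cnj (c x * k x (l i))" if "x \<in> A" for x
      proof -
        have "k (l i) x = cnj (k x (l i))" using li that A(2) by (intro kernel_hermitian) auto
        then show ?thesis by simp
      qed
      then show ?thesis unfolding cnj_sum by (intro sum.cong refl)
    qed
    also have "(\<Sum>x\<in>A. c x * k x (l i)) = 0" using zero[OF kernel_in[OF li]] .
    finally show "(G *\<^sub>v v) $ i = 0\<^sub>v n $ i" using i by simp
  qed (simp add: G_def gram_def)
  then have "B *\<^sub>v (G *\<^sub>v v) = 0\<^sub>v n"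
    using B(2) by (intro eq_vecI) (auto simp: scalar_prod_def)
  moreover have "B *\<^sub>v (G *\<^sub>v v) = v"
    using B G by (subst assoc_mult_mat_vec[symmetric]) (auto simp: inverts_mat_def v_def)
  ultimately have "v = 0\<^sub>v n" by simp
  moreover obtain j where "j < n" "x = l j" using lA(1) x by blast
  ultimately have "cnj (c x) = 0" by (metis v_def index_vec index_zero_vec(1))
  then show ?thesis by simp
qed

text \<open>Evaluations at points where \<open>E\<close> vanishes are determined by their values on an \<open>m\<close>-dimensional
  complement of \<open>E\<close>, so at most \<open>m\<close> of them are independent.\<close>

lemma common_zeros_card:
  assumes ns: "nonsingular_kernel (points H) k"
    and codim: "has_codim H E m"
    and A: "A \<subseteq> points H" "\<And>x h. x \<in> A \<Longrightarrow> h \<in> E \<Longrightarrow> h x = 0"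
  shows "finite A \<and> card A \<le> m"
proof (rule ccontr)
  assume "\<not> (finite A \<and> card A \<le> m)"
  then obtain A' where A': "A' \<subseteq> A" "finite A'" "card A' = Suc m"
    by (metis Suc_leI infinite_arbitrarily_large not_le obtain_subset_with_card_n)
  obtain B where B: "finite B" "card B = m" and H_eq: "elements H = {e + f | e f. e \<in> E \<and> f \<in> cfun.span B}"
    using codim unfolding has_codim_def has_fin_dim_def by blast
  obtain \<beta> where \<beta>: "bij_betw \<beta> {..<m} B"
    using ex_bij_betw_nat_finite[OF B(1)] unfolding atLeast0LessThan B(2) by blast
  obtain c where c: "\<exists>x\<in>A'. c x \<noteq> 0" "\<forall>i<m. (\<Sum>x\<in>A'. \<beta> i x * c x) = 0"
    using underdetermined_system_on[OF A'(2), of m \<beta>] A'(3) by auto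
  have "cfun.span B \<subseteq> {f. (\<Sum>x\<in>A'. c x * f x) = 0}"
  proof (rule cfun.span_minimal)
    show "B \<subseteq> {f. (\<Sum>x\<in>A'. c x * f x) = 0}"
    proof
      fix f assume "f \<in> B"
      then obtain i where "i < m" "f = \<beta> i" using bij_betw_imp_surj_on[OF \<beta>] by blast
      then show "f \<in> {f. (\<Sum>x\<in>A'. c x * f x) = 0}" using c(2) by (simp add: mult.commute)
    qed
    show "cfun.subspace {f. (\<Sum>x\<in>A'. c x * f x) = 0}"
    proof (rule cfun.subspaceI)
      fix f a assume "f \<in> {f. (\<Sum>x\<in>A'. c x * f x) = 0}"
      moreover have "(\<Sum>x\<in>A'. c x * cscale a f x) = a * (\<Sum>x\<in>A'. c x * f x)"
        by (simp add: sum_distrib_left mult_ac)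
      ultimately show "cscale a f \<in> {f. (\<Sum>x\<in>A'. c x * f x) = 0}" by simp
    qed (simp_all add: distrib_left sum.distrib)
  qed
  have "(\<Sum>x\<in>A'. c x * h x) = 0" if h: "h \<in> elements H" for h
  proof -
    obtain e f where ef: "e \<in> E" "f \<in> cfun.span B" "h = e + f" using h H_eq by blast
    have "(\<Sum>x\<in>A'. c x * h x) = (\<Sum>x\<in>A'. c x * f x)"
      using A(2) A'(1) ef by (intro sum.cong) auto
    also have "\<dots> = 0" using \<open>cfun.span B \<subseteq> _\<close> ef(2) by blast
    finally show ?thesis .
  qed
  then have "c x = 0" if "x \<in> A'" for x
    using evaluations_independent[OF ns A'(2) _ _ that, of c] A' A(1) by blast
  then show False using c(1) by blast
qed

text \<open>With one point more than there are in \<open>D\<close>, some nontrivial combination of the kernel functions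
  vanishes on \<open>D\<close>, and hence is zero.\<close>

lemma finite_set_of_uniqueness:
  assumes ns: "nonsingular_kernel (points H) k"
    and D: "finite D" "D \<subseteq> points H" and uniq: "set_of_uniqueness D (elements H)"
  shows "D = points H"
proof (rule ccontr)
  assume "D \<noteq> points H"
  then obtain \<alpha> where \<alpha>: "\<alpha> \<in> points H" "\<alpha> \<notin> D" using D by blast
  define A where "A = insert \<alpha> D"
  have A: "finite A" "A \<subseteq> points H" "card A = Suc (card D)" using D \<alpha> by (auto simp: A_def)
  obtain l where l: "bij_betw l {..<card D} D"
    using ex_bij_betw_nat_finite[OF D(1)] unfolding atLeast0LessThan by blast
  obtain c where c: "\<exists>x\<in>A. c x \<noteq> 0" "\<forall>i<card D. (\<Sum>x\<in>A. k (l i) x * c x) = 0"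
    using underdetermined_system_on[OF A(1), of "card D" "\<lambda>i. k (l i)"] A(3) by auto
  define f where "f = (\<Sum>x\<in>A. cscale (c x) (\<lambda>y. k y x))"
  have f: "f \<in> elements H" unfolding f_def using A(2) kernel_in by (intro V_sum V_scale) auto
  have "\<forall>y\<in>D. f y = 0 y"
  proof
    fix y assume "y \<in> D"
    then obtain i where "i < card D" "y = l i" using bij_betw_imp_surj_on[OF l] by blast
    then show "f y = 0 y" using c(2) by (simp add: f_def sum_fun_apply mult.commute)
  qed
  then have "f = 0" using uniq f V_zero unfolding set_of_uniqueness_def by blast
  have "(\<Sum>x\<in>A. cnj (c x) * h x) = 0" if h: "h \<in> elements H" for h
  proof -
    have "(\<Sum>x\<in>A. cnj (c x) * h x) = (\<Sum>x\<in>A. inner_prod H h (cscale (c x) (\<lambda>y. k y x)))"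
      using A(2) kernel_in kernel_eval h by (intro sum.cong) (auto simp: ip_scale_right)
    also have "\<dots> = inner_prod H h f"
      unfolding f_def using A(2) kernel_in h by (intro ip_sum_right[symmetric]) auto
    also have "\<dots> = 0" unfolding \<open>f = 0\<close> using h by (rule ip_zero_right)
    finally show ?thesis .
  qed
  then have "cnj (c x) = 0" if "x \<in> A" for x
    using evaluations_independent[OF ns A(1,2) _ that, of "\<lambda>x. cnj (c x)"] by blast
  then show False using c(1) by simp
qed

section \<open>Pseudomultipliers\<close>

lemma mult_op_eq:
  assumes uniq: "set_of_uniqueness D (elements H)" and "g \<in> elements H" "restr D g = mult_fun D \<psi> h"
  shows "mult_op H D \<psi> h = g"
  unfolding mult_op_def
proof (rule the_equality)
  fix g' assume "g' \<in> elements H \<and> restr D g' = mult_fun D \<psi> h"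
  then have "g' \<in> elements H" "restr D g' = restr D g" using assms by auto
  then have "\<forall>x\<in>D. g' x = g x" by (metis restr_def)
  then show "g' = g" using uniq assms(2) \<open>g' \<in> elements H\<close> unfolding set_of_uniqueness_def by blast
qed (use assms in blast)

lemma restr_mult_fun_iff: "restr D g = mult_fun D \<psi> h \<longleftrightarrow> (\<forall>x\<in>D. g x = \<psi> x * h x)"
  by (auto simp: restr_def mult_fun_def fun_eq_iff)

context
  fixes D \<psi> m E
  assumes D: "D \<subseteq> points H" and uniq: "set_of_uniqueness D (elements H)"
    and adm: "admissible H m D \<psi> E"
begin

lemma mult_op_admissible:
  assumes "h \<in> E"
  shows "mult_op H D \<psi> h \<in> elements H" "x \<in> D \<Longrightarrow> mult_op H D \<psi> h x = \<psi> x * h x"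
proof -
  obtain g where g: "g \<in> elements H" "restr D g = mult_fun D \<psi> h"
    using adm assms unfolding admissible_def by (metis imageE image_subset_iff)
  then have eq: "mult_op H D \<psi> h = g" using uniq by (intro mult_op_eq)
  show "mult_op H D \<psi> h \<in> elements H" using g(1) eq by simp
  show "x \<in> D \<Longrightarrow> mult_op H D \<psi> h x = \<psi> x * h x"
    using g(2) eq by (simp add: restr_mult_fun_iff)
qed

lemma E_subspace: "cfun.subspace E" "E \<subseteq> elements H"
  using adm by (auto simp: admissible_def closed_subspace_iff)

text \<open>The supremum defining the norm is taken over a bounded set, by automatic boundedness; this is
  what makes it a bound for the operator.\<close>

lemma op_norm_bound:
  "0 \<le> op_norm H E (mult_op H D \<psi>)"
  "h \<in> E \<Longrightarrow> nrm (mult_op H D \<psi> h) \<le> op_norm H E (mult_op H D \<psi>) * nrm h"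
proof -
  let ?M = "mult_op H D \<psi>"
  have "closed_subspace H E" using adm by (simp add: admissible_def)
  then obtain C where C: "\<And>h. h \<in> E \<Longrightarrow> nrm (?M h) \<le> C * nrm h"
    using multiplication_bounded[OF D _ uniq, of E ?M \<psi>] mult_op_admissible by blast
  have bdd: "bdd_above ((\<lambda>h. hnorm H (?M h)) ` {h \<in> E. hnorm H h \<le> 1})"
  proof (rule bdd_aboveI2)
    fix h assume h: "h \<in> {h \<in> E. hnorm H h \<le> 1}"
    then have h': "h \<in> E" "nrm h \<le> 1" "0 \<le> nrm h" using E_subspace by (auto simp: nrm_eq_hnorm[symmetric])
    have "hnorm H (?M h) \<le> C * nrm h" using C[OF h'(1)] by (simp add: nrm_eq_hnorm)
    also have "\<dots> \<le> max C 0 * 1" using h' by (intro mult_mono) auto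
    finally show "hnorm H (?M h) \<le> max C 0" by simp
  qed
  have upper: "nrm (?M h) \<le> op_norm H E ?M" if "h \<in> E" "nrm h \<le> 1" for h
    unfolding op_norm_def nrm_eq_hnorm using that bdd by (intro cSUP_upper) (auto simp: nrm_eq_hnorm)
  have "0 \<in> E" using E_subspace(1) by (rule cfun.subspace_0)
  then show "0 \<le> op_norm H E ?M"
    using upper[of 0] mult_op_admissible(1)[of 0] nrm_nonneg nrm_zero order_trans by (metis zero_le_one)
  show "nrm (?M h) \<le> op_norm H E ?M * nrm h" if h: "h \<in> E"
  proof (cases "nrm h = 0")
    case True
    then show ?thesis using C[OF h] by simp
  next
    case False
    have hH: "h \<in> elements H" using h E_subspace by blast
    then have pos: "nrm h > 0" using False nrm_nonneg[OF hH] by linarith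
    define a where "a = complex_of_real (1 / nrm h)"
    have aE: "cscale a h \<in> E" using E_subspace(1) h by (rule cfun.subspace_scale)
    have "?M (cscale a h) = cscale a (?M h)"
      using mult_op_admissible[OF h] uniq by (intro mult_op_eq) (auto simp: restr_mult_fun_iff)
    then have "nrm (?M h) / nrm h = nrm (?M (cscale a h))"
      using mult_op_admissible(1)[OF h] pos by (simp add: nrm_scale a_def norm_divide)
    also have "\<dots> \<le> op_norm H E ?M"
      using aE hH pos by (intro upper) (auto simp: nrm_scale a_def norm_divide)
    finally show ?thesis using pos by (simp add: pos_divide_le_eq)
  qed
qed

lemma op_norm_neg_squares:
  assumes "D' \<subseteq> D" "\<And>x. x \<in> D' \<Longrightarrow> \<phi> x = \<psi> x"
  defines "t \<equiv> op_norm H E (mult_op H D \<psi>)"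
  shows "at_most_neg_squares D' (defect_kernel k \<phi> t) m"
proof (rule codim_imp_neg_squares)
  show "D' \<subseteq> points H" using assms(1) D by blast
  show "has_codim H E m" using adm by (simp add: admissible_def)
  show "0 \<le> t" unfolding t_def by (rule op_norm_bound)
  show "\<exists>g\<in>elements H. nrm g \<le> t * nrm h \<and> (\<forall>x\<in>D'. g x = \<phi> x * h x)" if "h \<in> E" for h
    using mult_op_admissible[OF that] op_norm_bound(2)[OF that] assms(1,2)
    unfolding t_def by (intro bexI[of _ "mult_op H D \<psi> h"]) auto
qed (rule E_subspace)+

lemma op_norm_le:
  assumes "0 \<le> t"
    and "\<And>h. h \<in> E \<Longrightarrow> \<exists>g\<in>elements H. nrm g \<le> t * nrm h \<and> (\<forall>x\<in>D. g x = \<psi> x * h x)"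
  shows "op_norm H E (mult_op H D \<psi>) \<le> t"
  unfolding op_norm_def
proof (rule cSUP_least)
  have "0 \<in> E" using E_subspace(1) by (rule cfun.subspace_0)
  then show "{h \<in> E. hnorm H h \<le> 1} \<noteq> {}" using nrm_zero by (auto simp: nrm_eq_hnorm[symmetric] simp del: zero_fun_apply)
  fix h assume h: "h \<in> {h \<in> E. hnorm H h \<le> 1}"
  then obtain g where g: "g \<in> elements H" "nrm g \<le> t * nrm h" "\<forall>x\<in>D. g x = \<psi> x * h x"
    using assms(2) by blast
  have "mult_op H D \<psi> h = g" using g uniq by (intro mult_op_eq) (auto simp: restr_mult_fun_iff)
  moreover have "t * nrm h \<le> t * 1" using h assms(1) by (intro mult_left_mono) (auto simp: nrm_eq_hnorm)
  ultimately show "hnorm H (mult_op H D \<psi> h) \<le> t" using g(2) by (simp add: nrm_eq_hnorm)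
qed

end

end

section \<open>Restriction to a set of uniqueness\<close>

lemma restr_add: "restr D (f + g) = restr D f + restr D g"
  by (auto simp: restr_def fun_eq_iff)

lemma restr_scale: "restr D (cscale c f) = cscale c (restr D f)"
  by (auto simp: restr_def fun_eq_iff)

lemma restr_diff: "restr D (f - g) = restr D f - restr D g"
  by (auto simp: restr_def fun_eq_iff)

lemma linear_restr: "Vector_Spaces.linear cscale cscale (restr D)"
  by unfold_locales (auto simp: restr_add restr_scale)

lemma inj_on_restr: "set_of_uniqueness D C \<Longrightarrow> inj_on (restr D) C"
  unfolding inj_on_def set_of_uniqueness_def by (metis restr_def)

lemma has_fin_dim_restr:
  assumes "cfun.subspace V" and inj: "inj_on (restr D) V"
  shows "has_fin_dim (restr D ` V) n \<longleftrightarrow> has_fin_dim V n"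
proof
  interpret r: Vector_Spaces.linear cscale cscale "restr D" by (rule linear_restr)
  assume "has_fin_dim V n"
  then obtain B where B: "finite B" "card B = n" "cfun.independent B" "cfun.span B = V"
    unfolding has_fin_dim_def by blast
  have "inj_on (restr D) B" using inj B(4) cfun.span_superset by (metis inj_on_subset)
  then have "finite (restr D ` B)" "card (restr D ` B) = n" using B(1,2) by (auto simp: card_image)
  moreover have "cfun.independent (restr D ` B)"
    using r.independent_injective_image[OF B(3)] inj B(4) by simp
  moreover have "cfun.span (restr D ` B) = restr D ` V" by (simp add: r.span_image B(4))
  ultimately show "has_fin_dim (restr D ` V) n" unfolding has_fin_dim_def by blast
next
  interpret r: Vector_Spaces.linear cscale cscale "restr D" by (rule linear_restr)
  assume "has_fin_dim (restr D ` V) n"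
  then obtain B' where B': "finite B'" "card B' = n" "cfun.independent B'" "cfun.span B' = restr D ` V"
    unfolding has_fin_dim_def by blast
  have "B' \<subseteq> restr D ` V" using B'(4) cfun.span_superset by blast
  then obtain B where B: "B \<subseteq> V" "B' = restr D ` B" unfolding subset_image_iff by blast
  have injB: "inj_on (restr D) B" using inj B(1) by (rule inj_on_subset)
  have "cfun.independent B"
  proof
    assume "cfun.dependent B"
    then obtain b where b: "b \<in> B" "b \<in> cfun.span (B - {b})" unfolding cfun.dependent_def by blast
    have "restr D b \<in> cfun.span (restr D ` (B - {b}))" using b(2) by (simp add: r.span_image)
    moreover have "restr D ` (B - {b}) = B' - {restr D b}"
      using injB b(1) B(2) by (auto simp: inj_on_def)
    ultimately have "cfun.dependent B'" using b(1) B(2) unfolding cfun.dependent_def by auto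
    then show False using B'(3) by blast
  qed
  moreover have "finite B" using B'(1) injB B(2) by (simp add: finite_image_iff)
  moreover have "card B = n" using B'(2) injB B(2) by (simp add: card_image)
  moreover have "cfun.span B = V"
  proof -
    have "cfun.span B \<subseteq> V" using B(1) assms(1) by (rule cfun.span_minimal)
    moreover have "restr D ` cfun.span B = restr D ` V" using B'(4) by (simp add: B(2) r.span_image)
    ultimately show ?thesis using inj inj_on_image_eq_iff by blast
  qed
  ultimately show "has_fin_dim V n" unfolding has_fin_dim_def by blast
qed

context kernel_space
begin

context
  fixes D assumes D: "D \<subseteq> points H" and uniq: "set_of_uniqueness D (elements H)"
begin

lemma restrict_space_simps:
  "points (restrict_space H D) = D"
  "elements (restrict_space H D) = restr D ` elements H"
  "f \<in> elements H \<Longrightarrow> g \<in> elements H \<Longrightarrow>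
    inner_prod (restrict_space H D) (restr D f) (restr D g) = inner_prod H f g"
  "f \<in> elements H \<Longrightarrow> hnorm (restrict_space H D) (restr D f) = nrm f"
  using inj_on_restr[OF uniq]
  by (simp_all add: restrict_space_def the_inv_into_f_f hnorm_def nrm_def)

lemma inner_product_restrict_space:
  "inner_product_functions (elements (restrict_space H D)) (inner_prod (restrict_space H D))"
proof
  let ?H = "restrict_space H D"
  have elts: "elements ?H = restr D ` elements H" by (rule restrict_space_simps)
  interpret r: Vector_Spaces.linear cscale cscale "restr D" by (rule linear_restr)
  show "cfun.subspace (elements ?H)" unfolding elts using subspace_elements by (rule r.subspace_image)
  fix f assume "f \<in> elements ?H"
  then obtain f' where f: "f' \<in> elements H" "f = restr D f'" unfolding elts by blast
  show "0 \<le> Re (inner_prod ?H f f)"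
    using inner_nonneg[OF f(1)] by (simp only: f(2) restrict_space_simps(3)[OF f(1) f(1)])
  show "f = 0" if "inner_prod ?H f f = 0"
  proof -
    have "inner_prod H f' f' = 0" using that by (simp only: f(2) restrict_space_simps(3)[OF f(1) f(1)])
    then have "f' = 0" using f(1) inner_definite by blast
    then show ?thesis by (simp only: f(2) r.zero)
  qed
  fix g assume "g \<in> elements ?H"
  then obtain g' where g: "g' \<in> elements H" "g = restr D g'" unfolding elts by blast
  show "inner_prod ?H g f = cnj (inner_prod ?H f g)"
    unfolding f(2) g(2) restrict_space_simps(3)[OF f(1) g(1)] restrict_space_simps(3)[OF g(1) f(1)]
    using f(1) g(1) by (rule inner_commute)
  show "inner_prod ?H (cscale c f) g = c * inner_prod ?H f g" for c
    unfolding f(2) g(2) restr_scale[symmetric] restrict_space_simps(3)[OF f(1) g(1)]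
      restrict_space_simps(3)[OF V_scale[OF f(1)] g(1)]
    using f(1) g(1) by (rule inner_scale)
  fix h assume "h \<in> elements ?H"
  then obtain h' where h: "h' \<in> elements H" "h = restr D h'" unfolding elts by blast
  show "inner_prod ?H (f + g) h = inner_prod ?H f h + inner_prod ?H g h"
    unfolding f(2) g(2) h(2) restr_add[symmetric] restrict_space_simps(3)[OF f(1) h(1)]
      restrict_space_simps(3)[OF g(1) h(1)] restrict_space_simps(3)[OF V_add[OF f(1) g(1)] h(1)]
    using f(1) g(1) h(1) by (rule inner_add)
qed

lemma hilbert_function_space_restrict: "hilbert_function_space (restrict_space H D)"
proof -
  let ?H = "restrict_space H D"
  note ip = inner_product_restrict_space
  have elts: "elements ?H = restr D ` elements H" by (rule restrict_space_simps)
  interpret ip: inner_product_functions "elements ?H" "inner_prod ?H" by (rule ip)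
  have norm_diff: "hnorm ?H (restr D f - restr D g) = nrm (f - g)"
    if "f \<in> elements H" "g \<in> elements H" for f g
    unfolding restr_diff[symmetric] using that by (intro restrict_space_simps) auto
  show ?thesis
  proof
    show "f x = 0" if "f \<in> elements ?H" "x \<notin> points ?H" for f x
      using that by (auto simp: restrict_space_def restr_def)
    show "Metric_space.mcomplete (elements ?H) (hdist ?H)"
      unfolding mcomplete_hdist_iff[OF ip]
    proof (intro allI impI)
      fix \<sigma> :: "nat \<Rightarrow> 'a \<Rightarrow> complex"
      assume "\<forall>n. \<sigma> n \<in> elements ?H"
        and cauchy: "\<forall>\<epsilon>>0. \<exists>N. \<forall>n\<ge>N. \<forall>m\<ge>N. hnorm ?H (\<sigma> n - \<sigma> m) < \<epsilon>"
      then have "\<forall>n. \<exists>f\<in>elements H. \<sigma> n = restr D f" unfolding elts by blast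
      then obtain \<tau> where \<tau>: "\<And>n. \<tau> n \<in> elements H" "\<And>n. \<sigma> n = restr D (\<tau> n)" by metis
      have "\<exists>l\<in>elements H. (\<lambda>n. nrm (\<tau> n - l)) \<longlonglongrightarrow> 0"
      proof (rule cauchy_convergent[OF \<tau>(1)])
        show "\<exists>N. \<forall>n\<ge>N. \<forall>m\<ge>N. nrm (\<tau> n - \<tau> m) < \<epsilon>" if "\<epsilon> > 0" for \<epsilon>
          using cauchy that by (simp add: \<tau> norm_diff)
      qed
      then obtain l where l: "l \<in> elements H" "(\<lambda>n. nrm (\<tau> n - l)) \<longlonglongrightarrow> 0" by blast
      have "(\<lambda>n. hnorm ?H (\<sigma> n - restr D l)) \<longlonglongrightarrow> 0"
        using l(2) by (simp add: \<tau> norm_diff l(1))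
      then show "\<exists>l\<in>elements ?H. (\<lambda>n. hnorm ?H (\<sigma> n - l)) \<longlonglongrightarrow> 0"
        using l(1) unfolding elts by blast
    qed
    show "continuous_map (htopology ?H) euclidean (\<lambda>h. h x)" if "x \<in> points ?H" for x
    proof (rule continuous_map_evaluation[OF ip])
      fix f assume "f \<in> elements ?H"
      then obtain g where g: "g \<in> elements H" "f = restr D g" unfolding elts by blast
      have x: "x \<in> D" "x \<in> points H" using that D by (auto simp: restrict_space_simps)
      have "cmod (f x) = cmod (inner_prod H g (\<lambda>y. k y x))"
        using g x kernel_eval by (simp add: restr_def)
      also have "\<dots> \<le> nrm g * nrm (\<lambda>y. k y x)"
        using g x kernel_in by (intro cauchy_schwarz) auto
      finally show "cmod (f x) \<le> nrm (\<lambda>y. k y x) * hnorm ?H f"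
        using g by (simp add: restrict_space_simps(4) mult.commute)
    qed
  qed (fact ip.subspace ip.ip_add_left ip.ip_scale_left ip.ip_commute ip.ip_nonneg ip.ip_definite)+
qed

lemma kernel_space_restrict: "kernel_space (restrict_space H D) (\<lambda>x y. if x \<in> D then k x y else 0)"
proof (rule kernel_space.intro[OF hilbert_function_space_restrict], rule kernel_space_axioms.intro)
  let ?H = "restrict_space H D"
  have "(\<lambda>y. if y \<in> D then k y x else 0) \<in> elements ?H \<and>
      (\<forall>f\<in>elements ?H. inner_prod ?H f (\<lambda>y. if y \<in> D then k y x else 0) = f x)" if x: "x \<in> D" for x
  proof -
    have xH: "x \<in> points H" using x D by blast
    have eq: "(\<lambda>y. if y \<in> D then k y x else 0) = restr D (\<lambda>y. k y x)" by (simp add: restr_def)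
    have rx: "restr D g x = g x" for g using x by (simp add: restr_def)
    show ?thesis
      unfolding eq restrict_space_simps(2)
      using kernel_in[OF xH] kernel_eval[OF xH] x by (auto simp: restrict_space_simps(3) rx)
  qed
  then show "reproducing_kernel ?H (\<lambda>x y. if x \<in> D then k x y else 0)"
    by (simp add: reproducing_kernel_def restrict_space_simps(1))
qed

lemma dim_less_restrict: "dim_less (restrict_space H D) m \<longleftrightarrow> dim_less H m"
  unfolding dim_less_def restrict_space_simps(2)
  using has_fin_dim_restr[OF subspace_elements inj_on_restr[OF uniq]] by simp

end

section \<open>Extending a multiplier of a subspace of finite codimension\<close>

text \<open>For \<open>h\<^sub>1, h\<^sub>2\<close> in \<open>E\<close> the functions \<open>M h\<^sub>1 * h\<^sub>2\<close> and \<open>M h\<^sub>2 * h\<^sub>1\<close> agree on \<open>D\<close>, hence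
  everywhere, \<open>D\<close> being a set of uniqueness for \<open>HH + HH\<close>. So \<open>M h / h\<close> does not depend on \<open>h\<close>, and it
  extends \<open>w\<close> to all points where not all of \<open>E\<close> vanishes. A point outside \<open>D\<close> where \<open>E\<close> vanishes is
  either a singularity, or all \<open>M h\<close> vanish there too and any value will do.\<close>

lemma extend_multiplier:
  assumes D: "D \<subseteq> points H" and ns: "nonsingular_kernel (points H) k"
    and uniq2: "set_of_uniqueness D {f\<^sub>1 * f\<^sub>2 + f\<^sub>3 * f\<^sub>4 | f\<^sub>1 f\<^sub>2 f\<^sub>3 f\<^sub>4.
      f\<^sub>1 \<in> elements H \<and> f\<^sub>2 \<in> elements H \<and> f\<^sub>3 \<in> elements H \<and> f\<^sub>4 \<in> elements H}"
    and E: "closed_subspace H E" "has_codim H E m"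
    and mult: "\<And>h. h \<in> E \<Longrightarrow> \<exists>g\<in>elements H. nrm g \<le> t * nrm h \<and> (\<forall>x\<in>D. g x = w x * h x)"
  obtains D' \<psi> where "D \<subseteq> D'" "D' \<subseteq> points H" "\<forall>x\<in>D. \<psi> x = w x"
    "\<forall>\<alpha>\<in>points H - D'. singularity H D' \<psi> \<alpha>"
    "finite (points H - D')" "card (points H - D') \<le> m" "admissible H m D' \<psi> E"
    "\<And>h. h \<in> E \<Longrightarrow> \<exists>g\<in>elements H. nrm g \<le> t * nrm h \<and> (\<forall>x\<in>D'. g x = \<psi> x * h x)"
proof -
  obtain M where M: "\<And>h. h \<in> E \<Longrightarrow> M h \<in> elements H" "\<And>h. h \<in> E \<Longrightarrow> nrm (M h) \<le> t * nrm h"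
    "\<And>h x. h \<in> E \<Longrightarrow> x \<in> D \<Longrightarrow> M h x = w x * h x"
    using mult by metis
  have EH: "E \<subseteq> elements H" using E(1) by (simp add: closed_subspace_iff)
  let ?HH = "{f\<^sub>1 * f\<^sub>2 + f\<^sub>3 * f\<^sub>4 | f\<^sub>1 f\<^sub>2 f\<^sub>3 f\<^sub>4.
      f\<^sub>1 \<in> elements H \<and> f\<^sub>2 \<in> elements H \<and> f\<^sub>3 \<in> elements H \<and> f\<^sub>4 \<in> elements H}"
  have cross: "M h\<^sub>1 x * h\<^sub>2 x = M h\<^sub>2 x * h\<^sub>1 x" if h: "h\<^sub>1 \<in> E" "h\<^sub>2 \<in> E" for h\<^sub>1 h\<^sub>2 x
  proof -
    have hH: "h\<^sub>1 \<in> elements H" "h\<^sub>2 \<in> elements H" "M h\<^sub>1 \<in> elements H" "- M h\<^sub>2 \<in> elements H"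
      using h EH M(1) by auto
    have 1: "M h\<^sub>1 * h\<^sub>2 + (- M h\<^sub>2) * h\<^sub>1 \<in> ?HH" using hH by blast
    have "0 * 0 + 0 * 0 \<in> ?HH" using V_zero by blast
    then have 2: "0 \<in> ?HH" by (simp only: mult_zero_left add_0_left)
    have "\<forall>x\<in>D. (M h\<^sub>1 * h\<^sub>2 + (- M h\<^sub>2) * h\<^sub>1) x = 0 x"
      using M(3) h by simp
    then have "M h\<^sub>1 * h\<^sub>2 + (- M h\<^sub>2) * h\<^sub>1 = 0"
      using uniq2 1 2 unfolding set_of_uniqueness_def by blast
    then have "(M h\<^sub>1 * h\<^sub>2 + (- M h\<^sub>2) * h\<^sub>1) x = 0" by simp
    then show ?thesis by simp
  qed
  define Z where "Z = {\<alpha> \<in> points H - D. (\<forall>h\<in>E. h \<alpha> = 0) \<and> (\<exists>h\<in>E. M h \<alpha> \<noteq> 0)}"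
  define D' where "D' = points H - Z"
  define \<psi> where "\<psi> x = (if x \<in> D then w x else
      if \<exists>h\<in>E. h x \<noteq> 0 then let h = SOME h. h \<in> E \<and> h x \<noteq> 0 in M h x / h x else 0)" for x
  have diff: "points H - D' = Z" by (auto simp: D'_def Z_def)
  have Z_card: "finite Z \<and> card Z \<le> m"
    by (rule common_zeros_card[OF ns E(2)]) (auto simp: Z_def)
  have mult': "M h x = \<psi> x * h x" if h: "h \<in> E" and x: "x \<in> D'" for h x
  proof (cases "x \<in> D")
    case True
    then show ?thesis using M(3)[OF h] by (simp add: \<psi>_def)
  next
    case xD: False
    show ?thesis
    proof (cases "\<exists>h\<in>E. h x \<noteq> 0")
      case True
      define h\<^sub>0 where "h\<^sub>0 = (SOME h. h \<in> E \<and> h x \<noteq> 0)"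
      have h0: "h\<^sub>0 \<in> E" "h\<^sub>0 x \<noteq> 0"
        unfolding h\<^sub>0_def using True someI_ex[of "\<lambda>h. h \<in> E \<and> h x \<noteq> 0"] by blast+
      have "\<psi> x = M h\<^sub>0 x / h\<^sub>0 x" using xD True by (simp add: \<psi>_def h\<^sub>0_def Let_def)
      then have "M h x * h\<^sub>0 x = (\<psi> x * h x) * h\<^sub>0 x"
        using cross[OF h h0(1), of x] h0(2) by simp
      then show ?thesis using h0(2) by simp
    next
      case False
      then have "M h x = 0" using x xD h by (auto simp: D'_def Z_def)
      then show ?thesis using False h by simp
    qed
  qed
  have restr_M: "restr D' (M h) = mult_fun D' \<psi> h" if "h \<in> E" for h
    using mult'[OF that] by (simp add: restr_mult_fun_iff)
  show thesis
  proof (rule that)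
    show "D \<subseteq> D'" using D by (auto simp: D'_def Z_def)
    show "D' \<subseteq> points H" by (auto simp: D'_def)
    show "\<forall>x\<in>D. \<psi> x = w x" by (simp add: \<psi>_def)
    show "\<forall>\<alpha>\<in>points H - D'. singularity H D' \<psi> \<alpha>"
    proof
      fix \<alpha> assume "\<alpha> \<in> points H - D'"
      then have "\<alpha> \<in> Z" using diff by blast
      then obtain h where h: "\<alpha> \<in> points H" "h \<in> E" "h \<alpha> = 0" "M h \<alpha> \<noteq> 0" by (auto simp: Z_def)
      then show "singularity H D' \<psi> \<alpha>"
        unfolding singularity_def using EH M(1)[OF h(2)] restr_M[OF h(2)] by blast
    qed
    show "finite (points H - D')" "card (points H - D') \<le> m" using Z_card by (simp_all add: diff)
    show "admissible H m D' \<psi> E"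
      unfolding admissible_def
    proof (intro conjI image_subsetI)
      fix h assume h: "h \<in> E"
      show "mult_fun D' \<psi> h \<in> restr D' ` elements H"
        using restr_M[OF h, symmetric] M(1)[OF h] by (rule image_eqI)
    qed (rule E)+
    show "\<exists>g\<in>elements H. nrm g \<le> t * nrm h \<and> (\<forall>x\<in>D'. g x = \<psi> x * h x)" if "h \<in> E" for h
      using M(1,2)[OF that] mult'[OF that] by blast
  qed
qed

text \<open>Every admissible subspace has norm in \<open>T\<close>, so all that matters for \<open>s_num\<close> is one subspace on
  which the norm is at most \<open>Inf T\<close>.\<close>

lemma s_num_eq_Inf:
  assumes D': "D' \<subseteq> points H" "set_of_uniqueness D' (elements H)" and D: "D \<subseteq> D'"
    and \<psi>: "\<forall>x\<in>D. \<psi> x = w x" and dim: "\<not> dim_less H m"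
  defines "T \<equiv> {t. 0 \<le> t \<and>
      at_most_neg_squares D (defect_kernel k w t) m}"
  assumes adm: "admissible H m D' \<psi> E" and T: "Inf T \<in> T"
    and mult: "\<And>h. h \<in> E \<Longrightarrow> \<exists>g\<in>elements H. nrm g \<le> Inf T * nrm h \<and> (\<forall>x\<in>D'. g x = \<psi> x * h x)"
  shows "s_num H m D' \<psi> = Inf T"
proof -
  let ?f = "\<lambda>E. op_norm H E (mult_op H D' \<psi>)"
  have T_bdd: "bdd_below T" by (auto simp: T_def intro: bdd_belowI[of _ 0])
  have in_T: "?f F \<in> T" if "admissible H m D' \<psi> F" for F
    using op_norm_bound(1)[OF D' that] op_norm_neg_squares[OF D' that D, of w] \<psi> by (simp add: T_def)
  have "(INF F\<in>{F. admissible H m D' \<psi> F}. ?f F) = Inf T"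
  proof (rule antisym)
    have "bdd_below (?f ` {F. admissible H m D' \<psi> F})"
      using op_norm_bound(1)[OF D'] by (intro bdd_belowI[of _ 0]) auto
    then have "(INF F\<in>{F. admissible H m D' \<psi> F}. ?f F) \<le> ?f E"
      using adm by (intro cINF_lower) auto
    also have "\<dots> \<le> Inf T" using T by (intro op_norm_le[OF D' adm] mult) (simp_all add: T_def)
    finally show "(INF F\<in>{F. admissible H m D' \<psi> F}. ?f F) \<le> Inf T" .
    show "Inf T \<le> (INF F\<in>{F. admissible H m D' \<psi> F}. ?f F)"
      using adm in_T T_bdd by (intro cINF_greatest) (auto intro: cInf_lower)
  qed
  then show ?thesis using dim by (simp add: s_num_def)
qed

end

lemma at_most_neg_squares_cong:
  assumes "\<And>x y. x \<in> D \<Longrightarrow> y \<in> D \<Longrightarrow> \<kappa> x y = \<kappa>' x y"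
  shows "at_most_neg_squares D \<kappa> m \<longleftrightarrow> at_most_neg_squares D \<kappa>' m"
proof -
  have "gram \<kappa> n l = gram \<kappa>' n l" if "l ` {..<n} \<subseteq> D" for n l
    using that by (intro eq_matI) (auto simp: gram_def intro!: assms)
  then show ?thesis using assms unfolding at_most_neg_squares_def by (metis (no_types, lifting))
qed

lemma at_most_neg_squares_mono: "at_most_neg_squares D \<kappa> n \<Longrightarrow> n \<le> m \<Longrightarrow> at_most_neg_squares D \<kappa> m"
  unfolding at_most_neg_squares_def using order_trans by blast

theorem theorem2p1:
  fixes H :: "'a function_space"
    and k :: "'a \<Rightarrow> 'a \<Rightarrow> complex"
    and D\<^sub>\<phi> :: "'a set"
    and \<phi> :: "'a \<Rightarrow> complex"
    and m :: nat
  assumes "hilbert_function_space H"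
    and "reproducing_kernel H k"
    and "nonsingular_kernel (points H) k"
    and "D\<^sub>\<phi> \<subseteq> points H"
    and "set_of_uniqueness D\<^sub>\<phi> (elements H)"
    and "set_of_uniqueness D\<^sub>\<phi>
           {f\<^sub>1 * f\<^sub>2 + f\<^sub>3 * f\<^sub>4 | f\<^sub>1 f\<^sub>2 f\<^sub>3 f\<^sub>4.
              f\<^sub>1 \<in> elements H \<and> f\<^sub>2 \<in> elements H \<and> f\<^sub>3 \<in> elements H \<and> f\<^sub>4 \<in> elements H}"
  defines "T \<equiv> {t::real. 0 \<le> t \<and>
      at_most_neg_squares D\<^sub>\<phi>
        (\<lambda>x y. (complex_of_real (t\<^sup>2) - \<phi> x * cnj (\<phi> y)) * k x y) m}"
    and "is_extension \<equiv> \<lambda>D\<^sub>\<psi> \<psi>. D\<^sub>\<phi> \<subseteq> D\<^sub>\<psi> \<and> (\<forall>x\<in>D\<^sub>\<phi>. \<psi> x = \<phi> x) \<and> pseudomultiplier H m D\<^sub>\<psi> \<psi>"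
  shows "(pseudomultiplier (restrict_space H D\<^sub>\<phi>) m D\<^sub>\<phi> \<phi> \<longleftrightarrow> (\<exists>t. t \<in> T)) \<and>
         ((\<exists>t. t \<in> T) \<longleftrightarrow> (\<exists>D\<^sub>\<psi> \<psi>. is_extension D\<^sub>\<psi> \<psi>)) \<and>
         (pseudomultiplier (restrict_space H D\<^sub>\<phi>) m D\<^sub>\<phi> \<phi> \<longrightarrow>
            (\<exists>D\<^sub>\<psi> \<psi>. is_extension D\<^sub>\<psi> \<psi> \<and>
               s_num (restrict_space H D\<^sub>\<phi>) m D\<^sub>\<phi> \<phi> = s_num H m D\<^sub>\<psi> \<psi> \<and>
               s_num H m D\<^sub>\<psi> \<psi> = Inf T))"
proof -
  let ?R = "restrict_space H D\<^sub>\<phi>"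
  interpret H: kernel_space H k
    by (rule kernel_space.intro[OF assms(1)]) (rule kernel_space_axioms.intro[OF assms(2)])
  note ns = assms(3) and D = assms(4) and uniq = assms(5)
  interpret R: kernel_space ?R "\<lambda>x y. if x \<in> D\<^sub>\<phi> then k x y else 0"
    using D uniq by (rule H.kernel_space_restrict)
  have points_R: "points ?R = D\<^sub>\<phi>" by (simp add: restrict_space_def)
  have dim_R: "dim_less ?R m \<longleftrightarrow> dim_less H m" by (rule H.dim_less_restrict[OF D uniq])
  show ?thesis
  proof (cases "dim_less H m")
    case True
    then obtain n where n: "n < m" "has_fin_dim (elements H) n" unfolding dim_less_def by blast
    \<comment> \<open>The zero subspace now has codimension \<open>n\<close> less than \<open>m\<close> and is multiplied into \<open>H\<close> with norm \<open>0\<close>.\<close>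
    have codim: "has_codim H {0} n"
      unfolding has_codim_def
    proof (intro exI[of _ "elements H"] conjI)
      show "elements H = {e + f | e f. e \<in> {0} \<and> f \<in> elements H}" by simp
    qed (use n H.V_zero in auto)
    have "finite (points H) \<and> card (points H) \<le> n"
      by (rule H.common_zeros_card[OF ns codim]) auto
    then have D_eq: "D\<^sub>\<phi> = points H"
      using H.finite_set_of_uniqueness[OF ns _ D uniq] finite_subset[OF D] by blast
    have "t \<in> T" if t: "0 \<le> t" for t
    proof -
      have "at_most_neg_squares D\<^sub>\<phi> (defect_kernel k \<phi> t) n"
      proof (rule H.codim_imp_neg_squares[OF D _ codim _ t])
        show "cfun.subspace {0}" by (rule cfun.subspace_single_0)
        show "{0} \<subseteq> elements H" using H.V_zero by blast
        fix h :: "'a \<Rightarrow> complex" assume "h \<in> {0}"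
        then have "h = 0" by blast
        then show "\<exists>g\<in>elements H. H.nrm g \<le> t * H.nrm h \<and> (\<forall>x\<in>D\<^sub>\<phi>. g x = \<phi> x * h x)"
          using H.V_zero H.nrm_zero by (intro bexI[of _ 0]) auto
      qed
      then show ?thesis using t n(1) at_most_neg_squares_mono unfolding T_def by fastforce
    qed
    then have T: "T = {0..}" by (auto simp: T_def)
    then have "Inf T = 0" by simp
    moreover have "is_extension D\<^sub>\<phi> \<phi>"
      using True D_eq by (simp add: is_extension_def pseudomultiplier_def)
    moreover have "s_num H m D\<^sub>\<phi> \<phi> = 0" "s_num ?R m D\<^sub>\<phi> \<phi> = 0"
      using True dim_R by (simp_all add: s_num_def)
    moreover have "pseudomultiplier ?R m D\<^sub>\<phi> \<phi>"
      using True dim_R points_R by (simp add: pseudomultiplier_def)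
    moreover have "0 \<in> T" by (simp add: T)
    ultimately show ?thesis by metis
  next
    case dim: False
    have large: "\<not> has_fin_dim (elements H) n" "\<not> has_fin_dim (elements ?R) n" if "n < m" for n
      using dim dim_R that unfolding dim_less_def by blast+
    have T_R: "T = {t. 0 \<le> t \<and> at_most_neg_squares D\<^sub>\<phi>
        (\<lambda>x y. (complex_of_real (t\<^sup>2) - \<phi> x * cnj (\<phi> y)) * (if x \<in> D\<^sub>\<phi> then k x y else 0)) m}"
      unfolding T_def by (intro Collect_cong conj_cong refl at_most_neg_squares_cong) simp
    have uniq_R: "set_of_uniqueness D\<^sub>\<phi> (elements ?R)"
      unfolding set_of_uniqueness_def
    proof (intro ballI impI)
      fix f g assume fg: "f \<in> elements ?R" "g \<in> elements ?R" "\<forall>x\<in>D\<^sub>\<phi>. f x = g x"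
      then have "f x = g x" for x
        using R.vanishes_outside[OF fg(1), of x] R.vanishes_outside[OF fg(2), of x] points_R
        by (cases "x \<in> D\<^sub>\<phi>") auto
      then show "f = g" by (rule ext)
    qed
    have DR: "D\<^sub>\<phi> \<subseteq> points ?R" by (simp add: points_R)
    have 1: "\<exists>t. t \<in> T" if pm: "pseudomultiplier ?R m D\<^sub>\<phi> \<phi>"
    proof -
      obtain E where E: "admissible ?R m D\<^sub>\<phi> \<phi> E"
        using pm dim dim_R by (auto simp: pseudomultiplier_def)
      show ?thesis
        using R.op_norm_bound(1)[OF DR uniq_R E] R.op_norm_neg_squares[OF DR uniq_R E order_refl refl]
        unfolding T_R by blast
    qed
    have 3: "\<exists>t. t \<in> T" if "is_extension D' \<psi>" for D' \<psi>
    proof -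
      have ext: "D\<^sub>\<phi> \<subseteq> D'" "\<forall>x\<in>D\<^sub>\<phi>. \<psi> x = \<phi> x" "pseudomultiplier H m D' \<psi>"
        using that by (auto simp: is_extension_def)
      then obtain E where E: "D' \<subseteq> points H" "set_of_uniqueness D' (elements H)" "admissible H m D' \<psi> E"
        using dim by (auto simp: pseudomultiplier_def)
      show ?thesis
        using H.op_norm_bound(1)[OF E] H.op_norm_neg_squares[OF E ext(1), of \<phi>] ext(2)
        unfolding T_def by auto
    qed
    have 2: "pseudomultiplier ?R m D\<^sub>\<phi> \<phi> \<and> (\<exists>D' \<psi>. is_extension D' \<psi> \<and>
        s_num ?R m D\<^sub>\<phi> \<phi> = s_num H m D' \<psi> \<and> s_num H m D' \<psi> = Inf T)" if tT: "t \<in> T" for t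
    proof -
      \<comment> \<open>The infimum is attained, so one subspace realises the smallest bound.\<close>
      define s where "s = Inf T"
      have s0: "0 \<le> s" unfolding s_def using tT by (intro cInf_greatest) (auto simp: T_def)
      have neg: "at_most_neg_squares D\<^sub>\<phi> (defect_kernel k \<phi> s) m"
      proof (rule H.at_most_neg_squares_limit[OF D])
        fix \<epsilon> :: real assume "\<epsilon> > 0"
        then have "s < sqrt (s\<^sup>2 + \<epsilon>)" using s0 by (intro real_less_rsqrt) simp
        then obtain t where t: "t \<in> T" "t < sqrt (s\<^sup>2 + \<epsilon>)"
          using tT cInf_lessD[of T "sqrt (s\<^sup>2 + \<epsilon>)"] unfolding s_def by blast
        then have "0 \<le> t" by (simp add: T_def)
        then have "t\<^sup>2 < (sqrt (s\<^sup>2 + \<epsilon>))\<^sup>2" using t(2) by (intro power_strict_mono) auto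
        also have "\<dots> = s\<^sup>2 + \<epsilon>" using \<open>\<epsilon> > 0\<close> by simp
        finally have "t\<^sup>2 < s\<^sup>2 + \<epsilon>" .
        then show "\<exists>t. t\<^sup>2 < s\<^sup>2 + \<epsilon> \<and> at_most_neg_squares D\<^sub>\<phi>
            (defect_kernel k \<phi> t) m"
          using t(1) unfolding T_def by blast
      qed
      then have sT: "s \<in> T" using s0 by (simp add: T_def)
      have neg_R: "at_most_neg_squares D\<^sub>\<phi> (\<lambda>x y. (complex_of_real (s\<^sup>2) - \<phi> x * cnj (\<phi> y)) *
          (if x \<in> D\<^sub>\<phi> then k x y else 0)) m"
        using sT unfolding T_R by blast
      obtain E where E: "closed_subspace H E" "has_codim H E m"
        "\<And>h. h \<in> E \<Longrightarrow> \<exists>g\<in>elements H. H.nrm g \<le> s * H.nrm h \<and> (\<forall>x\<in>D\<^sub>\<phi>. g x = \<phi> x * h x)"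
        using H.neg_squares_imp_codim[OF D s0 neg large(1)] by blast
      obtain D' \<psi> where ext: "D\<^sub>\<phi> \<subseteq> D'" "D' \<subseteq> points H" "\<forall>x\<in>D\<^sub>\<phi>. \<psi> x = \<phi> x"
        "\<forall>\<alpha>\<in>points H - D'. singularity H D' \<psi> \<alpha>"
        "finite (points H - D')" "card (points H - D') \<le> m" "admissible H m D' \<psi> E"
        "\<And>h. h \<in> E \<Longrightarrow> \<exists>g\<in>elements H. H.nrm g \<le> s * H.nrm h \<and> (\<forall>x\<in>D'. g x = \<psi> x * h x)"
        using H.extend_multiplier[OF D ns assms(6) E] by blast
      have uniq': "set_of_uniqueness D' (elements H)"
        using uniq ext(1) unfolding set_of_uniqueness_def by blast
      have "is_extension D' \<psi>"
        using ext uniq' dim by (auto simp: is_extension_def pseudomultiplier_def)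
      moreover have "s_num H m D' \<psi> = Inf T"
        using H.s_num_eq_Inf[OF ext(2) uniq' ext(1,3) dim ext(7)] sT ext(8)
        unfolding T_def s_def by blast
      moreover obtain F where F: "closed_subspace ?R F" "has_codim ?R F m"
        "\<And>h. h \<in> F \<Longrightarrow> \<exists>g\<in>elements ?R. R.nrm g \<le> s * R.nrm h \<and> (\<forall>x\<in>D\<^sub>\<phi>. g x = \<phi> x * h x)"
        using R.neg_squares_imp_codim[OF DR s0 neg_R large(2)] by blast
      have adm_R: "admissible ?R m D\<^sub>\<phi> \<phi> F"
        unfolding admissible_def
      proof (intro conjI image_subsetI F(1,2))
        fix h assume "h \<in> F"
        then obtain g where g: "g \<in> elements ?R" "\<forall>x\<in>D\<^sub>\<phi>. g x = \<phi> x * h x" using F(3) by blast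
        then have "mult_fun D\<^sub>\<phi> \<phi> h = restr D\<^sub>\<phi> g" using R.restr_mult_fun_iff by metis
        then show "mult_fun D\<^sub>\<phi> \<phi> h \<in> restr D\<^sub>\<phi> ` elements ?R" using g(1) by blast
      qed
      have "\<not> dim_less ?R m" using dim dim_R by simp
      then have "s_num ?R m D\<^sub>\<phi> \<phi> = Inf T"
        using R.s_num_eq_Inf[OF DR uniq_R order_refl _ _ adm_R, of \<phi>] sT F(3)
        unfolding T_R s_def by blast
      moreover have "pseudomultiplier ?R m D\<^sub>\<phi> \<phi>"
        using adm_R uniq_R dim dim_R points_R by (auto simp: pseudomultiplier_def)
      ultimately show ?thesis by metis
    qed
    show ?thesis using 1 2 3 by blast
  qed
qed

end
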